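(* Let $A$ be a unital finitely generated $\mathrm{C}^*$-algebra with a coassociative unital $*$-homomorphism $\Delta_A\colon A\to A\otimes A$ (so that $\mathscr{QS}(A)$ is a compact quantum semigroup), let $B=\mathbb{C}^n$ with standard basis $e_1,\dots,e_n$, let $C=A^{\star n}$ with canonical inclusions $\iota_1,\dots,\iota_n\colon A\hookrightarrow C$, and let $\Phi\colon A\to B\otimes C$, $\Phi(a)=\sum_{i=1}^n e_i\otimes\iota_i(a)$, be the quantum family of all maps $\mathscr{QS}(B)\to\mathscr{QS}(A)$. Let $\Gamma\colon C\to C\otimes C$ be the unique unital $*$-homomorphism such that $$(\mathrm{id}\otimes\Gamma)\circ\Phi=(\mu\otimes\mathrm{id}\otimes\mathrm{id})\circ(\mathrm{id}\otimes\chi\otimes\mathrm{id})\circ(\Phi\otimes\Phi)\circ\Delta_A,$$ where $\chi\colon C\otimes B\to B\otimes C$ is the flip and $\mu\colon B\otimes B\to B$ is the multiplication map. Let $\Delta\colon C\to C\otimes C$ be the free product comultiplication on $C=A^{\star n}$, i.e. the unique coassociative unital $*$-homomorphism such that $\Delta\circ\iota_k=(\iota_k\otimes\iota_k)\circ\Delta_A$ for $k=1,\dots,n$. Then $\Gamma=\Delta$.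
   Context: For a $\mathrm{C}^*$-algebra $A$, $\mathscr{QS}(A)$ denotes the corresponding quantum space (a formal object dual to $A$); $\otimes$ is the minimal tensor product. Coassociative means $(\Delta_A\otimes\mathrm{id})\circ\Delta_A=(\mathrm{id}\otimes\Delta_A)\circ\Delta_A$; a compact quantum semigroup is a unital $\mathrm{C}^*$-algebra with a coassociative unital $*$-homomorphism $A\to A\otimes A$. The quantum family of all maps $\mathscr{QS}(B)\to\mathscr{QS}(A)$ is the pair $(C,\Phi)$, with $C$ a unital $\mathrm{C}^*$-algebra and $\Phi\colon A\to B\otimes C$ a unital $*$-homomorphism, characterized (up to isomorphism) by: for every unital $\mathrm{C}^*$-algebra $D$ and every unital $*$-homomorphism $\Psi\colon A\to B\otimes D$ there is a unique unital $*$-homomorphism $\Lambda\colon C\to D$ with $(\mathrm{id}\otimes\Lambda)\circ\Phi=\Psi$. For $B=\mathbb{C}^n$ it is given by $C=A^{\star n}$ and the formula for $\Phi$ in the claim; the existence and uniqueness of $\Gamma$ follow from this universal property. Here $A^{\star n}$ is the universal (full) unital free product of $n$ copies of $A$, amalgamated over the multiples of the unit. *)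

theory Defs
  imports
    "HOL-Algebra.Module"
    "HOL-Algebra.Algebraic_Closure_Type"
    "HOL-Analysis.Abstract_Metric_Spaces"
    "HOL-Analysis.Infinite_Sum"
begin

hide_const (open) Multiset.mult Polynomial.smult

section \<open>Unital C*-algebras\<close>

text \<open>
  Algebras are records with explicit carriers, so that one can quantify over all C*-algebras
  carried by subsets of a given type. All C*-algebras occurring in the main statement live on
  one type \<open>'u\<close>, which plays the role of a universe of points; since algebras only matter up to
  isomorphism, this is no restriction as long as \<open>'u\<close> has enough elements (for a
  finitely generated, hence separable, nonzero algebra any type that can carry it is large enough
  to carry isomorphic copies of all algebras derived from it).
\<close>

record 'a cstar_alg = "(complex, 'a) module" +
  star :: "'a \<Rightarrow> 'a"
  cnorm :: "'a \<Rightarrow> real"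

text \<open>Extended by 0 outside the carrier, as \<^locale>\<open>Metric_space\<close> wants total nonnegativity
  and symmetry.\<close>

definition cdist :: "('a, 'm) cstar_alg_scheme \<Rightarrow> 'a \<Rightarrow> 'a \<Rightarrow> real" where
  "cdist A x y = (if x \<in> carrier A \<and> y \<in> carrier A then cnorm A (x \<ominus>\<^bsub>A\<^esub> y) else 0)"

abbreviation ctopology :: "('a, 'm) cstar_alg_scheme \<Rightarrow> 'a topology" where
  "ctopology A \<equiv> Metric_space.mtopology (carrier A) (cdist A)"

text \<open>The zero algebra, in which the unit is 0, is allowed.\<close>

locale cstar_algebra =
  ring A + module "ring_of_type_algebra :: complex ring" A
    for A :: "('a, 'm) cstar_alg_scheme" (structure) +
  assumes smult_mult_left: "\<lbrakk>x \<in> carrier A; y \<in> carrier A\<rbrakk> \<Longrightarrow> (c \<odot> x) \<otimes> y = c \<odot> (x \<otimes> y)"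
    and smult_mult_right: "\<lbrakk>x \<in> carrier A; y \<in> carrier A\<rbrakk> \<Longrightarrow> x \<otimes> (c \<odot> y) = c \<odot> (x \<otimes> y)"
    and star_closed: "x \<in> carrier A \<Longrightarrow> star A x \<in> carrier A"
    and star_star: "x \<in> carrier A \<Longrightarrow> star A (star A x) = x"
    and star_add: "\<lbrakk>x \<in> carrier A; y \<in> carrier A\<rbrakk> \<Longrightarrow> star A (x \<oplus> y) = star A x \<oplus> star A y"
    and star_smult: "x \<in> carrier A \<Longrightarrow> star A (c \<odot> x) = cnj c \<odot> star A x"
    and star_mult: "\<lbrakk>x \<in> carrier A; y \<in> carrier A\<rbrakk> \<Longrightarrow> star A (x \<otimes> y) = star A y \<otimes> star A x"
    and norm_nonneg: "x \<in> carrier A \<Longrightarrow> 0 \<le> cnorm A x"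
    and norm_eq_zero: "x \<in> carrier A \<Longrightarrow> cnorm A x = 0 \<longleftrightarrow> x = \<zero>"
    and norm_add: "\<lbrakk>x \<in> carrier A; y \<in> carrier A\<rbrakk> \<Longrightarrow> cnorm A (x \<oplus> y) \<le> cnorm A x + cnorm A y"
    and norm_smult: "x \<in> carrier A \<Longrightarrow> cnorm A (c \<odot> x) = cmod c * cnorm A x"
    and norm_mult: "\<lbrakk>x \<in> carrier A; y \<in> carrier A\<rbrakk> \<Longrightarrow> cnorm A (x \<otimes> y) \<le> cnorm A x * cnorm A y"
    and cstar_identity: "x \<in> carrier A \<Longrightarrow> cnorm A (star A x \<otimes> x) = (cnorm A x)\<^sup>2"
    and complete: "Metric_space.mcomplete (carrier A) (cdist A)"

text \<open>Unital *-homomorphisms; being extensional, they are equal as soon as they agree on the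
  carrier.\<close>

definition cstar_hom :: "('a, 'm) cstar_alg_scheme \<Rightarrow> ('b, 'n) cstar_alg_scheme \<Rightarrow> ('a \<Rightarrow> 'b) set" where
  "cstar_hom A B = {\<phi> \<in> ring_hom A B \<inter> extensional (carrier A).
     (\<forall>c. \<forall>x \<in> carrier A. \<phi> (c \<odot>\<^bsub>A\<^esub> x) = c \<odot>\<^bsub>B\<^esub> \<phi> x) \<and>
     (\<forall>x \<in> carrier A. \<phi> (star A x) = star B (\<phi> x))}"

definition cstar_iso :: "('a, 'm) cstar_alg_scheme \<Rightarrow> ('b, 'n) cstar_alg_scheme \<Rightarrow> ('a \<Rightarrow> 'b) set" where
  "cstar_iso A B = {\<phi> \<in> cstar_hom A B. bij_betw \<phi> (carrier A) (carrier B)}"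

definition id_hom :: "('a, 'm) cstar_alg_scheme \<Rightarrow> 'a \<Rightarrow> 'a" where
  "id_hom A = (\<lambda>x \<in> carrier A. x)"

definition closed_star_subalgebra :: "('a, 'm) cstar_alg_scheme \<Rightarrow> 'a set \<Rightarrow> bool" where
  "closed_star_subalgebra A M \<longleftrightarrow>
     closedin (ctopology A) M \<and> \<one>\<^bsub>A\<^esub> \<in> M \<and>
     (\<forall>x \<in> M. \<forall>y \<in> M. x \<oplus>\<^bsub>A\<^esub> y \<in> M \<and> x \<otimes>\<^bsub>A\<^esub> y \<in> M) \<and>
     (\<forall>c. \<forall>x \<in> M. c \<odot>\<^bsub>A\<^esub> x \<in> M) \<and> (\<forall>x \<in> M. star A x \<in> M)"

definition finitely_generated :: "('a, 'm) cstar_alg_scheme \<Rightarrow> bool" where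
  "finitely_generated A \<longleftrightarrow>
     (\<exists>S. finite S \<and> S \<subseteq> carrier A \<and>
        (\<forall>M. closed_star_subalgebra A M \<and> S \<subseteq> M \<longrightarrow> M = carrier A))"

text \<open>The algebra of complex n-tuples, with indices running from 1 to n.\<close>

definition complex_power :: "nat \<Rightarrow> (nat \<Rightarrow> complex) cstar_alg" where
  "complex_power n =
    \<lparr>carrier = {1..n} \<rightarrow>\<^sub>E UNIV,
     mult = (\<lambda>x y. \<lambda>i \<in> {1..n}. x i * y i), one = (\<lambda>i \<in> {1..n}. 1),
     zero = (\<lambda>i \<in> {1..n}. 0), add = (\<lambda>x y. \<lambda>i \<in> {1..n}. x i + y i),
     smult = (\<lambda>c x. \<lambda>i \<in> {1..n}. c * x i),
     star = (\<lambda>x. \<lambda>i \<in> {1..n}. cnj (x i)),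
     cnorm = (\<lambda>x. Max (insert 0 ((\<lambda>i. cmod (x i)) ` {1..n})))\<rparr>"

definition unit_vec :: "nat \<Rightarrow> nat \<Rightarrow> nat \<Rightarrow> complex" where
  "unit_vec n i = (\<lambda>k \<in> {1..n}. if k = i then 1 else 0)"


section \<open>Minimal tensor products\<close>

definition l2 :: "('i \<Rightarrow> complex) set" where
  "l2 = {f. (\<lambda>i. (cmod (f i))\<^sup>2) summable_on UNIV}"

definition l2_norm :: "('i \<Rightarrow> complex) \<Rightarrow> real" where
  "l2_norm f = sqrt (\<Sum>\<^sub>\<infinity>i. (cmod (f i))\<^sup>2)"

definition l2_inner :: "('i \<Rightarrow> complex) \<Rightarrow> ('i \<Rightarrow> complex) \<Rightarrow> complex" where
  "l2_inner f g = (\<Sum>\<^sub>\<infinity>i. cnj (f i) * g i)"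

definition l2_bounded_operator :: "(('i \<Rightarrow> complex) \<Rightarrow> ('i \<Rightarrow> complex)) \<Rightarrow> bool" where
  "l2_bounded_operator S \<longleftrightarrow>
     (\<forall>f \<in> l2. S f \<in> l2) \<and>
     (\<forall>f \<in> l2. \<forall>g \<in> l2. S (\<lambda>i. f i + g i) = (\<lambda>i. S f i + S g i)) \<and>
     (\<forall>c. \<forall>f \<in> l2. S (\<lambda>i. c * f i) = (\<lambda>i. c * S f i)) \<and>
     (\<exists>K. \<forall>f \<in> l2. l2_norm (S f) \<le> K * l2_norm f)"

text \<open>*-representations, possibly degenerate (not unital), on the Hilbert space of
  square-summable families indexed by the type on which the algebra lives. A cyclic
  representation of an algebra \<open>A\<close> has Hilbert dimension at most the cardinality of \<open>A\<close>, so up to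
  isomorphism every cyclic representation, extended by 0, is of this form.\<close>

definition star_rep :: "('u, 'm) cstar_alg_scheme \<Rightarrow> ('u \<Rightarrow> ('u \<Rightarrow> complex) \<Rightarrow> ('u \<Rightarrow> complex)) \<Rightarrow> bool" where
  "star_rep A \<pi> \<longleftrightarrow>
     (\<forall>a \<in> carrier A. l2_bounded_operator (\<pi> a)) \<and>
     (\<forall>a \<in> carrier A. \<forall>b \<in> carrier A. \<forall>f \<in> l2.
        \<pi> (a \<oplus>\<^bsub>A\<^esub> b) f = (\<lambda>i. \<pi> a f i + \<pi> b f i) \<and> \<pi> (a \<otimes>\<^bsub>A\<^esub> b) f = \<pi> a (\<pi> b f)) \<and>
     (\<forall>c. \<forall>a \<in> carrier A. \<forall>f \<in> l2. \<pi> (c \<odot>\<^bsub>A\<^esub> a) f = (\<lambda>i. c * \<pi> a f i)) \<and>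
     (\<forall>a \<in> carrier A. \<forall>f \<in> l2. \<forall>g \<in> l2. l2_inner (\<pi> (star A a) f) g = l2_inner f (\<pi> a g))"

text \<open>The spatial norm of \<open>\<Sum>i<m. a i \<otimes> b i\<close> in the algebraic tensor product: the supremum, over
  all pairs of *-representations, of the operator norm of \<open>\<Sum>i<m. \<pi> (a i) \<otimes> \<rho> (b i)\<close>, which acts on
  the Hilbert space tensor product, i.e. on the square-summable families indexed by \<open>'u \<times> 'u\<close>,
  with \<open>f \<otimes> g = (\<lambda>(x, y). f x * g y)\<close>. The operator norm is computed on the unit vectors in
  the dense subspace of finite sums \<open>\<Sum>j<k. f j \<otimes> g j\<close>.\<close>

definition spatial_norm ::
  "('u, 'm) cstar_alg_scheme \<Rightarrow> ('u, 'n) cstar_alg_scheme \<Rightarrow> nat \<Rightarrow> (nat \<Rightarrow> 'u) \<Rightarrow> (nat \<Rightarrow> 'u) \<Rightarrow> real" where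
  "spatial_norm A B m a b = Sup
     {l2_norm (\<lambda>(x, y). \<Sum>i<m. \<Sum>j<k. \<pi> (a i) (f j) x * \<rho> (b i) (g j) y) | \<pi> \<rho> k f g.
        star_rep A \<pi> \<and> star_rep B \<rho> \<and>
        (\<forall>j<k. f j \<in> l2 \<and> g j \<in> l2) \<and>
        l2_norm (\<lambda>(x, y). \<Sum>j<(k::nat). f j x * g j y) \<le> 1}"

text \<open>\<open>T\<close>, with elementary tensors \<open>t a b\<close>, is the completion of the algebraic tensor product of
  \<open>A\<close> and \<open>B\<close> in the spatial norm.\<close>

definition is_minimal_tensor_product ::
  "'u cstar_alg \<Rightarrow> 'u cstar_alg \<Rightarrow> 'u cstar_alg \<Rightarrow> ('u \<Rightarrow> 'u \<Rightarrow> 'u) \<Rightarrow> bool" where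
  "is_minimal_tensor_product A B T t \<longleftrightarrow>
     cstar_algebra T \<and>
     (\<forall>a \<in> carrier A. \<forall>b \<in> carrier B. t a b \<in> carrier T) \<and>
     (\<forall>a \<in> carrier A. \<forall>a' \<in> carrier A. \<forall>b \<in> carrier B. t (a \<oplus>\<^bsub>A\<^esub> a') b = t a b \<oplus>\<^bsub>T\<^esub> t a' b) \<and>
     (\<forall>a \<in> carrier A. \<forall>b \<in> carrier B. \<forall>b' \<in> carrier B. t a (b \<oplus>\<^bsub>B\<^esub> b') = t a b \<oplus>\<^bsub>T\<^esub> t a b') \<and>
     (\<forall>c. \<forall>a \<in> carrier A. \<forall>b \<in> carrier B.
        t (c \<odot>\<^bsub>A\<^esub> a) b = c \<odot>\<^bsub>T\<^esub> t a b \<and> t a (c \<odot>\<^bsub>B\<^esub> b) = c \<odot>\<^bsub>T\<^esub> t a b) \<and>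
     (\<forall>a \<in> carrier A. \<forall>a' \<in> carrier A. \<forall>b \<in> carrier B. \<forall>b' \<in> carrier B.
        t (a \<otimes>\<^bsub>A\<^esub> a') (b \<otimes>\<^bsub>B\<^esub> b') = t a b \<otimes>\<^bsub>T\<^esub> t a' b') \<and>
     t \<one>\<^bsub>A\<^esub> \<one>\<^bsub>B\<^esub> = \<one>\<^bsub>T\<^esub> \<and>
     (\<forall>a \<in> carrier A. \<forall>b \<in> carrier B. t (star A a) (star B b) = star T (t a b)) \<and>
     (\<forall>m. \<forall>a \<in> {..<m} \<rightarrow> carrier A. \<forall>b \<in> {..<m} \<rightarrow> carrier B.
        cnorm T (\<Oplus>\<^bsub>T\<^esub>i \<in> {..<m}. t (a i) (b i)) = spatial_norm A B m a b) \<and>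
     ctopology T closure_of
       {\<Oplus>\<^bsub>T\<^esub>i \<in> {..<m}. t (a i) (b i) | (m::nat) a b.
          a \<in> {..<m} \<rightarrow> carrier A \<and> b \<in> {..<m} \<rightarrow> carrier B} = carrier T"

text \<open>
  The minimal tensor product is determined up to unique isomorphism only. A tensor system is a
  choice of a minimal tensor product (again on \<open>'u\<close>) for all pairs of unital C*-algebras on \<open>'u\<close>.
  Such a choice exists for every type \<open>'u\<close>: the cardinality \<open>\<kappa>\<close> of a nonzero Banach space
  satisfies \<open>\<kappa>\<^sup>\<omega> = \<kappa>\<close>, so the completed tensor product of two nonzero algebras is not larger
  than the larger one of them.
\<close>

record 'u tensor_system =
  tprod :: "'u cstar_alg \<Rightarrow> 'u cstar_alg \<Rightarrow> 'u cstar_alg" (infixl \<open>\<boxtimes>\<index>\<close> 70)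
  tens :: "'u cstar_alg \<Rightarrow> 'u cstar_alg \<Rightarrow> 'u \<Rightarrow> 'u \<Rightarrow> 'u"

locale minimal_tensor_system =
  fixes \<T> :: "'u tensor_system" (structure)
  assumes minimal_tensor_product:
    "\<lbrakk>cstar_algebra A; cstar_algebra B\<rbrakk> \<Longrightarrow> is_minimal_tensor_product A B (A \<boxtimes> B) (tens \<T> A B)"

text \<open>
  The structural maps below are the unique unital *-homomorphisms with the given values on elementary
  tensors; these exist because the minimal tensor product is functorial, associative and symmetric,
  and, for \<open>mult_map\<close>, only if the multiplication of the algebra extends to a *-homomorphism
  on the minimal tensor product, as it does for commutative algebras.
\<close>

definition hom_of_tensors ::
  "'u tensor_system \<Rightarrow> 'u cstar_alg \<Rightarrow> 'u cstar_alg \<Rightarrow> 'u cstar_alg \<Rightarrow> ('u \<Rightarrow> 'u \<Rightarrow> 'u) \<Rightarrow> 'u \<Rightarrow> 'u" where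
  "hom_of_tensors \<T> A B D h =
     (THE F. F \<in> cstar_hom (A \<boxtimes>\<^bsub>\<T>\<^esub> B) D \<and>
        (\<forall>a \<in> carrier A. \<forall>b \<in> carrier B. F (tens \<T> A B a b) = h a b))"

text \<open>\<open>\<phi> \<otimes> \<psi>\<close> for \<open>\<phi> : A \<rightarrow> A'\<close> and \<open>\<psi> : B \<rightarrow> B'\<close>\<close>

definition tensor_map ::
  "'u tensor_system \<Rightarrow> 'u cstar_alg \<Rightarrow> 'u cstar_alg \<Rightarrow> 'u cstar_alg \<Rightarrow> 'u cstar_alg
     \<Rightarrow> ('u \<Rightarrow> 'u) \<Rightarrow> ('u \<Rightarrow> 'u) \<Rightarrow> 'u \<Rightarrow> 'u" where
  "tensor_map \<T> A A' B B' \<phi> \<psi> =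
     hom_of_tensors \<T> A B (A' \<boxtimes>\<^bsub>\<T>\<^esub> B') (\<lambda>a b. tens \<T> A' B' (\<phi> a) (\<psi> b))"

definition flip_map :: "'u tensor_system \<Rightarrow> 'u cstar_alg \<Rightarrow> 'u cstar_alg \<Rightarrow> 'u \<Rightarrow> 'u" where
  "flip_map \<T> A B = hom_of_tensors \<T> A B (B \<boxtimes>\<^bsub>\<T>\<^esub> A) (\<lambda>a b. tens \<T> B A b a)"

definition mult_map :: "'u tensor_system \<Rightarrow> 'u cstar_alg \<Rightarrow> 'u \<Rightarrow> 'u" where
  "mult_map \<T> B = hom_of_tensors \<T> B B B (\<lambda>b b'. b \<otimes>\<^bsub>B\<^esub> b')"

definition assoc_map ::
  "'u tensor_system \<Rightarrow> 'u cstar_alg \<Rightarrow> 'u cstar_alg \<Rightarrow> 'u cstar_alg \<Rightarrow> 'u \<Rightarrow> 'u" where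
  "assoc_map \<T> A B C =
     (THE F. F \<in> cstar_hom ((A \<boxtimes>\<^bsub>\<T>\<^esub> B) \<boxtimes>\<^bsub>\<T>\<^esub> C) (A \<boxtimes>\<^bsub>\<T>\<^esub> (B \<boxtimes>\<^bsub>\<T>\<^esub> C)) \<and>
        (\<forall>a \<in> carrier A. \<forall>b \<in> carrier B. \<forall>c \<in> carrier C.
           F (tens \<T> (A \<boxtimes>\<^bsub>\<T>\<^esub> B) C (tens \<T> A B a b) c) =
             tens \<T> A (B \<boxtimes>\<^bsub>\<T>\<^esub> C) a (tens \<T> B C b c)))"

definition assoc_inv_map ::
  "'u tensor_system \<Rightarrow> 'u cstar_alg \<Rightarrow> 'u cstar_alg \<Rightarrow> 'u cstar_alg \<Rightarrow> 'u \<Rightarrow> 'u" where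
  "assoc_inv_map \<T> A B C =
     (THE F. F \<in> cstar_hom (A \<boxtimes>\<^bsub>\<T>\<^esub> (B \<boxtimes>\<^bsub>\<T>\<^esub> C)) ((A \<boxtimes>\<^bsub>\<T>\<^esub> B) \<boxtimes>\<^bsub>\<T>\<^esub> C) \<and>
        (\<forall>a \<in> carrier A. \<forall>b \<in> carrier B. \<forall>c \<in> carrier C.
           F (tens \<T> A (B \<boxtimes>\<^bsub>\<T>\<^esub> C) a (tens \<T> B C b c)) =
             tens \<T> (A \<boxtimes>\<^bsub>\<T>\<^esub> B) C (tens \<T> A B a b) c))"

text \<open>The map \<open>id \<otimes> \<chi> \<otimes> id\<close> with \<open>\<chi> : C \<otimes> B \<rightarrow> B \<otimes> C\<close> the flip, with explicit bracketing:
  \<open>(B \<otimes> C) \<otimes> (B \<otimes> C) \<rightarrow> B \<otimes> (C \<otimes> (B \<otimes> C)) \<rightarrow> B \<otimes> ((C \<otimes> B) \<otimes> C) \<rightarrow> B \<otimes> ((B \<otimes> C) \<otimes> C)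
  \<rightarrow> B \<otimes> (B \<otimes> (C \<otimes> C)) \<rightarrow> (B \<otimes> B) \<otimes> (C \<otimes> C)\<close>.\<close>

definition middle_flip_map :: "'u tensor_system \<Rightarrow> 'u cstar_alg \<Rightarrow> 'u cstar_alg \<Rightarrow> 'u \<Rightarrow> 'u"
  where
  "middle_flip_map \<T> B C =
     assoc_inv_map \<T> B B (C \<boxtimes> C)
     \<circ> tensor_map \<T> B B ((B \<boxtimes> C) \<boxtimes> C) (B \<boxtimes> (C \<boxtimes> C)) (id_hom B) (assoc_map \<T> B C C)
     \<circ> tensor_map \<T> B B ((C \<boxtimes> B) \<boxtimes> C) ((B \<boxtimes> C) \<boxtimes> C) (id_hom B)
         (tensor_map \<T> (C \<boxtimes> B) (B \<boxtimes> C) C C (flip_map \<T> C B) (id_hom C))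
     \<circ> tensor_map \<T> B B (C \<boxtimes> (B \<boxtimes> C)) ((C \<boxtimes> B) \<boxtimes> C) (id_hom B) (assoc_inv_map \<T> C B C)
     \<circ> assoc_map \<T> B C (B \<boxtimes> C)" for \<T> (structure)


section \<open>Comultiplications and free products\<close>

definition coassociative :: "'u tensor_system \<Rightarrow> 'u cstar_alg \<Rightarrow> ('u \<Rightarrow> 'u) \<Rightarrow> bool" where
  "coassociative \<T> A \<Delta> \<longleftrightarrow>
     (\<forall>a \<in> carrier A.
        assoc_map \<T> A A A (tensor_map \<T> A (A \<boxtimes> A) A A \<Delta> (id_hom A) (\<Delta> a)) =
        tensor_map \<T> A A A (A \<boxtimes> A) (id_hom A) \<Delta> (\<Delta> a))" for \<T> (structure)

definition compact_quantum_semigroup :: "'u tensor_system \<Rightarrow> 'u cstar_alg \<Rightarrow> ('u \<Rightarrow> 'u) \<Rightarrow> bool" where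
  "compact_quantum_semigroup \<T> A \<Delta> \<longleftrightarrow>
     cstar_algebra A \<and> \<Delta> \<in> cstar_hom A (A \<boxtimes> A) \<and> coassociative \<T> A \<Delta>" for \<T> (structure)

text \<open>\<open>C\<close> with \<open>\<iota> 1, \<dots>, \<iota> n\<close> is the universal unital free product of \<open>n\<close> copies of \<open>A\<close>, i.e. their
  coproduct in the category of unital C*-algebras and unital *-homomorphisms. The test algebras
  \<open>D\<close> range over all unital C*-algebras on \<open>'u\<close>.\<close>

definition is_free_power :: "'u cstar_alg \<Rightarrow> nat \<Rightarrow> 'u cstar_alg \<Rightarrow> (nat \<Rightarrow> 'u \<Rightarrow> 'u) \<Rightarrow> bool" where
  "is_free_power A n C \<iota> \<longleftrightarrow>
     cstar_algebra C \<and> (\<forall>k \<in> {1..n}. \<iota> k \<in> cstar_hom A C) \<and>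
     (\<forall>D :: 'u cstar_alg. \<forall>\<psi>. cstar_algebra D \<and> (\<forall>k \<in> {1..n}. \<psi> k \<in> cstar_hom A D) \<longrightarrow>
        (\<exists>!\<Lambda>. \<Lambda> \<in> cstar_hom C D \<and> (\<forall>k \<in> {1..n}. \<forall>a \<in> carrier A. \<Lambda> (\<iota> k a) = \<psi> k a)))"

definition all_maps_family ::
  "'u tensor_system \<Rightarrow> 'u cstar_alg \<Rightarrow> nat \<Rightarrow> 'u cstar_alg \<Rightarrow> (nat \<Rightarrow> 'u) \<Rightarrow> 'u cstar_alg
     \<Rightarrow> (nat \<Rightarrow> 'u \<Rightarrow> 'u) \<Rightarrow> 'u \<Rightarrow> 'u" where
  "all_maps_family \<T> A n B e C \<iota> =
     (\<lambda>a \<in> carrier A. \<Oplus>\<^bsub>B \<boxtimes>\<^bsub>\<T>\<^esub> C\<^esub>i \<in> {1..n}. tens \<T> B C (e i) (\<iota> i a))"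

end

theory Submission
  imports Defs "HOL-Analysis.Bounded_Linear_Function"
begin

hide_const (open) Multiset.mult Polynomial.smult

text \<open>
  Both \<open>\<Gamma>\<close> and \<open>\<Delta>\<close> are homomorphisms on the free power \<open>C\<close>; so it suffices to compare them on the elements
  \<open>\<iota>\<^sub>k(a)\<close>. On \<open>a \<otimes> a'\<close>, the map \<open>\<Phi> \<otimes> \<Phi>\<close> followed by the flip of the middle factors and the multiplication of \<open>B\<close>
  gives \<open>\<Sum>\<^sub>k\<^sub>l e\<^sub>k e\<^sub>l \<otimes> \<iota>\<^sub>k(a) \<otimes> \<iota>\<^sub>l(a')\<close>. As the \<open>e\<^sub>k\<close> are orthogonal projections, only the diagonal remains, and
  by linearity and continuity the defining identity of \<open>\<Gamma>\<close> reads
  \<open>\<Sum>\<^sub>k e\<^sub>k \<otimes> \<Gamma>(\<iota>\<^sub>k(a)) = \<Sum>\<^sub>k e\<^sub>k \<otimes> (\<iota>\<^sub>k \<otimes> \<iota>\<^sub>k)(\<Delta>\<^sub>A(a))\<close>. Comparison of components gives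
  \<open>\<Gamma>(\<iota>\<^sub>k(a)) = (\<iota>\<^sub>k \<otimes> \<iota>\<^sub>k)(\<Delta>\<^sub>A(a)) = \<Delta>(\<iota>\<^sub>k(a))\<close>. This is \<open>component_formula\<close> and \<open>components_eq\<close>.

  Most of the work is to show that the maps in this computation exist. The structural maps of the tensor system are
  definite descriptions, and denote the intended homomorphisms only if there is exactly one homomorphism with the
  prescribed values on elementary tensors. Uniqueness holds because elementary tensors have dense span and morphisms
  of C*-algebras are contractive (\<open>star_morphism_contractive\<close>). Existence is by extension from a dense subalgebra
  (\<open>star_morphism_extension\<close>), which requires a bound in terms of the spatial norm.

  These bounds come from representations. The product of representations \<open>\<phi>\<close> of \<open>U\<close> and \<open>\<psi>\<close> of \<open>V\<close> extends to a
  representation of the completed tensor product (\<open>product_rep\<close>), and the norm of any element of the completion is the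
  supremum of its norms under such products (\<open>norm_le_product_reps\<close>). Hence whatever allows representations
  of the factors to be pulled back, such as a morphism or evaluation of a factor \<open>B\<close> at one of its points, induces a
  contractive map of tensor products (\<open>tensor_relation_morphism\<close>); for the flip, the two Hilbert spaces are
  exchanged (\<open>flip_morphism\<close>).

  All associators that occur move a factor \<open>B = \<complex>\<^sup>n\<close>. They have the form \<open>\<Sum>\<^sub>k J\<^sub>k \<circ> S\<^sub>k\<close>, where \<open>S\<^sub>k\<close> evaluates this
  factor at the point \<open>k\<close> and \<open>J\<^sub>k\<close> inserts \<open>e\<^sub>k\<close> at the new place (\<open>sum_of_slices_hom\<close>); so they follow from
  functoriality. Components can be compared because evaluation at \<open>k\<close> is a bounded map from \<open>B \<otimes> (C \<otimes> C)\<close> to \<open>C \<otimes> C\<close>,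
  whose norm is detected by representations on \<open>\<ell>\<^sup>2('u)\<close>: the products of representations act on
  \<open>\<ell>\<^sup>2('u \<times> 'u)\<close>, and there is a bijection between \<open>'u \<times> 'u\<close> and \<open>'u\<close> if \<open>'u\<close> is infinite
  (\<open>faithful_tensor_product\<close>). If \<open>'u\<close> is finite, it carries only zero algebras.
\<close>

section \<open>Limits in a C*-algebra\<close>

context cstar_algebra
begin

lemma is_ring: "ring A"
  by unfold_locales

text \<open>The laws of \<open>A\<close>, which otherwise share their unqualified names with the laws of the scalar field, the
  second ring in scope.\<close>

lemmas minus_eq = abelian_group.minus_eq[OF ring.is_abelian_group[OF is_ring]]
  and minus_add = abelian_group.minus_add[OF ring.is_abelian_group[OF is_ring]]
  and minus_equality = abelian_group.minus_equality[OF ring.is_abelian_group[OF is_ring]]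
  and l_neg = abelian_group.l_neg[OF ring.is_abelian_group[OF is_ring]]
  and r_neg = abelian_group.r_neg[OF ring.is_abelian_group[OF is_ring]]
  and r_neg1 = abelian_group.r_neg1[OF ring.is_abelian_group[OF is_ring]]
  and r_right_minus_eq = ring.r_right_minus_eq[OF is_ring]
  and a_closed = ring.ring_simprules(1)[OF is_ring]
  and m_closed = ring.ring_simprules(5)[OF is_ring]
  and a_assoc = ring.ring_simprules(7)[OF is_ring]
  and a_comm = ring.ring_simprules(10)[OF is_ring]
  and a_lcomm = ring.ring_simprules(22)[OF is_ring]
  and m_assoc = ring.ring_simprules(11)[OF is_ring]
  and l_distr = ring.ring_simprules(13)[OF is_ring]
  and r_distr = ring.ring_simprules(23)[OF is_ring]
  and l_minus = ring.ring_simprules(26)[OF is_ring]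
  and r_minus = ring.ring_simprules(27)[OF is_ring]

lemmas a_ac = a_assoc a_comm a_lcomm

lemma is_abelian_monoid: "abelian_monoid A"
  by unfold_locales

lemmas finsum_closed = abelian_monoid.finsum_closed[OF is_abelian_monoid]
  and finsum_insert = abelian_monoid.finsum_insert[OF is_abelian_monoid]
  and finsum_empty = abelian_monoid.finsum_empty[OF is_abelian_monoid]
  and finsum_cong' = abelian_monoid.finsum_cong'[OF is_abelian_monoid]
  and finsum_addf = abelian_monoid.finsum_addf[OF is_abelian_monoid]
  and finsum_singleton = abelian_monoid.finsum_singleton[OF is_abelian_monoid]

lemma smult_closed' [simp, intro]: "x \<in> carrier A \<Longrightarrow> c \<odot> x \<in> carrier A"
  using smult_closed[of c x] by (simp add: ring_of_type_algebra_def)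

lemma add_smult: "x \<in> carrier A \<Longrightarrow> (c + d) \<odot> x = c \<odot> x \<oplus> d \<odot> x"
  using smult_l_distr[of c d x] by (simp add: ring_of_type_algebra_def)

lemma smult_add: "\<lbrakk>x \<in> carrier A; y \<in> carrier A\<rbrakk> \<Longrightarrow> c \<odot> (x \<oplus> y) = c \<odot> x \<oplus> c \<odot> y"
  using smult_r_distr[of c x y] by (simp add: ring_of_type_algebra_def)

lemma smult_smult: "x \<in> carrier A \<Longrightarrow> c \<odot> (d \<odot> x) = (c * d) \<odot> x"
  using smult_assoc1[of c d x] by (simp add: ring_of_type_algebra_def)

lemma one_smult [simp]: "x \<in> carrier A \<Longrightarrow> 1 \<odot> x = x"
  using smult_one[of x] by (simp add: ring_of_type_algebra_def)

lemma zero_smult [simp]: "x \<in> carrier A \<Longrightarrow> 0 \<odot> x = \<zero>"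
  using smult_l_null[of x] by (simp add: ring_of_type_algebra_def)

lemma smult_zero [simp]: "c \<odot> \<zero> = \<zero>"
  using smult_r_null[of c] by (simp add: ring_of_type_algebra_def)

lemma minus_eq_smult: "x \<in> carrier A \<Longrightarrow> \<ominus> x = (-1) \<odot> x"
  using add_smult[of x 1 "-1"] minus_equality[of "(-1) \<odot> x" x]
  by (simp add: a_comm)

declare star_closed [simp, intro]

lemma star_zero [simp]: "star A \<zero> = \<zero>"
  using star_smult[of \<zero> 0] by simp

lemma star_one [simp]: "star A \<one> = \<one>"
  using star_mult[of "star A \<one>" \<one>] by (simp add: star_star)

lemma norm_zero [simp]: "cnorm A \<zero> = 0"
  by (simp add: norm_eq_zero)

lemma norm_minus: "x \<in> carrier A \<Longrightarrow> cnorm A (\<ominus> x) = cnorm A x"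
  by (simp add: minus_eq_smult norm_smult)

lemma norm_diff_commute:
  assumes "x \<in> carrier A" "y \<in> carrier A"
  shows "cnorm A (x \<ominus> y) = cnorm A (y \<ominus> x)"
proof -
  have "x \<ominus> y = \<ominus> (y \<ominus> x)"
    using assms by (simp add: minus_eq minus_add a_comm)
  then show ?thesis
    using assms norm_minus[of "y \<ominus> x"] by simp
qed

lemma norm_diff_triangle:
  assumes "x \<in> carrier A" "y \<in> carrier A" "z \<in> carrier A"
  shows "cnorm A (x \<ominus> z) \<le> cnorm A (x \<ominus> y) + cnorm A (y \<ominus> z)"
proof -
  have "x \<ominus> z = (x \<ominus> y) \<oplus> (y \<ominus> z)"
    using assms by (simp add: minus_eq a_assoc r_neg1)
  then show ?thesis
    using assms norm_add[of "x \<ominus> y" "y \<ominus> z"] by simp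
qed

lemma norm_le_diff:
  assumes "x \<in> carrier A" "y \<in> carrier A"
  shows "cnorm A x \<le> cnorm A y + cnorm A (x \<ominus> y)"
proof -
  have "x = y \<oplus> (x \<ominus> y)"
    using assms by (simp add: minus_eq a_lcomm r_neg)
  then show ?thesis
    using assms norm_add[of y "x \<ominus> y"] by simp
qed

lemma diff_eq_zero_iff:
  assumes "x \<in> carrier A" "y \<in> carrier A"
  shows "x \<ominus> y = \<zero> \<longleftrightarrow> x = y"
  using assms by (rule r_right_minus_eq)

lemma norm_star: 
  assumes "x \<in> carrier A"
  shows "cnorm A (star A x) = cnorm A x"
proof -
  have le: "cnorm A y \<le> cnorm A (star A y)" if "y \<in> carrier A" for y
  proof -
    have "(cnorm A y)\<^sup>2 \<le> cnorm A (star A y) * cnorm A y"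
      using that norm_mult[of "star A y" y] by (simp add: cstar_identity)
    then show ?thesis
      using norm_nonneg[OF that] norm_nonneg[OF star_closed[OF that]]
      by (cases "cnorm A y = 0") (auto simp: power2_eq_square)
  qed
  show ?thesis
    using le[of x] le[of "star A x"] assms by (simp add: star_star)
qed

lemma norm_projection_le_one:
  assumes "p \<in> carrier A" "star A p = p" "p \<otimes> p = p"
  shows "cnorm A p \<le> 1"
proof -
  have "(cnorm A p)\<^sup>2 = cnorm A p"
    using cstar_identity[of p] assms by simp
  then show ?thesis by (auto simp: power2_eq_square)
qed

lemma norm_selfadjoint_square:
  assumes "x \<in> carrier A" "star A x = x"
  shows "cnorm A (x \<otimes> x) = (cnorm A x)\<^sup>2"
  using cstar_identity[of x] assms by simp

lemma Metric_space_cdist: "Metric_space (carrier A) (cdist A)"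
proof
  fix x y z
  show "0 \<le> cdist A x y" by (simp add: cdist_def norm_nonneg)
  show "cdist A x y = cdist A y x" by (simp add: cdist_def norm_diff_commute)
  show "cdist A x y = 0 \<longleftrightarrow> x = y" if "x \<in> carrier A" "y \<in> carrier A"
    using that by (simp add: cdist_def norm_eq_zero diff_eq_zero_iff)
  show "cdist A x z \<le> cdist A x y + cdist A y z"
    if "x \<in> carrier A" "y \<in> carrier A" "z \<in> carrier A"
    using that by (simp add: cdist_def norm_diff_triangle)
qed

definition lim :: "(nat \<Rightarrow> 'a) \<Rightarrow> 'a \<Rightarrow> bool" where
  "lim x l \<longleftrightarrow> (\<forall>n. x n \<in> carrier A) \<and> l \<in> carrier A \<and> (\<lambda>n. cnorm A (x n \<ominus> l)) \<longlonglongrightarrow> 0"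

lemma limI:
  assumes "\<And>n. x n \<in> carrier A" "l \<in> carrier A"
    and "\<And>n. cnorm A (x n \<ominus> l) \<le> f n" "f \<longlonglongrightarrow> 0"
  shows "lim x l"
  unfolding lim_def using assms
  by (auto intro!: tendsto_sandwich[OF _ _ tendsto_const assms(4)] always_eventually norm_nonneg)

lemma lim_const: "l \<in> carrier A \<Longrightarrow> lim (\<lambda>n. l) l"
  by (simp add: lim_def minus_eq r_neg)

lemma lim_closed: "lim x l \<Longrightarrow> x n \<in> carrier A" "lim x l \<Longrightarrow> l \<in> carrier A"
  by (simp_all add: lim_def)

lemma lim_norm:
  assumes "lim x l"
  shows "(\<lambda>n. cnorm A (x n)) \<longlonglongrightarrow> cnorm A l"
proof (rule LIM_zero_cancel, rule Lim_null_comparison)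
  show "\<forall>\<^sub>F n in sequentially. norm (cnorm A (x n) - cnorm A l) \<le> cnorm A (x n \<ominus> l)"
    using lim_closed[OF assms] norm_le_diff[of "x _" l] norm_le_diff[of l "x _"]
      norm_diff_commute[of l "x _"] by (intro always_eventually allI) (simp add: abs_le_iff algebra_simps)
  show "(\<lambda>n. cnorm A (x n \<ominus> l)) \<longlonglongrightarrow> 0"
    using assms by (simp add: lim_def)
qed

lemma lim_unique:
  assumes "lim x l" "lim x l'"
  shows "l = l'"
proof -
  note c = lim_closed[OF assms(1)] lim_closed[OF assms(2)]
  have lim: "(\<lambda>n. cnorm A (x n \<ominus> l) + cnorm A (x n \<ominus> l')) \<longlonglongrightarrow> 0 + 0"
    using assms unfolding lim_def by (intro tendsto_add) auto
  have le: "cnorm A (l \<ominus> l') \<le> cnorm A (x n \<ominus> l) + cnorm A (x n \<ominus> l')" for n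
    using norm_diff_triangle[of l "x n" l'] c by (simp add: norm_diff_commute[of l "x n"])
  have "cnorm A (l \<ominus> l') \<le> 0 + 0"
    by (rule LIMSEQ_le_const[OF lim]) (use le in blast)
  moreover have "0 \<le> cnorm A (l \<ominus> l')"
    using c by (intro norm_nonneg) simp
  ultimately have "cnorm A (l \<ominus> l') = 0"
    by linarith
  then show ?thesis
    using c by (simp add: norm_eq_zero diff_eq_zero_iff)
qed

lemma diff_add_distrib:
  assumes "a \<in> carrier A" "b \<in> carrier A" "c \<in> carrier A" "d \<in> carrier A"
  shows "(a \<oplus> b) \<ominus> (c \<oplus> d) = (a \<ominus> c) \<oplus> (b \<ominus> d)"
  using assms by (simp add: minus_eq minus_add a_ac)

lemma diff_mult_distrib:
  assumes "a \<in> carrier A" "b \<in> carrier A" "c \<in> carrier A" "d \<in> carrier A"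
  shows "(a \<otimes> b) \<ominus> (c \<otimes> d) = a \<otimes> (b \<ominus> d) \<oplus> (a \<ominus> c) \<otimes> d"
  using assms by (simp add: minus_eq r_distr l_distr r_minus l_minus a_assoc r_neg1)

lemma smult_diff:
  assumes "x \<in> carrier A" "y \<in> carrier A"
  shows "c \<odot> (x \<ominus> y) = c \<odot> x \<ominus> c \<odot> y"
  using assms by (simp add: minus_eq smult_add minus_eq_smult smult_smult mult.commute)

lemma star_diff:
  assumes "x \<in> carrier A" "y \<in> carrier A"
  shows "star A (x \<ominus> y) = star A x \<ominus> star A y"
  using assms by (simp add: minus_eq star_add minus_eq_smult star_smult)

lemma lim_add:
  assumes "lim x l" "lim y k"
  shows "lim (\<lambda>n. x n \<oplus> y n) (l \<oplus> k)"
proof (rule limI)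
  note c = lim_closed[OF assms(1)] lim_closed[OF assms(2)]
  show "cnorm A ((x n \<oplus> y n) \<ominus> (l \<oplus> k)) \<le> cnorm A (x n \<ominus> l) + cnorm A (y n \<ominus> k)" for n
    using c by (simp add: diff_add_distrib norm_add)
  show "(\<lambda>n. cnorm A (x n \<ominus> l) + cnorm A (y n \<ominus> k)) \<longlonglongrightarrow> 0"
    using assms unfolding lim_def by (intro tendsto_add_zero) auto
qed (use lim_closed[OF assms(1)] lim_closed[OF assms(2)] in auto)

lemma lim_smult:
  assumes "lim x l"
  shows "lim (\<lambda>n. c \<odot> x n) (c \<odot> l)"
proof (rule limI)
  show "cnorm A (c \<odot> x n \<ominus> c \<odot> l) \<le> cmod c * cnorm A (x n \<ominus> l)" for n
    using lim_closed[OF assms] by (simp flip: smult_diff add: norm_smult)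
  show "(\<lambda>n. cmod c * cnorm A (x n \<ominus> l)) \<longlonglongrightarrow> 0"
    using assms unfolding lim_def by (intro tendsto_mult_right_zero) auto
qed (use lim_closed[OF assms(1)] in auto)

lemma lim_star:
  assumes "lim x l"
  shows "lim (\<lambda>n. star A (x n)) (star A l)"
  using assms unfolding lim_def by (simp flip: star_diff add: norm_star)

lemma lim_mult:
  assumes "lim x l" "lim y k"
  shows "lim (\<lambda>n. x n \<otimes> y n) (l \<otimes> k)"
proof (rule limI)
  note c = lim_closed[OF assms(1)] lim_closed[OF assms(2)]
  show "cnorm A ((x n \<otimes> y n) \<ominus> (l \<otimes> k))
      \<le> cnorm A (x n) * cnorm A (y n \<ominus> k) + cnorm A (x n \<ominus> l) * cnorm A k" for n
    using c by (auto simp: diff_mult_distrib intro!: order_trans[OF norm_add] add_mono norm_mult)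
  have "(\<lambda>n. cnorm A (x n) * cnorm A (y n \<ominus> k) + cnorm A (x n \<ominus> l) * cnorm A k)
      \<longlonglongrightarrow> cnorm A l * 0 + 0 * cnorm A k"
    using assms unfolding lim_def by (intro tendsto_intros lim_norm[OF assms(1)]) auto
  then show "(\<lambda>n. cnorm A (x n) * cnorm A (y n \<ominus> k) + cnorm A (x n \<ominus> l) * cnorm A k) \<longlonglongrightarrow> 0"
    by simp
qed (use lim_closed[OF assms(1)] lim_closed[OF assms(2)] in auto)

lemma lim_Suc: "lim x l \<Longrightarrow> lim (\<lambda>n. x (Suc n)) l"
  unfolding lim_def using LIMSEQ_Suc[of "\<lambda>n. cnorm A (x n \<ominus> l)"] by auto

lemma Cauchy_imp_lim:
  assumes x: "\<And>n. x n \<in> carrier A"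
    and cauchy: "\<And>\<epsilon>. \<epsilon> > 0 \<Longrightarrow> \<exists>N. \<forall>m\<ge>N. \<forall>n\<ge>N. cnorm A (x m \<ominus> x n) < \<epsilon>"
  shows "\<exists>l. lim x l"
proof -
  interpret M: Metric_space "carrier A" "cdist A" by (rule Metric_space_cdist)
  have "M.MCauchy x"
    unfolding M.MCauchy_def using x cauchy by (auto simp: cdist_def)
  then obtain l where l: "limitin M.mtopology x l sequentially"
    using complete unfolding M.mcomplete_def by blast
  have "(\<lambda>n. cdist A (x n) l) \<longlonglongrightarrow> 0" "l \<in> carrier A"
    using l by (auto simp: M.limitin_metric_dist_null)
  then show ?thesis
    using x by (auto simp: lim_def cdist_def)
qed

lemma geometric_imp_lim:
  assumes x: "\<And>n. x n \<in> carrier A"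
    and step: "\<And>n. cnorm A (x (Suc n) \<ominus> x n) \<le> K * r ^ n"
    and r: "0 \<le> r" "r < 1"
  shows "\<exists>l. lim x l"
proof (rule Cauchy_imp_lim[OF x])
  fix \<epsilon> :: real assume \<epsilon>: "\<epsilon> > 0"
  have "summable (\<lambda>n. K * r ^ n)"
    using r by (intro summable_mult summable_geometric) auto
  then obtain N where N: "\<And>m n. m \<ge> N \<Longrightarrow> norm (\<Sum>i=m..<n. K * r ^ i) < \<epsilon>"
    unfolding summable_Cauchy using \<epsilon> by blast
  have le: "cnorm A (x n \<ominus> x m) \<le> (\<Sum>i=m..<n. K * r ^ i)" if "m \<le> n" for m n
    using that
  proof (induction n rule: dec_induct)
    case base
    then show ?case using x by (simp add: minus_eq r_neg)
  next
    case (step n)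
    have "cnorm A (x (Suc n) \<ominus> x m) \<le> cnorm A (x (Suc n) \<ominus> x n) + cnorm A (x n \<ominus> x m)"
      using x by (intro norm_diff_triangle) auto
    also have "\<dots> \<le> (\<Sum>i=m..<Suc n. K * r ^ i)"
      using step assms(2)[of n] by simp
    finally show ?case .
  qed
  have lt: "cnorm A (x n \<ominus> x m) < \<epsilon>" if "N \<le> m" "m \<le> n" for m n
    using le[OF that(2)] N[OF that(1), of n] by simp
  have "cnorm A (x m \<ominus> x n) < \<epsilon>" if "m \<ge> N" "n \<ge> N" for m n
    using lt[of m n] lt[of n m] that x norm_diff_commute[of "x m" "x n"]
    by (cases m n rule: le_cases) auto
  then show "\<exists>N. \<forall>m\<ge>N. \<forall>n\<ge>N. cnorm A (x m \<ominus> x n) < \<epsilon>" by blast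
qed

text \<open>A square root of \<open>1 - w\<close> is \<open>1 - z\<close> for the fixed point \<open>z\<close> of \<open>z \<mapsto> (w + z\<^sup>2) / 2\<close>, which is a
  contraction on the ball of radius \<open>\<parallel>w\<parallel>\<close>. As the limit of polynomials in \<open>w\<close>, it inherits
  self-adjointness and commutes with everything that commutes with \<open>w\<close>.\<close>

lemma sqrt_one_minus:
  assumes w: "w \<in> carrier A" "star A w = w" "cnorm A w < 1"
  obtains y where "y \<in> carrier A" "star A y = y" "y \<otimes> y = \<one> \<ominus> w"
    "\<And>a. a \<in> carrier A \<Longrightarrow> a \<otimes> w = w \<otimes> a \<Longrightarrow> a \<otimes> y = y \<otimes> a"
proof -
  define r where "r = cnorm A w"
  have r: "0 \<le> r" "r < 1" using w norm_nonneg by (auto simp: r_def)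
  define f where "f z = (1/2) \<odot> (w \<oplus> z \<otimes> z)" for z
  define z where "z n = (f ^^ n) \<zero>" for n
  have z_Suc: "z (Suc n) = f (z n)" for n by (simp add: z_def)
  have z0: "z 0 = \<zero>" by (simp add: z_def)
  have zc [simp]: "z n \<in> carrier A" for n
    by (induction n) (use w in \<open>auto simp: z_Suc z0 f_def\<close>)
  have zn: "cnorm A (z n) \<le> r" for n
  proof (induction n)
    case (Suc n)
    have "cnorm A (z (Suc n)) \<le> (1/2) * (r + cnorm A (z n) * cnorm A (z n))"
      using w norm_add[of w "z n \<otimes> z n"] norm_mult[of "z n" "z n"]
      by (simp add: z_Suc f_def norm_smult r_def)
    also have "\<dots> \<le> (1/2) * (r + r * 1)"
      using Suc r norm_nonneg[of "z n"] by (intro mult_left_mono add_mono mult_mono) auto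
    finally show ?case by simp
  qed (use r in \<open>simp add: z0\<close>)
  have step: "cnorm A (z (Suc n) \<ominus> z n) \<le> r * r ^ n" for n
  proof (induction n)
    case 0
    show ?case using zn[of 1] by (simp add: z0 minus_eq)
  next
    case (Suc n)
    let ?d = "z (Suc n) \<ominus> z n"
    have "z (Suc (Suc n)) \<ominus> z (Suc n) = (1/2) \<odot> ((w \<oplus> z (Suc n) \<otimes> z (Suc n)) \<ominus> (w \<oplus> z n \<otimes> z n))"
      using w zc by (subst (1 2) z_Suc) (simp add: f_def smult_diff del: zc)
    also have "\<dots> = (1/2) \<odot> (z (Suc n) \<otimes> ?d \<oplus> ?d \<otimes> z n)"
      using w by (simp add: diff_add_distrib diff_mult_distrib) (simp add: minus_eq r_neg)
    finally have "cnorm A (z (Suc (Suc n)) \<ominus> z (Suc n)) = (1/2) * cnorm A (z (Suc n) \<otimes> ?d \<oplus> ?d \<otimes> z n)"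
      by (simp add: norm_smult)
    also have "\<dots> \<le> (1/2) * (cnorm A (z (Suc n)) * cnorm A ?d + cnorm A ?d * cnorm A (z n))"
      by (intro mult_left_mono order_trans[OF norm_add] add_mono norm_mult) auto
    also have "\<dots> \<le> (1/2) * (r * cnorm A ?d + cnorm A ?d * r)"
      by (intro mult_left_mono add_mono mult_right_mono zn) (auto simp: norm_nonneg)
    also have "\<dots> \<le> r * (r * r ^ n)"
      using mult_left_mono[OF Suc r(1)] by (simp add: mult.commute)
    finally show ?case by simp
  qed
  obtain l where l: "lim z l"
    using geometric_imp_lim[OF zc step r] by blast
  have lc [simp]: "l \<in> carrier A" using l by (rule lim_closed)
  have "lim (\<lambda>n. f (z n)) (f l)"
    unfolding f_def by (intro lim_smult lim_add lim_mult lim_const w l)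
  then have "lim (\<lambda>n. z (Suc n)) (f l)"
    by (simp add: z_Suc)
  then have "f l = l"
    by (rule lim_unique[OF _ lim_Suc[OF l]])
  then have fix_l: "2 \<odot> l = w \<oplus> l \<otimes> l"
    using w smult_smult[of "w \<oplus> l \<otimes> l" 2 "1/2"] by (simp add: f_def)
  have star_z: "star A (z n) = z n" for n
    by (induction n) (use w in \<open>simp_all add: z_Suc z0 f_def star_add star_smult star_mult\<close>)
  then have "lim z (star A l)"
    using lim_star[OF l] by simp
  then have star_l: "star A l = l"
    by (rule lim_unique[OF _ l])
  have comm: "a \<otimes> l = l \<otimes> a" if a: "a \<in> carrier A" "a \<otimes> w = w \<otimes> a" for a
  proof -
    have "a \<otimes> z n = z n \<otimes> a" for n
    proof (induction n)
      case (Suc n)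
      have "a \<otimes> (z n \<otimes> z n) = (z n \<otimes> z n) \<otimes> a"
        using a Suc by (metis m_assoc zc)
      then show ?case
        using a w by (simp add: z_Suc f_def smult_mult_left smult_mult_right r_distr l_distr)
    qed (use a in \<open>simp add: z0\<close>)
    then have "lim (\<lambda>n. a \<otimes> z n) (l \<otimes> a)"
      using lim_mult[OF l lim_const[OF a(1)]] by simp
    then show ?thesis
      by (rule lim_unique[OF lim_mult[OF lim_const[OF a(1)] l]])
  qed
  have two: "2 \<odot> l = l \<oplus> l"
    using add_smult[of l 1 1] by simp
  show ?thesis
  proof (rule that[of "\<one> \<ominus> l"])
    have "l \<otimes> l = \<ominus> w \<oplus> (l \<oplus> l)"
      using w fix_l two by (simp add: a_assoc[symmetric] l_neg)
    moreover have "(\<one> \<ominus> l) \<otimes> (\<one> \<ominus> l) = \<one> \<ominus> (l \<oplus> l) \<oplus> l \<otimes> l"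
      by (simp add: minus_eq l_distr r_distr l_minus r_minus minus_add a_ac)
    moreover have "\<one> \<ominus> p \<oplus> (\<ominus> w \<oplus> p) = \<one> \<ominus> w" if "p \<in> carrier A" for p
      using w that by (subst a_comm[of "\<ominus> w" p]) (simp_all add: minus_eq a_assoc r_neg1)
    ultimately show "(\<one> \<ominus> l) \<otimes> (\<one> \<ominus> l) = \<one> \<ominus> w"
      by simp
    show "a \<otimes> (\<one> \<ominus> l) = (\<one> \<ominus> l) \<otimes> a" if "a \<in> carrier A" "a \<otimes> w = w \<otimes> a" for a
      using that comm[OF that] by (simp add: minus_eq l_distr r_distr l_minus r_minus)
  qed (simp_all add: star_diff star_l)
qed

end


section \<open>Morphisms and their extension by continuity\<close>

text \<open>Not necessarily unital *-homomorphisms; corner embeddings such as \<open>c \<mapsto> p \<otimes> c\<close> for a projection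
  \<open>p\<close>, and possibly degenerate representations, are of this kind.\<close>

definition star_morphism ::
  "('a, 'm) cstar_alg_scheme \<Rightarrow> ('b, 'n) cstar_alg_scheme \<Rightarrow> ('a \<Rightarrow> 'b) \<Rightarrow> bool" where
  "star_morphism A D \<phi> \<longleftrightarrow>
     (\<forall>x \<in> carrier A. \<phi> x \<in> carrier D) \<and>
     (\<forall>x \<in> carrier A. \<forall>y \<in> carrier A. \<phi> (x \<oplus>\<^bsub>A\<^esub> y) = \<phi> x \<oplus>\<^bsub>D\<^esub> \<phi> y) \<and>
     (\<forall>x \<in> carrier A. \<forall>y \<in> carrier A. \<phi> (x \<otimes>\<^bsub>A\<^esub> y) = \<phi> x \<otimes>\<^bsub>D\<^esub> \<phi> y) \<and>
     (\<forall>c. \<forall>x \<in> carrier A. \<phi> (c \<odot>\<^bsub>A\<^esub> x) = c \<odot>\<^bsub>D\<^esub> \<phi> x) \<and>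
     (\<forall>x \<in> carrier A. \<phi> (star A x) = star D (\<phi> x))"

lemma star_morphismD:
  assumes "star_morphism A D \<phi>"
  shows "x \<in> carrier A \<Longrightarrow> \<phi> x \<in> carrier D"
    and "\<lbrakk>x \<in> carrier A; y \<in> carrier A\<rbrakk> \<Longrightarrow> \<phi> (x \<oplus>\<^bsub>A\<^esub> y) = \<phi> x \<oplus>\<^bsub>D\<^esub> \<phi> y"
    and "\<lbrakk>x \<in> carrier A; y \<in> carrier A\<rbrakk> \<Longrightarrow> \<phi> (x \<otimes>\<^bsub>A\<^esub> y) = \<phi> x \<otimes>\<^bsub>D\<^esub> \<phi> y"
    and "x \<in> carrier A \<Longrightarrow> \<phi> (c \<odot>\<^bsub>A\<^esub> x) = c \<odot>\<^bsub>D\<^esub> \<phi> x"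
    and "x \<in> carrier A \<Longrightarrow> \<phi> (star A x) = star D (\<phi> x)"
  using assms by (simp_all add: star_morphism_def)

lemma cstar_hom_iff:
  "\<phi> \<in> cstar_hom A D \<longleftrightarrow> star_morphism A D \<phi> \<and> \<phi> \<one>\<^bsub>A\<^esub> = \<one>\<^bsub>D\<^esub> \<and> \<phi> \<in> extensional (carrier A)"
  by (auto simp: cstar_hom_def star_morphism_def ring_hom_def)

lemma star_morphism_comp:
  assumes "star_morphism A D \<phi>" "star_morphism D E \<psi>"
  shows "star_morphism A E (\<lambda>x. \<psi> (\<phi> x))"
  using assms by (simp add: star_morphism_def)

lemma star_morphism_zero:
  assumes "cstar_algebra A" "cstar_algebra D" "star_morphism A D \<phi>"
  shows "\<phi> \<zero>\<^bsub>A\<^esub> = \<zero>\<^bsub>D\<^esub>"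
proof -
  interpret A: cstar_algebra A by fact
  interpret D: cstar_algebra D by fact
  have "\<phi> (0 \<odot>\<^bsub>A\<^esub> \<zero>\<^bsub>A\<^esub>) = 0 \<odot>\<^bsub>D\<^esub> \<phi> \<zero>\<^bsub>A\<^esub>"
    by (rule star_morphismD(4)[OF assms(3)]) simp
  then show ?thesis
    using star_morphismD(1)[OF assms(3)] by simp
qed

lemma star_morphism_diff:
  assumes "cstar_algebra A" "cstar_algebra D" "star_morphism A D \<phi>"
    and "x \<in> carrier A" "y \<in> carrier A"
  shows "\<phi> (x \<ominus>\<^bsub>A\<^esub> y) = \<phi> x \<ominus>\<^bsub>D\<^esub> \<phi> y"
proof -
  interpret A: cstar_algebra A by fact
  interpret D: cstar_algebra D by fact
  show ?thesis
    using assms(4,5) by (simp add: A.minus_eq D.minus_eq A.minus_eq_smult D.minus_eq_smult star_morphismD[OF assms(3)])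
qed

lemma additive_finsum:
  assumes A: "cstar_algebra A" and D: "cstar_algebra D"
    and closed: "\<And>x. x \<in> carrier A \<Longrightarrow> h x \<in> carrier D"
    and zero: "h \<zero>\<^bsub>A\<^esub> = \<zero>\<^bsub>D\<^esub>"
    and add: "\<And>x y. \<lbrakk>x \<in> carrier A; y \<in> carrier A\<rbrakk> \<Longrightarrow> h (x \<oplus>\<^bsub>A\<^esub> y) = h x \<oplus>\<^bsub>D\<^esub> h y"
    and "finite I" "f \<in> I \<rightarrow> carrier A"
  shows "h (\<Oplus>\<^bsub>A\<^esub>i\<in>I. f i) = (\<Oplus>\<^bsub>D\<^esub>i\<in>I. h (f i))"
proof -
  interpret A: cstar_algebra A by fact
  interpret D: cstar_algebra D by fact
  show ?thesis
    using assms(6,7)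
  proof (induction I)
    case (insert i I)
    then have "f i \<in> carrier A" "f \<in> I \<rightarrow> carrier A" by auto
    then show ?case
      using insert closed by (simp add: add A.finsum_insert D.finsum_insert Pi_def A.finsum_closed)
  qed (simp add: zero)
qed

lemma star_morphism_finsum:
  assumes "cstar_algebra A" "cstar_algebra D" "star_morphism A D \<phi>"
    and "finite I" "f \<in> I \<rightarrow> carrier A"
  shows "\<phi> (\<Oplus>\<^bsub>A\<^esub>i\<in>I. f i) = (\<Oplus>\<^bsub>D\<^esub>i\<in>I. \<phi> (f i))"
  using assms by (intro additive_finsum star_morphism_zero star_morphismD(1,2)[OF assms(3)]) auto

text \<open>If \<open>a\<close> is self-adjoint with \<open>\<parallel>a\<parallel> < 1\<close> and \<open>y\<close> is the square root of \<open>1 - a\<^sup>2\<close>, then \<open>u = a + i y\<close> satisfies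
  \<open>u\<^sup>* u = 1\<close>. Its image satisfies \<open>\<phi>(u)\<^sup>* \<phi>(u) = \<phi>(1)\<close>, a projection, whence \<open>\<parallel>\<phi>(u)\<parallel> \<le> 1\<close>, and \<open>\<phi>(a)\<close> is the mean
  of \<open>\<phi>(u)\<close> and its adjoint. The C*-identity and scaling reduce the general case to this one.\<close>

lemma star_morphism_contractive:
  assumes "cstar_algebra A" "cstar_algebra D" and \<phi>: "star_morphism A D \<phi>" and x: "x \<in> carrier A"
  shows "cnorm D (\<phi> x) \<le> cnorm A x"
proof -
  interpret A: cstar_algebra A by fact
  interpret D: cstar_algebra D by fact
  note hom = star_morphismD[OF \<phi>]
  have unit_ball: "cnorm D (\<phi> a) \<le> 1" if a: "a \<in> carrier A" "star A a = a" "cnorm A a < 1" for a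
  proof -
    have "cnorm A (a \<otimes>\<^bsub>A\<^esub> a) < 1"
      using a A.norm_nonneg[OF a(1)] by (simp add: A.norm_selfadjoint_square power_less_one_iff)
    moreover have "a \<otimes>\<^bsub>A\<^esub> a \<in> carrier A" "star A (a \<otimes>\<^bsub>A\<^esub> a) = a \<otimes>\<^bsub>A\<^esub> a"
      using a by (simp_all add: A.star_mult)
    ultimately obtain y where y: "y \<in> carrier A" "star A y = y" "y \<otimes>\<^bsub>A\<^esub> y = \<one>\<^bsub>A\<^esub> \<ominus>\<^bsub>A\<^esub> a \<otimes>\<^bsub>A\<^esub> a"
      and comm: "\<And>b. \<lbrakk>b \<in> carrier A; b \<otimes>\<^bsub>A\<^esub> (a \<otimes>\<^bsub>A\<^esub> a) = (a \<otimes>\<^bsub>A\<^esub> a) \<otimes>\<^bsub>A\<^esub> b\<rbrakk> \<Longrightarrow> b \<otimes>\<^bsub>A\<^esub> y = y \<otimes>\<^bsub>A\<^esub> b"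
      using A.sqrt_one_minus[of "a \<otimes>\<^bsub>A\<^esub> a"] by metis
    have ay: "a \<otimes>\<^bsub>A\<^esub> y = y \<otimes>\<^bsub>A\<^esub> a"
      using comm[of a] a by (simp add: A.m_assoc)
    define u where "u = \<phi> a \<oplus>\<^bsub>D\<^esub> \<i> \<odot>\<^bsub>D\<^esub> \<phi> y"
    have su: "star D u = \<phi> a \<oplus>\<^bsub>D\<^esub> (-\<i>) \<odot>\<^bsub>D\<^esub> \<phi> y"
      using a y by (simp add: u_def D.star_add D.star_smult hom flip: hom(5))
    have uc: "u \<in> carrier D" using a y by (simp add: u_def hom)
    have "star D u \<otimes>\<^bsub>D\<^esub> u = \<phi> ((a \<oplus>\<^bsub>A\<^esub> (-\<i>) \<odot>\<^bsub>A\<^esub> y) \<otimes>\<^bsub>A\<^esub> (a \<oplus>\<^bsub>A\<^esub> \<i> \<odot>\<^bsub>A\<^esub> y))"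
      unfolding su unfolding u_def using a y by (simp add: hom)
    also have "(a \<oplus>\<^bsub>A\<^esub> (-\<i>) \<odot>\<^bsub>A\<^esub> y) \<otimes>\<^bsub>A\<^esub> (a \<oplus>\<^bsub>A\<^esub> \<i> \<odot>\<^bsub>A\<^esub> y)
        = (a \<otimes>\<^bsub>A\<^esub> a \<oplus>\<^bsub>A\<^esub> y \<otimes>\<^bsub>A\<^esub> y) \<oplus>\<^bsub>A\<^esub> (\<i> \<odot>\<^bsub>A\<^esub> (a \<otimes>\<^bsub>A\<^esub> y) \<oplus>\<^bsub>A\<^esub> (-\<i>) \<odot>\<^bsub>A\<^esub> (a \<otimes>\<^bsub>A\<^esub> y))"
      using a(1) y(1)
      by (simp add: A.l_distr A.r_distr A.smult_mult_left A.smult_mult_right A.smult_smult A.smult_add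
          A.a_ac ay)
    also have "\<dots> = a \<otimes>\<^bsub>A\<^esub> a \<oplus>\<^bsub>A\<^esub> y \<otimes>\<^bsub>A\<^esub> y"
      using a y by (simp flip: A.add_smult)
    also have "\<dots> = \<one>\<^bsub>A\<^esub>"
      unfolding y(3) A.minus_eq using a by (subst A.a_lcomm) (simp_all add: A.r_neg)
    finally have "(cnorm D u)\<^sup>2 = cnorm D (\<phi> \<one>\<^bsub>A\<^esub>)"
      using D.cstar_identity[OF uc] by simp
    also have "\<dots> \<le> 1"
      by (rule D.norm_projection_le_one) (simp_all add: hom flip: hom(3,5))
    finally have "cnorm D u \<le> 1"
      by (simp add: power2_le_imp_le)
    moreover have "\<phi> a = (1/2) \<odot>\<^bsub>D\<^esub> (u \<oplus>\<^bsub>D\<^esub> star D u)"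
    proof -
      have "u \<oplus>\<^bsub>D\<^esub> star D u = (\<phi> a \<oplus>\<^bsub>D\<^esub> \<phi> a) \<oplus>\<^bsub>D\<^esub> (\<i> \<odot>\<^bsub>D\<^esub> \<phi> y \<oplus>\<^bsub>D\<^esub> (-\<i>) \<odot>\<^bsub>D\<^esub> \<phi> y)"
        unfolding su unfolding u_def using a y by (simp add: hom D.a_ac)
      also have "\<dots> = \<phi> a \<oplus>\<^bsub>D\<^esub> \<phi> a"
        using a y by (simp add: hom flip: D.add_smult)
      finally show ?thesis
        using a D.add_smult[of "\<phi> a" "1/2" "1/2"] by (simp add: hom D.smult_add)
    qed
    ultimately show ?thesis
      using uc D.norm_add[of u "star D u"] by (simp add: D.norm_smult D.norm_star)
  qed
  have sa: "cnorm D (\<phi> a) \<le> cnorm A a" if a: "a \<in> carrier A" "star A a = a" for a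
  proof (rule field_le_epsilon)
    fix e :: real assume e: "0 < e"
    define k where "k = cnorm A a + e"
    have k: "k > 0" "cnorm A a < k" using e A.norm_nonneg[OF a(1)] by (auto simp: k_def)
    have "cnorm D (\<phi> (complex_of_real (1/k) \<odot>\<^bsub>A\<^esub> a)) \<le> 1"
      by (rule unit_ball) (use a k in \<open>auto simp: A.star_smult A.norm_smult norm_divide\<close>)
    then have "cnorm D (\<phi> a) / k \<le> 1"
      using a k by (simp add: hom D.norm_smult norm_divide)
    then show "cnorm D (\<phi> a) \<le> cnorm A a + e"
      using k by (simp add: k_def divide_simps)
  qed
  have "(cnorm D (\<phi> x))\<^sup>2 = cnorm D (\<phi> (star A x \<otimes>\<^bsub>A\<^esub> x))"
    using x by (simp add: hom D.cstar_identity)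
  also have "\<dots> \<le> cnorm A (star A x \<otimes>\<^bsub>A\<^esub> x)"
    by (rule sa) (use x in \<open>auto simp: A.star_mult A.star_star\<close>)
  also have "\<dots> = (cnorm A x)\<^sup>2"
    using x by (rule A.cstar_identity)
  finally show ?thesis
    using A.norm_nonneg[OF x] by (rule power2_le_imp_le)
qed

lemma star_morphism_lim:
  assumes "cstar_algebra A" "cstar_algebra D" "star_morphism A D \<phi>" "cstar_algebra.lim A x l"
  shows "cstar_algebra.lim D (\<lambda>n. \<phi> (x n)) (\<phi> l)"
proof -
  interpret A: cstar_algebra A by fact
  interpret D: cstar_algebra D by fact
  note c = A.lim_closed[OF assms(4)]
  show ?thesis
  proof (rule D.limI)
    show "cnorm D (\<phi> (x n) \<ominus>\<^bsub>D\<^esub> \<phi> l) \<le> cnorm A (x n \<ominus>\<^bsub>A\<^esub> l)" for n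
      using star_morphism_contractive[OF assms(1-3), of "x n \<ominus>\<^bsub>A\<^esub> l"] c
      by (simp add: star_morphism_diff[OF assms(1-3)])
    show "(\<lambda>n. cnorm A (x n \<ominus>\<^bsub>A\<^esub> l)) \<longlonglongrightarrow> 0"
      using assms(4) by (simp add: A.lim_def)
  qed (use c star_morphismD(1)[OF assms(3)] in auto)
qed

inductive_set additive_span :: "('a, 'm) cstar_alg_scheme \<Rightarrow> 'a set \<Rightarrow> 'a set"
  for A :: "('a, 'm) cstar_alg_scheme" and S :: "'a set" where
  zero: "\<zero>\<^bsub>A\<^esub> \<in> additive_span A S"
| add: "\<lbrakk>z \<in> additive_span A S; s \<in> S\<rbrakk> \<Longrightarrow> z \<oplus>\<^bsub>A\<^esub> s \<in> additive_span A S"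

definition dense_span :: "('a, 'm) cstar_alg_scheme \<Rightarrow> 'a set \<Rightarrow> bool" where
  "dense_span A S \<longleftrightarrow> S \<subseteq> carrier A \<and>
     (\<forall>z \<in> carrier A. \<forall>\<epsilon>>0. \<exists>s \<in> additive_span A S. cnorm A (z \<ominus>\<^bsub>A\<^esub> s) < \<epsilon>)"

lemma additive_span_closed:
  assumes "cstar_algebra A" "S \<subseteq> carrier A" "z \<in> additive_span A S"
  shows "z \<in> carrier A"
proof -
  interpret A: cstar_algebra A by fact
  show ?thesis
    using assms(3,2) by induction auto
qed

lemma seq_of_approx:
  assumes "cstar_algebra A" "z \<in> carrier A" "\<And>s. P s \<Longrightarrow> s \<in> carrier A"
    and "\<And>\<epsilon>. \<epsilon> > 0 \<Longrightarrow> \<exists>s. P s \<and> cnorm A (z \<ominus>\<^bsub>A\<^esub> s) < \<epsilon>"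
  obtains x where "cstar_algebra.lim A x z" "\<And>n. P (x n)"
proof -
  interpret A: cstar_algebra A by fact
  have "\<exists>s. P s \<and> cnorm A (z \<ominus>\<^bsub>A\<^esub> s) < 1 / real (Suc n)" for n
    by (rule assms(4)) simp
  then obtain x where x: "\<And>n. P (x n)" "\<And>n. cnorm A (z \<ominus>\<^bsub>A\<^esub> x n) < 1 / real (Suc n)"
    by metis
  have "A.lim x z"
  proof (rule A.limI)
    show "cnorm A (x n \<ominus>\<^bsub>A\<^esub> z) \<le> 1 / real (Suc n)" for n
      using x(2)[of n] A.norm_diff_commute[of z "x n"] assms(2) assms(3)[OF x(1)] by simp
    show "(\<lambda>n. 1 / real (Suc n)) \<longlonglongrightarrow> 0"
      using LIMSEQ_inverse_real_of_nat by (simp add: inverse_eq_divide)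
  qed (use assms x in auto)
  then show ?thesis using that x by blast
qed

text \<open>Closed additive properties of the generators extend to the whole algebra.\<close>

lemma dense_span_induct [consumes 3, case_names zero add lim]:
  assumes "cstar_algebra A" "dense_span A S" "z \<in> carrier A"
    and zero: "P \<zero>\<^bsub>A\<^esub>"
    and add: "\<And>z s. \<lbrakk>z \<in> carrier A; P z; s \<in> S\<rbrakk> \<Longrightarrow> P (z \<oplus>\<^bsub>A\<^esub> s)"
    and lim: "\<And>x l. \<lbrakk>cstar_algebra.lim A x l; \<And>n. P (x n)\<rbrakk> \<Longrightarrow> P l"
  shows "P z"
proof -
  have S: "S \<subseteq> carrier A" using assms(2) by (simp add: dense_span_def)
  have P: "s \<in> carrier A \<and> P s" if "s \<in> additive_span A S" for s
    using that additive_span_closed[OF assms(1) S]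
    by (induction) (auto intro: zero add additive_span.intros)
  obtain x where "cstar_algebra.lim A x z" "\<And>n. x n \<in> additive_span A S"
    by (rule seq_of_approx[OF assms(1,3), of "\<lambda>s. s \<in> additive_span A S"])
      (use assms(2,3) P in \<open>unfold dense_span_def, blast+\<close>)
  then show ?thesis using lim P by blast
qed

lemma star_morphism_eqI:
  assumes A: "cstar_algebra A" and D: "cstar_algebra D" and S: "dense_span A S"
    and \<phi>: "star_morphism A D \<phi>" and \<psi>: "star_morphism A D \<psi>"
    and eq: "\<And>s. s \<in> S \<Longrightarrow> \<phi> s = \<psi> s"
    and "z \<in> carrier A"
  shows "\<phi> z = \<psi> z"
  using A S assms(7)
proof (induction rule: dense_span_induct)
  case zero
  show ?case using A D \<phi> \<psi> by (simp add: star_morphism_zero)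
next
  case (add z s)
  moreover have "s \<in> carrier A" using S add by (auto simp: dense_span_def)
  ultimately show ?case using eq by (simp add: star_morphismD(2)[OF \<phi>] star_morphismD(2)[OF \<psi>])
next
  case (lim x l)
  interpret D: cstar_algebra D by fact
  have "D.lim (\<lambda>n. \<phi> (x n)) (\<psi> l)"
    using star_morphism_lim[OF A D \<psi> lim(1)] lim(2) by simp
  then show ?case
    by (rule D.lim_unique[OF star_morphism_lim[OF A D \<phi> lim(1)]])
qed

text \<open>The additive span of \<open>G\<close> in the product algebra \<open>A \<times> D\<close>: the pairs of an element and its prospective image under
  a morphism prescribed by \<open>G\<close>.\<close>

inductive pair_span ::
  "('a, 'm) cstar_alg_scheme \<Rightarrow> ('b, 'n) cstar_alg_scheme \<Rightarrow> ('a \<times> 'b) set \<Rightarrow> 'a \<Rightarrow> 'b \<Rightarrow> bool"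
  for A :: "('a, 'm) cstar_alg_scheme" and D :: "('b, 'n) cstar_alg_scheme" and G where
  zero: "pair_span A D G \<zero>\<^bsub>A\<^esub> \<zero>\<^bsub>D\<^esub>"
| add: "\<lbrakk>pair_span A D G z d; (s, e) \<in> G\<rbrakk> \<Longrightarrow> pair_span A D G (z \<oplus>\<^bsub>A\<^esub> s) (d \<oplus>\<^bsub>D\<^esub> e)"

lemma pair_span_closed:
  assumes "cstar_algebra A" "cstar_algebra D" "G \<subseteq> carrier A \<times> carrier D" "pair_span A D G z d"
  shows "z \<in> carrier A" "d \<in> carrier D"
proof -
  interpret A: cstar_algebra A by fact
  interpret D: cstar_algebra D by fact
  have "z \<in> carrier A \<and> d \<in> carrier D"
    using assms(4,3) by induction auto
  then show "z \<in> carrier A" "d \<in> carrier D" by auto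
qed

text \<open>The source of the norm bounds for maps between tensor products: a representation \<open>\<rho>\<close> of the target that is given
  on the generators by a representation \<open>\<sigma>\<close> of the source is so on the whole span, and \<open>\<sigma>\<close> is contractive.\<close>

lemma pair_span_norm_le:
  assumes A: "cstar_algebra A" and D: "cstar_algebra D" and E: "cstar_algebra E"
    and \<sigma>: "star_morphism A E \<sigma>" and \<rho>: "star_morphism D E \<rho>"
    and G: "G \<subseteq> carrier A \<times> carrier D" and eq: "\<And>s e. (s, e) \<in> G \<Longrightarrow> \<rho> e = \<sigma> s"
    and zd: "pair_span A D G z d"
  shows "cnorm E (\<rho> d) \<le> cnorm A z"
proof -
  have "\<rho> d = \<sigma> z"
    using zd
  proof induction
    case zero
    show ?case using star_morphism_zero[OF A E \<sigma>] star_morphism_zero[OF D E \<rho>] by simp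
  next
    case (add z d s e)
    then show ?case
      using eq[OF add.hyps(2)] G pair_span_closed[OF A D G add.hyps(1)]
      by (auto simp: star_morphismD(2)[OF \<sigma>] star_morphismD(2)[OF \<rho>])
  qed
  then show ?thesis
    using star_morphism_contractive[OF A E \<sigma> pair_span_closed(1)[OF A D G zd]] by simp
qed

text \<open>The additive span \<open>R\<close> of a multiplicative relation \<open>G\<close> is a *-subalgebra of \<open>A \<times> D\<close>. By the norm bound, the
  closure of \<open>R\<close> is the graph of a function, defined everywhere because \<open>D\<close> is complete.\<close>

lemma star_morphism_extension:
  assumes A: "cstar_algebra A" and D: "cstar_algebra D"
    and G: "G \<subseteq> carrier A \<times> carrier D"
    and Gmult: "\<And>s e s' e'. \<lbrakk>(s, e) \<in> G; (s', e') \<in> G\<rbrakk> \<Longrightarrow> (s \<otimes>\<^bsub>A\<^esub> s', e \<otimes>\<^bsub>D\<^esub> e') \<in> G"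
    and Gsmult: "\<And>c s e. (s, e) \<in> G \<Longrightarrow> (c \<odot>\<^bsub>A\<^esub> s, c \<odot>\<^bsub>D\<^esub> e) \<in> G"
    and Gstar: "\<And>s e. (s, e) \<in> G \<Longrightarrow> (star A s, star D e) \<in> G"
    and dense: "dense_span A (fst ` G)"
    and bound: "\<And>z d. pair_span A D G z d \<Longrightarrow> cnorm D d \<le> K * cnorm A z"
  obtains F where "star_morphism A D F" "F \<in> extensional (carrier A)" "\<And>s e. (s, e) \<in> G \<Longrightarrow> F s = e"
proof -
  interpret A: cstar_algebra A by fact
  interpret D: cstar_algebra D by fact
  let ?R = "pair_span A D G"
  have Gc: "s \<in> carrier A" "e \<in> carrier D" if "(s, e) \<in> G" for s e
    using that G by auto
  have R_closed: "z \<in> carrier A \<and> d \<in> carrier D" if "?R z d" for z d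
    using pair_span_closed[OF A D G that] by blast
  have R_add: "?R (z \<oplus>\<^bsub>A\<^esub> z') (d \<oplus>\<^bsub>D\<^esub> d')" if "?R z' d'" "?R z d" for z d z' d'
    using that
  proof induction
    case zero
    then show ?case using R_closed by simp
  next
    case (add z' d' s e)
    have "?R ((z \<oplus>\<^bsub>A\<^esub> z') \<oplus>\<^bsub>A\<^esub> s) ((d \<oplus>\<^bsub>D\<^esub> d') \<oplus>\<^bsub>D\<^esub> e)"
      by (rule pair_span.add[OF add.IH[OF add.prems] add.hyps(2)])
    then show ?case using add R_closed Gc by (simp add: A.a_assoc D.a_assoc)
  qed
  have R_smult: "?R (c \<odot>\<^bsub>A\<^esub> z) (c \<odot>\<^bsub>D\<^esub> d)" if "?R z d" for z d c
    using that
  proof induction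
    case (add z d s e)
    then show ?case using R_closed Gc
      by (auto simp: A.smult_add D.smult_add intro: pair_span.add Gsmult)
  qed (auto intro: pair_span.zero)
  have R_star: "?R (star A z) (star D d)" if "?R z d" for z d
    using that
  proof induction
    case (add z d s e)
    then show ?case using R_closed Gc
      by (auto simp: A.star_add D.star_add intro: pair_span.add Gstar)
  qed (auto intro: pair_span.zero)
  have R_mult1: "?R (z \<otimes>\<^bsub>A\<^esub> s) (d \<otimes>\<^bsub>D\<^esub> e)" if "?R z d" "(s, e) \<in> G" for z d s e
    using that
  proof induction
    case (add z d s' e')
    then show ?case using R_closed Gc
      by (auto simp: A.l_distr D.l_distr intro: pair_span.add Gmult)
  qed (use Gc in \<open>auto intro: pair_span.zero\<close>)
  have R_mult: "?R (z \<otimes>\<^bsub>A\<^esub> z') (d \<otimes>\<^bsub>D\<^esub> d')" if "?R z' d'" "?R z d" for z d z' d'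
    using that
  proof induction
    case zero
    then show ?case using R_closed by (auto intro: pair_span.zero)
  next
    case (add z' d' s e)
    then show ?case using R_closed Gc
      using R_add[OF R_mult1[OF add.prems add.hyps(2)] add.IH[OF add.prems]]
      by (simp add: A.r_distr D.r_distr)
  qed
  have R_diff: "?R (z \<ominus>\<^bsub>A\<^esub> z') (d \<ominus>\<^bsub>D\<^esub> d')" if "?R z d" "?R z' d'" for z d z' d'
    using R_add[OF R_smult[OF that(2), of "-1"] that(1)] R_closed[OF that(2)]
    by (simp add: A.minus_eq D.minus_eq A.minus_eq_smult D.minus_eq_smult)

  define C where "C z d \<longleftrightarrow> (\<exists>x y. (\<forall>n. ?R (x n) (y n)) \<and> A.lim x z \<and> D.lim y d)" for z d
  have C_closed: "z \<in> carrier A \<and> d \<in> carrier D" if "C z d" for z d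
    using that A.lim_closed D.lim_closed by (auto simp: C_def)
  have C_R: "C z d" if "?R z d" for z d
    unfolding C_def using that R_closed[OF that]
    by (intro exI[of _ "\<lambda>n. z"] exI[of _ "\<lambda>n. d"]) (auto intro: A.lim_const D.lim_const)
  have C_I: "C z d" if "\<And>n. ?R (x n) (y n)" "A.lim x z" "D.lim y d" for x y z d
    using that unfolding C_def by blast
  have C_add: "C (z \<oplus>\<^bsub>A\<^esub> z') (d \<oplus>\<^bsub>D\<^esub> d')" and C_mult: "C (z \<otimes>\<^bsub>A\<^esub> z') (d \<otimes>\<^bsub>D\<^esub> d')"
    if z: "C z d" and z': "C z' d'" for z d z' d'
  proof -
    obtain x y where xy: "\<And>n. ?R (x n) (y n)" "A.lim x z" "D.lim y d"
      using z unfolding C_def by blast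
    obtain x' y' where xy': "\<And>n. ?R (x' n) (y' n)" "A.lim x' z'" "D.lim y' d'"
      using z' unfolding C_def by blast
    show "C (z \<oplus>\<^bsub>A\<^esub> z') (d \<oplus>\<^bsub>D\<^esub> d')"
      by (rule C_I[OF R_add[OF xy'(1) xy(1)] A.lim_add[OF xy(2) xy'(2)] D.lim_add[OF xy(3) xy'(3)]])
    show "C (z \<otimes>\<^bsub>A\<^esub> z') (d \<otimes>\<^bsub>D\<^esub> d')"
      by (rule C_I[OF R_mult[OF xy'(1) xy(1)] A.lim_mult[OF xy(2) xy'(2)] D.lim_mult[OF xy(3) xy'(3)]])
  qed
  have C_smult: "C (c \<odot>\<^bsub>A\<^esub> z) (c \<odot>\<^bsub>D\<^esub> d)" and C_star: "C (star A z) (star D d)"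
    if z: "C z d" for z d c
  proof -
    obtain x y where xy: "\<And>n. ?R (x n) (y n)" "A.lim x z" "D.lim y d"
      using z unfolding C_def by blast
    show "C (c \<odot>\<^bsub>A\<^esub> z) (c \<odot>\<^bsub>D\<^esub> d)"
      by (rule C_I[OF R_smult[OF xy(1)] A.lim_smult[OF xy(2)] D.lim_smult[OF xy(3)]])
    show "C (star A z) (star D d)"
      by (rule C_I[OF R_star[OF xy(1)] A.lim_star[OF xy(2)] D.lim_star[OF xy(3)]])
  qed
  have C_bound: "cnorm D d \<le> K * cnorm A z" if zd: "C z d" for z d
  proof -
    obtain x y where xy: "\<And>n. ?R (x n) (y n)" "A.lim x z" "D.lim y d"
      using zd unfolding C_def by blast
    show ?thesis
      by (rule LIMSEQ_le[OF D.lim_norm[OF xy(3)] tendsto_mult_left[OF A.lim_norm[OF xy(2)]]])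
        (use bound[OF xy(1)] in blast)
  qed
  have C_unique: "d = d'" if "C z d" "C z d'" for z d d'
  proof -
    have c: "z \<in> carrier A" "d \<in> carrier D" "d' \<in> carrier D"
      using that C_closed by auto
    have "C (z \<ominus>\<^bsub>A\<^esub> z) (d \<ominus>\<^bsub>D\<^esub> d')"
      using C_add[OF that(1) C_smult[OF that(2), of "-1"]] c
      by (simp add: A.minus_eq D.minus_eq A.minus_eq_smult D.minus_eq_smult)
    then have "cnorm D (d \<ominus>\<^bsub>D\<^esub> d') \<le> K * cnorm A \<zero>\<^bsub>A\<^esub>"
      using C_bound c by (metis A.minus_eq A.r_neg)
    then have "cnorm D (d \<ominus>\<^bsub>D\<^esub> d') \<le> 0"
      by simp
    moreover have "0 \<le> cnorm D (d \<ominus>\<^bsub>D\<^esub> d')"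
      using c by (intro D.norm_nonneg) simp
    ultimately have "cnorm D (d \<ominus>\<^bsub>D\<^esub> d') = 0"
      by linarith
    then show ?thesis
      using c by (simp add: D.norm_eq_zero D.diff_eq_zero_iff)
  qed
  have R_lift: "\<exists>d. ?R z d" if "z \<in> additive_span A (fst ` G)" for z
    using that
  proof induction
    case (add z s)
    then show ?case using pair_span.add by fastforce
  qed (blast intro: pair_span.zero)
  have C_total: "\<exists>d. C z d" if z: "z \<in> carrier A" for z
  proof -
    obtain x where x: "A.lim x z" "\<And>n. \<exists>d. ?R (x n) d"
      by (rule seq_of_approx[OF A z, of "\<lambda>s. \<exists>d. ?R s d"])
        (use dense z R_closed R_lift in \<open>auto simp: dense_span_def\<close>, meson)
    then obtain y where y: "\<And>n. ?R (x n) (y n)" by metis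
    have xc: "x n \<in> carrier A" for n using x by (simp add: A.lim_def)
    have "\<exists>l. D.lim y l"
    proof (rule D.Cauchy_imp_lim)
      show "y n \<in> carrier D" for n using R_closed[OF y] by blast
      fix \<epsilon> :: real assume \<epsilon>: "\<epsilon> > 0"
      define \<delta> where "\<delta> = \<epsilon> / (2 * (\<bar>K\<bar> + 1))"
      have \<delta>: "\<delta> > 0" using \<epsilon> by (simp add: \<delta>_def)
      have "\<forall>\<^sub>F n in sequentially. cnorm A (x n \<ominus>\<^bsub>A\<^esub> z) < \<delta>"
        using x(1) \<delta> unfolding A.lim_def by (intro order_tendstoD(2)) auto
      then obtain N where N: "\<And>n. n \<ge> N \<Longrightarrow> cnorm A (x n \<ominus>\<^bsub>A\<^esub> z) < \<delta>"
        unfolding eventually_sequentially by blast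
      have "cnorm D (y m \<ominus>\<^bsub>D\<^esub> y n) < \<epsilon>" if "m \<ge> N" "n \<ge> N" for m n
      proof -
        have *: "cnorm A (x m \<ominus>\<^bsub>A\<^esub> x n) < 2 * \<delta>"
          using A.norm_diff_triangle[OF xc z xc, of m n] N[OF that(1)] N[OF that(2)]
            A.norm_diff_commute[OF z xc, of n] by simp
        have "cnorm D (y m \<ominus>\<^bsub>D\<^esub> y n) \<le> K * cnorm A (x m \<ominus>\<^bsub>A\<^esub> x n)"
          by (rule bound[OF R_diff[OF y y]])
        also have "\<dots> \<le> (\<bar>K\<bar> + 1) * cnorm A (x m \<ominus>\<^bsub>A\<^esub> x n)"
          by (rule mult_right_mono) (use xc A.norm_nonneg in auto)
        also have "\<dots> < (\<bar>K\<bar> + 1) * (2 * \<delta>)"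
          by (rule mult_strict_left_mono[OF *]) simp
        also have "\<dots> = \<epsilon>"
        proof -
          have eq: "p * (2 * (\<epsilon> / (2 * p))) = \<epsilon>" if "p \<noteq> 0" for p
            using that by simp
          show ?thesis unfolding \<delta>_def by (rule eq) linarith
        qed
        finally show ?thesis .
      qed
      then show "\<exists>N. \<forall>m\<ge>N. \<forall>n\<ge>N. cnorm D (y m \<ominus>\<^bsub>D\<^esub> y n) < \<epsilon>" by blast
    qed
    then show ?thesis
      unfolding C_def using x(1) y by blast
  qed
  define F where "F = (\<lambda>z \<in> carrier A. SOME d. C z d)"
  have F: "C z (F z)" if "z \<in> carrier A" for z
    using someI_ex[OF C_total[OF that]] that by (simp add: F_def)
  have F_eq: "F z = d" if "C z d" for z d
    using C_unique[OF F that] C_closed[OF that] by blast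
  have "star_morphism A D F"
    unfolding star_morphism_def
    using F C_closed by (auto intro!: F_eq C_add C_mult C_smult C_star)
  moreover have "F s = e" if "(s, e) \<in> G" for s e
    using F_eq[OF C_R[OF pair_span.add[OF pair_span.zero that]]] Gc[OF that] by simp
  ultimately show ?thesis
    using that by (simp add: F_def)
qed

text \<open>The mixed terms of a product vanish, because \<open>\<psi>\<^sub>k(x) \<psi>\<^sub>l(y) = \<psi>\<^sub>k(x) \<psi>\<^sub>k(1) \<psi>\<^sub>l(1) \<psi>\<^sub>l(y)\<close>.\<close>

lemma orthogonal_sum_hom:
  assumes A: "cstar_algebra A" and D: "cstar_algebra D" and I: "finite I"
    and \<psi>: "\<And>k. k \<in> I \<Longrightarrow> star_morphism A D (\<psi> k)"
    and orth: "\<And>k l. \<lbrakk>k \<in> I; l \<in> I; k \<noteq> l\<rbrakk> \<Longrightarrow> \<psi> k \<one>\<^bsub>A\<^esub> \<otimes>\<^bsub>D\<^esub> \<psi> l \<one>\<^bsub>A\<^esub> = \<zero>\<^bsub>D\<^esub>"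
    and unit: "(\<Oplus>\<^bsub>D\<^esub>k\<in>I. \<psi> k \<one>\<^bsub>A\<^esub>) = \<one>\<^bsub>D\<^esub>"
  shows "(\<lambda>z \<in> carrier A. \<Oplus>\<^bsub>D\<^esub>k\<in>I. \<psi> k z) \<in> cstar_hom A D"
proof -
  interpret A: cstar_algebra A by fact
  interpret D: cstar_algebra D by fact
  note hom = star_morphismD[OF \<psi>]
  have c: "(\<lambda>k. \<psi> k z) \<in> I \<rightarrow> carrier D" if "z \<in> carrier A" for z
    using hom(1) that by auto
  have sum_c: "(\<Oplus>\<^bsub>D\<^esub>k\<in>I. \<psi> k z) \<in> carrier D" if "z \<in> carrier A" for z
    using c[OF that] by (rule D.finsum_closed)
  have prod: "\<psi> k x \<otimes>\<^bsub>D\<^esub> \<psi> l y = (if k = l then \<psi> k (x \<otimes>\<^bsub>A\<^esub> y) else \<zero>\<^bsub>D\<^esub>)"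
    if "k \<in> I" "l \<in> I" "x \<in> carrier A" "y \<in> carrier A" for k l x y
  proof (cases "k = l")
    case False
    have "\<psi> k x \<otimes>\<^bsub>D\<^esub> \<psi> l y = (\<psi> k x \<otimes>\<^bsub>D\<^esub> \<psi> k \<one>\<^bsub>A\<^esub>) \<otimes>\<^bsub>D\<^esub> (\<psi> l \<one>\<^bsub>A\<^esub> \<otimes>\<^bsub>D\<^esub> \<psi> l y)"
      using that by (simp flip: hom(3))
    also have "\<dots> = \<psi> k x \<otimes>\<^bsub>D\<^esub> ((\<psi> k \<one>\<^bsub>A\<^esub> \<otimes>\<^bsub>D\<^esub> \<psi> l \<one>\<^bsub>A\<^esub>) \<otimes>\<^bsub>D\<^esub> \<psi> l y)"
      using that by (simp add: D.m_assoc hom(1))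
    also have "\<dots> = \<zero>\<^bsub>D\<^esub>"
      using that False by (simp add: orth hom(1))
    finally show ?thesis using False by simp
  qed (use that in \<open>simp add: hom(3)\<close>)
  have mult: "(\<Oplus>\<^bsub>D\<^esub>k\<in>I. \<psi> k x) \<otimes>\<^bsub>D\<^esub> (\<Oplus>\<^bsub>D\<^esub>k\<in>I. \<psi> k y) = (\<Oplus>\<^bsub>D\<^esub>k\<in>I. \<psi> k (x \<otimes>\<^bsub>A\<^esub> y))"
    if x: "x \<in> carrier A" and y: "y \<in> carrier A" for x y
  proof -
    have "(\<Oplus>\<^bsub>D\<^esub>k\<in>I. \<psi> k x) \<otimes>\<^bsub>D\<^esub> (\<Oplus>\<^bsub>D\<^esub>l\<in>I. \<psi> l y) = (\<Oplus>\<^bsub>D\<^esub>k\<in>I. \<psi> k x \<otimes>\<^bsub>D\<^esub> (\<Oplus>\<^bsub>D\<^esub>l\<in>I. \<psi> l y))"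
      by (rule additive_finsum[OF D D _ _ _ I c[OF x]]) (use sum_c[OF y] in \<open>auto simp: D.l_distr\<close>)
    also have "\<dots> = (\<Oplus>\<^bsub>D\<^esub>k\<in>I. \<psi> k (x \<otimes>\<^bsub>A\<^esub> y))"
    proof (rule D.finsum_cong')
      fix k assume k: "k \<in> I"
      have "\<psi> k x \<otimes>\<^bsub>D\<^esub> (\<Oplus>\<^bsub>D\<^esub>l\<in>I. \<psi> l y) = (\<Oplus>\<^bsub>D\<^esub>l\<in>I. \<psi> k x \<otimes>\<^bsub>D\<^esub> \<psi> l y)"
        by (rule additive_finsum[OF D D _ _ _ I c[OF y]]) (use k x hom(1) in \<open>auto simp: D.r_distr\<close>)
      also have "\<dots> = (\<Oplus>\<^bsub>D\<^esub>l\<in>I. if k = l then \<psi> k (x \<otimes>\<^bsub>A\<^esub> y) else \<zero>\<^bsub>D\<^esub>)"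
        by (rule D.finsum_cong') (use k x y in \<open>auto simp: prod hom(1)\<close>)
      also have "\<dots> = \<psi> k (x \<otimes>\<^bsub>A\<^esub> y)"
        using k x y I by (subst D.finsum_singleton[where f = "\<lambda>l. \<psi> k (x \<otimes>\<^bsub>A\<^esub> y)"]) (auto simp: hom(1))
      finally show "\<psi> k x \<otimes>\<^bsub>D\<^esub> (\<Oplus>\<^bsub>D\<^esub>l\<in>I. \<psi> l y) = \<psi> k (x \<otimes>\<^bsub>A\<^esub> y)" .
    qed (use c x y in auto)
    finally show ?thesis .
  qed
  have add: "(\<Oplus>\<^bsub>D\<^esub>k\<in>I. \<psi> k (x \<oplus>\<^bsub>A\<^esub> y)) = (\<Oplus>\<^bsub>D\<^esub>k\<in>I. \<psi> k x) \<oplus>\<^bsub>D\<^esub> (\<Oplus>\<^bsub>D\<^esub>k\<in>I. \<psi> k y)"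
    if x: "x \<in> carrier A" and y: "y \<in> carrier A" for x y
  proof -
    have "(\<Oplus>\<^bsub>D\<^esub>k\<in>I. \<psi> k (x \<oplus>\<^bsub>A\<^esub> y)) = (\<Oplus>\<^bsub>D\<^esub>k\<in>I. \<psi> k x \<oplus>\<^bsub>D\<^esub> \<psi> k y)"
      by (rule D.finsum_cong') (use x y hom(1,2) in auto)
    then show ?thesis
      by (simp add: D.finsum_addf[OF c[OF x] c[OF y]])
  qed
  have smult: "(\<Oplus>\<^bsub>D\<^esub>k\<in>I. \<psi> k (a \<odot>\<^bsub>A\<^esub> x)) = a \<odot>\<^bsub>D\<^esub> (\<Oplus>\<^bsub>D\<^esub>k\<in>I. \<psi> k x)" if x: "x \<in> carrier A" for x a
  proof -
    have "a \<odot>\<^bsub>D\<^esub> (\<Oplus>\<^bsub>D\<^esub>k\<in>I. \<psi> k x) = (\<Oplus>\<^bsub>D\<^esub>k\<in>I. a \<odot>\<^bsub>D\<^esub> \<psi> k x)"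
      by (rule additive_finsum[OF D D _ _ _ I c[OF x]]) (auto simp: D.smult_add)
    also have "\<dots> = (\<Oplus>\<^bsub>D\<^esub>k\<in>I. \<psi> k (a \<odot>\<^bsub>A\<^esub> x))"
      by (rule D.finsum_cong') (use x hom(1,4) in auto)
    finally show ?thesis by simp
  qed
  have star: "(\<Oplus>\<^bsub>D\<^esub>k\<in>I. \<psi> k (star A x)) = star D (\<Oplus>\<^bsub>D\<^esub>k\<in>I. \<psi> k x)" if x: "x \<in> carrier A" for x
  proof -
    have "star D (\<Oplus>\<^bsub>D\<^esub>k\<in>I. \<psi> k x) = (\<Oplus>\<^bsub>D\<^esub>k\<in>I. star D (\<psi> k x))"
      by (rule additive_finsum[OF D D _ _ _ I c[OF x]]) (auto simp: D.star_add)
    also have "\<dots> = (\<Oplus>\<^bsub>D\<^esub>k\<in>I. \<psi> k (star A x))"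
      by (rule D.finsum_cong') (use x hom(1,5) in auto)
    finally show ?thesis by simp
  qed
  show ?thesis
    unfolding cstar_hom_iff star_morphism_def
    using sum_c mult add smult star unit by auto
qed

section \<open>The Hilbert space of square-summable families\<close>

lemma l2I:
  assumes "\<And>F. finite F \<Longrightarrow> (\<Sum>i\<in>F. (cmod (f i))\<^sup>2) \<le> K"
  shows "f \<in> l2" and "(l2_norm f)\<^sup>2 \<le> K"
proof -
  have s: "(\<lambda>i. (cmod (f i))\<^sup>2) summable_on UNIV"
    using assms by (intro nonneg_bdd_above_summable_on bdd_aboveI2[where M = K]) auto
  then show "f \<in> l2" by (simp add: l2_def)
  have "(\<Sum>\<^sub>\<infinity>i. (cmod (f i))\<^sup>2) \<le> K"
    using s assms by (intro infsum_le_finite_sums) auto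
  then show "(l2_norm f)\<^sup>2 \<le> K"
    by (simp add: l2_norm_def infsum_nonneg)
qed

lemma l2_norm_square: "(l2_norm f)\<^sup>2 = (\<Sum>\<^sub>\<infinity>i. (cmod (f i))\<^sup>2)"
  by (simp add: l2_norm_def infsum_nonneg)

lemma l2_finite_sum_le:
  assumes "f \<in> l2" "finite F"
  shows "(\<Sum>i\<in>F. (cmod (f i))\<^sup>2) \<le> (l2_norm f)\<^sup>2"
  using assms unfolding l2_norm_square by (intro finite_sum_le_infsum) (auto simp: l2_def)

lemma l2_zero: "(\<lambda>i. 0) \<in> l2"
  by (simp add: l2_def)

lemma l2_scale:
  assumes "f \<in> l2"
  shows "(\<lambda>i. c * f i) \<in> l2"
  using assms by (auto simp: l2_def norm_mult power_mult_distrib intro: summable_on_cmult_right)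

lemma l2_add:
  assumes "f \<in> l2" "g \<in> l2"
  shows "(\<lambda>i. f i + g i) \<in> l2"
proof (rule l2I(1))
  fix F :: "'a set" assume F: "finite F"
  have "(\<Sum>i\<in>F. (cmod (f i + g i))\<^sup>2) \<le> (\<Sum>i\<in>F. 2 * (cmod (f i))\<^sup>2 + 2 * (cmod (g i))\<^sup>2)"
  proof (rule sum_mono)
    fix i
    have "(cmod (f i + g i))\<^sup>2 \<le> (cmod (f i) + cmod (g i))\<^sup>2"
      by (intro power_mono norm_triangle_ineq) auto
    also have "\<dots> \<le> 2 * (cmod (f i))\<^sup>2 + 2 * (cmod (g i))\<^sup>2"
      using zero_le_power2[of "cmod (f i) - cmod (g i)"] by (simp add: power2_eq_square algebra_simps)
    finally show "(cmod (f i + g i))\<^sup>2 \<le> 2 * (cmod (f i))\<^sup>2 + 2 * (cmod (g i))\<^sup>2" .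
  qed
  also have "\<dots> \<le> 2 * (l2_norm f)\<^sup>2 + 2 * (l2_norm g)\<^sup>2"
    using l2_finite_sum_le[OF assms(1) F] l2_finite_sum_le[OF assms(2) F]
    by (simp add: sum.distrib flip: sum_distrib_left)
  finally show "(\<Sum>i\<in>F. (cmod (f i + g i))\<^sup>2) \<le> 2 * (l2_norm f)\<^sup>2 + 2 * (l2_norm g)\<^sup>2" .
qed

lemma l2_inner_summable:
  assumes "f \<in> l2" "g \<in> l2"
  shows "(\<lambda>i. cnj (f i) * g i) abs_summable_on UNIV"
proof (rule abs_summable_product)
  show "(\<lambda>i. cnj (f i) * cnj (f i)) abs_summable_on UNIV" "(\<lambda>i. g i * g i) abs_summable_on UNIV"
    using assms by (simp_all add: l2_def norm_mult power2_eq_square)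
qed

lemmas l2_inner_summable' = l2_inner_summable[THEN abs_summable_summable]

typedef 'i ell2 = "l2 :: ('i \<Rightarrow> complex) set"
  morphisms coord Abs_ell2
  using l2_zero by blast

setup_lifting type_definition_ell2

lemma coord_l2 [simp, intro]: "coord v \<in> l2"
  by (rule coord)

lemma ell2_eqI: "(\<And>i. coord v i = coord w i) \<Longrightarrow> v = w"
  by (rule iffD1[OF coord_inject]) (rule ext)

lift_definition cscale :: "complex \<Rightarrow> 'i ell2 \<Rightarrow> 'i ell2" is "\<lambda>c f i. c * f i"
  by (rule l2_scale)

instantiation ell2 :: (type) real_inner
begin

lift_definition zero_ell2 :: "'a ell2" is "\<lambda>i. 0" by (rule l2_zero)
lift_definition plus_ell2 :: "'a ell2 \<Rightarrow> 'a ell2 \<Rightarrow> 'a ell2" is "\<lambda>f g i. f i + g i" by (rule l2_add)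
definition uminus_ell2 :: "'a ell2 \<Rightarrow> 'a ell2" where "- v = cscale (-1) v"
definition minus_ell2 :: "'a ell2 \<Rightarrow> 'a ell2 \<Rightarrow> 'a ell2" where "v - w = v + - (w :: 'a ell2)"
definition scaleR_ell2 :: "real \<Rightarrow> 'a ell2 \<Rightarrow> 'a ell2" where "r *\<^sub>R v = cscale (of_real r) v"
lift_definition norm_ell2 :: "'a ell2 \<Rightarrow> real" is l2_norm .
definition sgn_ell2 :: "'a ell2 \<Rightarrow> 'a ell2" where "sgn v = inverse (norm v) *\<^sub>R (v :: 'a ell2)"
definition dist_ell2 :: "'a ell2 \<Rightarrow> 'a ell2 \<Rightarrow> real" where "dist v w = norm (v - (w :: 'a ell2))"
definition uniformity_ell2 :: "('a ell2 \<times> 'a ell2) filter" where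
  "uniformity = (INF e\<in>{0<..}. principal {(x, y). dist (x :: 'a ell2) y < e})"
definition open_ell2 :: "'a ell2 set \<Rightarrow> bool" where
  "open U = (\<forall>x\<in>U. eventually (\<lambda>(x' :: 'a ell2, y). x' = x \<longrightarrow> y \<in> U) uniformity)"
lift_definition inner_ell2 :: "'a ell2 \<Rightarrow> 'a ell2 \<Rightarrow> real" is "\<lambda>f g. Re (l2_inner f g)" .

instance
proof
  fix u v w :: "'a ell2" and r s :: real and U :: "'a ell2 set"
  show "u + v + w = u + (v + w)" by transfer (simp add: add.assoc)
  show "u + v = v + u" by transfer (simp add: add.commute)
  show "0 + u = u" by transfer simp
  show "- u + u = 0" unfolding uminus_ell2_def by transfer simp
  show "u - v = u + - v" by (simp add: minus_ell2_def)
  show "r *\<^sub>R (u + v) = r *\<^sub>R u + r *\<^sub>R v"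
    unfolding scaleR_ell2_def by transfer (simp add: algebra_simps)
  show "(r + s) *\<^sub>R u = r *\<^sub>R u + s *\<^sub>R u"
    unfolding scaleR_ell2_def by transfer (simp add: algebra_simps)
  show "r *\<^sub>R s *\<^sub>R u = (r * s) *\<^sub>R u"
    unfolding scaleR_ell2_def by transfer (simp add: algebra_simps)
  show "1 *\<^sub>R u = u"
    unfolding scaleR_ell2_def by transfer simp
  show "sgn u = inverse (norm u) *\<^sub>R u" by (rule sgn_ell2_def)
  show "dist u v = norm (u - v)" by (rule dist_ell2_def)
  show "uniformity = (INF e\<in>{0<..}. principal {(x, y). dist (x :: 'a ell2) y < e})"
    by (rule uniformity_ell2_def)
  show "open U = (\<forall>x\<in>U. eventually (\<lambda>(x', y). x' = x \<longrightarrow> y \<in> U) uniformity)"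
    by (rule open_ell2_def)
  show "inner u v = inner v u"
  proof transfer
    fix f g :: "'a \<Rightarrow> complex"
    have "l2_inner f g = cnj (l2_inner g f)"
      unfolding l2_inner_def by (simp flip: infsum_cnj add: mult.commute)
    then show "Re (l2_inner f g) = Re (l2_inner g f)" by simp
  qed
  show "inner (u + v) w = inner u w + inner v w"
  proof transfer
    fix f g h :: "'a \<Rightarrow> complex" assume "f \<in> l2" "g \<in> l2" "h \<in> l2"
    then have "l2_inner (\<lambda>i. f i + g i) h = l2_inner f h + l2_inner g h"
      unfolding l2_inner_def by (simp add: distrib_right infsum_add l2_inner_summable')
    then show "Re (l2_inner (\<lambda>i. f i + g i) h) = Re (l2_inner f h) + Re (l2_inner g h)" by simp
  qed
  show "inner (r *\<^sub>R u) v = r * inner u v"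
    unfolding scaleR_ell2_def
  proof transfer
    fix f g :: "'a \<Rightarrow> complex" and r :: real
    have "l2_inner (\<lambda>i. of_real r * f i) g = of_real r * l2_inner f g"
      unfolding l2_inner_def by (simp add: mult.assoc infsum_cmult_right')
    then show "Re (l2_inner (\<lambda>i. of_real r * f i) g) = r * Re (l2_inner f g)" by simp
  qed
  have inner_norm: "inner u u = (norm u)\<^sup>2" for u :: "'a ell2"
  proof transfer
    fix f :: "'a \<Rightarrow> complex" assume f: "f \<in> l2"
    have "l2_inner f f = (\<Sum>\<^sub>\<infinity>i. complex_of_real ((cmod (f i))\<^sup>2))"
      unfolding l2_inner_def by (intro infsum_cong) (simp only: complex_norm_square mult.commute)
    also have "\<dots> = of_real (\<Sum>\<^sub>\<infinity>i. (cmod (f i))\<^sup>2)"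
      using f by (intro infsumI has_sum_of_real has_sum_infsum) (simp add: l2_def)
    finally show "Re (l2_inner f f) = (l2_norm f)\<^sup>2"
      by (simp add: l2_norm_square)
  qed
  have norm_nonneg: "0 \<le> norm u" by transfer (simp add: l2_norm_def infsum_nonneg)
  show "0 \<le> inner u u" by (simp add: inner_norm)
  show "norm u = sqrt (inner u u)" using norm_nonneg by (simp add: inner_norm)
  show "inner u u = 0 \<longleftrightarrow> u = 0"
  proof
    assume "inner u u = 0"
    then have "(norm u)\<^sup>2 = 0" by (simp add: inner_norm)
    then show "u = 0"
    proof transfer
      fix f :: "'a \<Rightarrow> complex" assume f: "f \<in> l2" "(l2_norm f)\<^sup>2 = 0"
      have "f i = 0" for i
        using l2_finite_sum_le[OF f(1), of "{i}"] f(2) by simp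
      then show "f = (\<lambda>i. 0)" by auto
    qed
  qed (simp add: inner_norm, transfer, simp add: l2_norm_def)
qed

end

lemma coord_simps [simp]:
  "coord 0 i = 0" "coord (v + w) i = coord v i + coord w i" "coord (cscale c v) i = c * coord v i"
  "coord (- v) i = - coord v i" "coord (v - w) i = coord v i - coord w i"
  "coord (r *\<^sub>R v) i = of_real r * coord v i"
  by (simp_all add: zero_ell2.rep_eq plus_ell2.rep_eq cscale.rep_eq uminus_ell2_def minus_ell2_def
      scaleR_ell2_def)

lemma coord_sum: "coord (\<Sum>k\<in>I. f k) i = (\<Sum>k\<in>I. coord (f k) i)"
  by (induction I rule: infinite_finite_induct) auto

lemma coord_Abs_ell2: "f \<in> l2 \<Longrightarrow> coord (Abs_ell2 f) = f"
  by (rule Abs_ell2_inverse)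

lemma norm_ell2: "norm v = l2_norm (coord v)"
  by (rule norm_ell2.rep_eq)

lemma inner_ell2: "inner v w = Re (l2_inner (coord v) (coord w))"
  by (rule inner_ell2.rep_eq)

lemma norm_coord_le: "cmod (coord v i) \<le> norm v"
  using l2_finite_sum_le[of "coord v" "{i}"] by (simp add: norm_ell2[symmetric] power2_le_iff_abs_le)

lemma norm_ell2_le:
  assumes "0 \<le> K" "\<And>F. finite F \<Longrightarrow> (\<Sum>i\<in>F. (cmod (coord v i))\<^sup>2) \<le> K\<^sup>2"
  shows "norm v \<le> K"
  unfolding norm_ell2 by (rule power2_le_imp_le[OF l2I(2)[OF assms(2)] assms(1)])

text \<open>A Cauchy sequence converges in each coordinate. The Cauchy estimate for finite sums of coordinates passes to the
  limit, and the finite sums determine the norm.\<close>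

instance ell2 :: (type) banach
proof
  fix \<sigma> :: "nat \<Rightarrow> 'a ell2" assume \<sigma>: "Cauchy \<sigma>"
  have "Cauchy (\<lambda>n. coord (\<sigma> n) i)" for i
  proof (rule metric_CauchyI)
    fix e :: real assume "0 < e"
    then obtain M where "\<And>m n. m \<ge> M \<Longrightarrow> n \<ge> M \<Longrightarrow> dist (\<sigma> m) (\<sigma> n) < e"
      using \<sigma> metric_CauchyD by blast
    moreover have "dist (coord (\<sigma> m) i) (coord (\<sigma> n) i) \<le> dist (\<sigma> m) (\<sigma> n)" for m n
      using norm_coord_le[of "\<sigma> m - \<sigma> n" i] by (simp add: dist_norm)
    ultimately show "\<exists>M. \<forall>m\<ge>M. \<forall>n\<ge>M. dist (coord (\<sigma> m) i) (coord (\<sigma> n) i) < e"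
      by (meson le_less_trans)
  qed
  then have "\<forall>i. \<exists>l. (\<lambda>n. coord (\<sigma> n) i) \<longlonglongrightarrow> l"
    by (meson Cauchy_convergent_iff convergent_def)
  then obtain f where f: "\<And>i. (\<lambda>n. coord (\<sigma> n) i) \<longlonglongrightarrow> f i"
    by metis
  have close: "(\<Sum>i\<in>F. (cmod (f i - coord (\<sigma> n) i))\<^sup>2) \<le> e\<^sup>2"
    if "finite F" "\<And>m. m \<ge> n \<Longrightarrow> norm (\<sigma> m - \<sigma> n) \<le> e" for F n e
  proof (rule LIMSEQ_le_const2)
    show "(\<lambda>m. \<Sum>i\<in>F. (cmod (coord (\<sigma> m) i - coord (\<sigma> n) i))\<^sup>2)
        \<longlonglongrightarrow> (\<Sum>i\<in>F. (cmod (f i - coord (\<sigma> n) i))\<^sup>2)"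
      by (intro tendsto_intros f)
    have "(\<Sum>i\<in>F. (cmod (coord (\<sigma> m) i - coord (\<sigma> n) i))\<^sup>2) \<le> e\<^sup>2" if "m \<ge> n" for m
    proof -
      have "(\<Sum>i\<in>F. (cmod (coord (\<sigma> m) i - coord (\<sigma> n) i))\<^sup>2) \<le> (norm (\<sigma> m - \<sigma> n))\<^sup>2"
        using l2_finite_sum_le[OF coord_l2 \<open>finite F\<close>, of "\<sigma> m - \<sigma> n"] by (simp add: norm_ell2)
      also have "\<dots> \<le> e\<^sup>2"
        by (intro power_mono \<open>\<And>m. m \<ge> n \<Longrightarrow> norm (\<sigma> m - \<sigma> n) \<le> e\<close> that) simp
      finally show ?thesis .
    qed
    then show "\<exists>N. \<forall>m\<ge>N. (\<Sum>i\<in>F. (cmod (coord (\<sigma> m) i - coord (\<sigma> n) i))\<^sup>2) \<le> e\<^sup>2"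
      by blast
  qed
  have ex: "\<exists>N. \<forall>n\<ge>N. \<forall>m\<ge>n. norm (\<sigma> m - \<sigma> n) \<le> e" if "e > 0" for e
    using metric_CauchyD[OF \<sigma> that] by (metis dist_norm less_imp_le order_trans)
  obtain N where N: "\<And>m. m \<ge> N \<Longrightarrow> norm (\<sigma> m - \<sigma> N) \<le> 1"
    using ex[of 1] by auto
  have "(\<lambda>i. f i - coord (\<sigma> N) i) \<in> l2"
    by (rule l2I(1)[OF close[OF _ N]])
  from l2_add[OF this coord_l2[of "\<sigma> N"]] have fl2: "f \<in> l2"
    by simp
  have "\<sigma> \<longlonglongrightarrow> Abs_ell2 f"
  proof (rule metric_LIMSEQ_I)
    fix e :: real assume e: "e > 0"
    then obtain N where N: "\<And>n m. n \<ge> N \<Longrightarrow> m \<ge> n \<Longrightarrow> norm (\<sigma> m - \<sigma> n) \<le> e / 2"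
      using ex[of "e / 2"] by auto
    have "dist (\<sigma> n) (Abs_ell2 f) < e" if "n \<ge> N" for n
    proof -
      have "norm (Abs_ell2 f - \<sigma> n) \<le> e / 2"
        by (rule norm_ell2_le)
          (use e in \<open>auto simp: coord_Abs_ell2[OF fl2] intro!: close N[OF that]\<close>)
      then show ?thesis using e by (simp add: dist_norm norm_minus_commute)
    qed
    then show "\<exists>N. \<forall>n\<ge>N. dist (\<sigma> n) (Abs_ell2 f) < e" by blast
  qed
  then show "convergent \<sigma>" by (auto simp: convergent_def)
qed

lemma cscale_simps:
  "cscale c (v + w) = cscale c v + cscale c w" "cscale (c + d) v = cscale c v + cscale d v"
  "cscale c (cscale d v) = cscale (c * d) v" "cscale 1 v = v" "cscale 0 v = 0" "cscale c 0 = 0"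
  "cscale c (r *\<^sub>R v) = r *\<^sub>R cscale c v" "cscale c (- v) = - cscale c v"
  by (auto intro!: ell2_eqI simp: algebra_simps)

lemma norm_cscale: "norm (cscale c v) = cmod c * norm v"
  by (simp add: norm_ell2 cscale.rep_eq l2_norm_def norm_mult power_mult_distrib infsum_cmult_right'
      real_sqrt_mult)

lemma l2_inner_scale_right: "l2_inner f (\<lambda>i. c * g i) = c * l2_inner f g"
  unfolding l2_inner_def by (subst infsum_cmult_right'[symmetric]) (simp add: mult_ac)

lemma l2_inner_scale_left: "l2_inner (\<lambda>i. c * f i) g = cnj c * l2_inner f g"
  unfolding l2_inner_def by (subst infsum_cmult_right'[symmetric]) (simp add: mult_ac)

lemma inner_cscale: "inner (cscale c v) w = inner v (cscale (cnj c) w)"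
  by (simp add: inner_ell2 cscale.rep_eq l2_inner_scale_left l2_inner_scale_right)

text \<open>The real inner product determines the complex one, because \<open>Im z = Re (-i z)\<close>.\<close>

lemma l2_inner_eqI:
  assumes "\<And>c. Re (c * z) = Re (c * (w :: complex))"
  shows "z = w"
  using assms[of 1] assms[of "-\<i>"] by (simp add: complex_eq_iff)


section \<open>The C*-algebra of bounded operators\<close>

lemma bounded_linear_cscale: "bounded_linear (cscale c)"
  by (rule bounded_linear_intro[where K = "cmod c"]) (simp_all add: cscale_simps norm_cscale mult.commute)

definition cscale_op :: "complex \<Rightarrow> 'i ell2 \<Rightarrow>\<^sub>L 'i ell2" where
  "cscale_op c = Blinfun (cscale c)"

lemma cscale_op_apply [simp]: "cscale_op c v = cscale c v"
  by (simp add: cscale_op_def bounded_linear_Blinfun_apply bounded_linear_cscale)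

text \<open>The inner product here is the real part of the complex one. For complex-linear operators this gives the usual
  notion of adjoint.\<close>

definition is_adjoint :: "('i ell2 \<Rightarrow>\<^sub>L 'i ell2) \<Rightarrow> ('i ell2 \<Rightarrow>\<^sub>L 'i ell2) \<Rightarrow> bool" where
  "is_adjoint S T \<longleftrightarrow> (\<forall>v w. inner (T v) w = inner v (S w))"

text \<open>The carrier requires an adjoint, which by the Riesz representation theorem every bounded complex-linear
  operator has.\<close>

definition ell2_ops :: "('i ell2 \<Rightarrow>\<^sub>L 'i ell2) cstar_alg" where
  "ell2_ops = \<lparr>carrier = {T. (\<forall>c v. blinfun_apply T (cscale c v) = cscale c (blinfun_apply T v)) \<and> (\<exists>S. is_adjoint S T)},
     mult = (o\<^sub>L), one = id_blinfun, zero = 0, add = (+), smult = (\<lambda>c T. cscale_op c o\<^sub>L T),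
     star = (\<lambda>T. SOME S. is_adjoint S T), cnorm = norm\<rparr>"

lemma ell2_ops_sel [simp]:
  "mult ell2_ops = (o\<^sub>L)" "one ell2_ops = id_blinfun" "zero ell2_ops = 0" "add ell2_ops = (+)"
  "smult ell2_ops = (\<lambda>c T. cscale_op c o\<^sub>L T)" "cnorm ell2_ops = norm"
  by (simp_all add: ell2_ops_def)

lemma ell2_ops_carrierI:
  fixes T :: "'i ell2 \<Rightarrow>\<^sub>L 'i ell2"
  shows
  "\<lbrakk>\<And>c v. T (cscale c v) = cscale c (T v); is_adjoint S T\<rbrakk> \<Longrightarrow> T \<in> carrier ell2_ops"
  by (auto simp: ell2_ops_def)

lemma ell2_ops_cscale:
  fixes T :: "'i ell2 \<Rightarrow>\<^sub>L 'i ell2"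
  shows "T \<in> carrier ell2_ops \<Longrightarrow> T (cscale c v) = cscale c (T v)"
  by (simp add: ell2_ops_def)

lemma is_adjoint_unique:
  assumes "is_adjoint S T" "is_adjoint S' T"
  shows "S = S'"
proof (rule blinfun_eqI)
  fix w
  have "inner v (S w - S' w) = 0" for v
    using assms by (simp add: is_adjoint_def inner_diff_right)
  then show "S w = S' w"
    by (metis inner_eq_zero_iff right_minus_eq)
qed

lemma is_adjoint_sym: "is_adjoint S T \<Longrightarrow> is_adjoint T S"
  by (simp add: is_adjoint_def inner_commute)

lemma is_adjoint_star: "T \<in> carrier ell2_ops \<Longrightarrow> is_adjoint (star ell2_ops T) T"
  by (auto simp: ell2_ops_def intro: someI)

lemma star_ell2_ops_eqI:
  assumes "is_adjoint S T"
  shows "star ell2_ops T = S"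
proof -
  have "is_adjoint (SOME S. is_adjoint S T) T"
    by (rule someI) fact
  then show ?thesis
    using is_adjoint_unique[OF _ assms] by (simp add: ell2_ops_def)
qed

lemma is_adjoint_carrier:
  assumes "is_adjoint S T" "T \<in> carrier ell2_ops"
  shows "S \<in> carrier ell2_ops"
proof (rule ell2_ops_carrierI)
  show "is_adjoint T S" by (rule is_adjoint_sym) fact
  fix c w
  have "inner v (S (cscale c w)) = inner v (cscale c (S w))" for v
  proof -
    have "inner v (S (cscale c w)) = inner (T (cscale (cnj c) v)) w"
      using assms by (simp add: is_adjoint_def ell2_ops_cscale inner_cscale)
    also have "\<dots> = inner v (cscale c (S w))"
      using assms by (simp add: is_adjoint_def inner_cscale)
    finally show ?thesis .
  qed
  then have "inner v (S (cscale c w) - cscale c (S w)) = 0" for v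
    by (simp add: inner_diff_right)
  then show "S (cscale c w) = cscale c (S w)"
    by (metis inner_eq_zero_iff right_minus_eq)
qed

lemma norm_adjoint_le:
  assumes "is_adjoint S T"
  shows "norm S \<le> norm T"
proof (rule norm_blinfun_bound)
  fix w
  have "norm (S w) * norm (S w) = inner (T (S w)) w"
    using assms by (simp add: is_adjoint_def power2_norm_eq_inner[symmetric] power2_eq_square)
  also have "\<dots> \<le> norm (T (S w)) * norm w"
    by (rule norm_cauchy_schwarz)
  also have "\<dots> \<le> norm T * norm (S w) * norm w"
    by (intro mult_right_mono norm_blinfun) simp
  finally have "norm (S w) * norm (S w) \<le> norm (S w) * (norm T * norm w)"
    by (simp add: mult_ac)
  then show "norm (S w) \<le> norm T * norm w"
    by (cases "norm (S w) = 0") auto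
qed simp

lemma is_adjoint_diff: "is_adjoint S T \<Longrightarrow> is_adjoint S' T' \<Longrightarrow> is_adjoint (S - S') (T - T')"
  by (simp add: is_adjoint_def blinfun.diff_left inner_diff_left inner_diff_right)

lemma is_adjoint_add: "is_adjoint S T \<Longrightarrow> is_adjoint S' T' \<Longrightarrow> is_adjoint (S + S') (T + T')"
  by (simp add: is_adjoint_def blinfun.add_left inner_add_left inner_add_right)

lemma is_adjoint_compose: "is_adjoint S T \<Longrightarrow> is_adjoint S' T' \<Longrightarrow> is_adjoint (S' o\<^sub>L S) (T o\<^sub>L T')"
  by (simp add: is_adjoint_def)

lemma is_adjoint_cscale: "is_adjoint S T \<Longrightarrow> is_adjoint (S o\<^sub>L cscale_op (cnj c)) (cscale_op c o\<^sub>L T)"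
  by (simp add: is_adjoint_def inner_cscale)

lemma norm_cscale_op_compose:
  fixes T :: "'i ell2 \<Rightarrow>\<^sub>L 'i ell2"
  shows "norm (cscale_op c o\<^sub>L T) = cmod c * norm T"
proof (rule antisym)
  have le: "norm (cscale_op c o\<^sub>L T) \<le> cmod c * norm T" for c and T :: "'i ell2 \<Rightarrow>\<^sub>L 'i ell2"
    by (rule norm_blinfun_bound)
      (auto simp: norm_cscale mult.assoc intro!: mult_left_mono norm_blinfun)
  then show "norm (cscale_op c o\<^sub>L T) \<le> cmod c * norm T" .
  show "cmod c * norm T \<le> norm (cscale_op c o\<^sub>L T)"
  proof (cases "c = 0")
    case False
    have "cscale_op (inverse c) o\<^sub>L (cscale_op c o\<^sub>L T) = T"
      using False by (intro blinfun_eqI) (simp add: cscale_simps)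
    then have "norm T \<le> cmod (inverse c) * norm (cscale_op c o\<^sub>L T)"
      using le[of "inverse c" "cscale_op c o\<^sub>L T"] by simp
    then show ?thesis using False by (simp add: norm_inverse norm_divide field_simps)
  qed simp
qed

lemma ell2_ops_minus:
  fixes S T :: "'i ell2 \<Rightarrow>\<^sub>L 'i ell2"
  assumes "abelian_group (ell2_ops :: ('i ell2 \<Rightarrow>\<^sub>L 'i ell2) cstar_alg)" "T \<in> carrier ell2_ops" "- S \<in> carrier ell2_ops" "S \<in> carrier ell2_ops"
  shows "T \<ominus>\<^bsub>ell2_ops\<^esub> S = T - S"
  using abelian_group.minus_equality[OF assms(1), of "- S" S] assms by (simp add: a_minus_def)

lemma cstar_algebra_ell2_ops: "cstar_algebra (ell2_ops :: ('i ell2 \<Rightarrow>\<^sub>L 'i ell2) cstar_alg)"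
proof -
  let ?E = "ell2_ops :: ('i ell2 \<Rightarrow>\<^sub>L 'i ell2) cstar_alg"
  note lin = blinfun.add_left blinfun.add_right blinfun.diff_left blinfun.minus_left cscale_simps ell2_ops_cscale
  have add_c: "S + T \<in> carrier ?E" if "S \<in> carrier ?E" "T \<in> carrier ?E" for S T
    using that by (auto simp: lin intro!: ell2_ops_carrierI is_adjoint_add is_adjoint_star)
  have mult_c: "S o\<^sub>L T \<in> carrier ?E" if "S \<in> carrier ?E" "T \<in> carrier ?E" for S T
    using that by (auto simp: lin intro!: ell2_ops_carrierI is_adjoint_compose is_adjoint_star)
  have smult_c: "cscale_op c o\<^sub>L T \<in> carrier ?E" if "T \<in> carrier ?E" for c T
    by (rule ell2_ops_carrierI[OF _ is_adjoint_cscale[OF is_adjoint_star[OF that]]])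
      (use that in \<open>simp add: lin mult.commute\<close>)
  have zero_c: "0 \<in> carrier ?E"
    by (rule ell2_ops_carrierI[of _ 0]) (auto simp: is_adjoint_def cscale_simps)
  have one_c: "id_blinfun \<in> carrier ?E"
    by (rule ell2_ops_carrierI[of _ id_blinfun]) (auto simp: is_adjoint_def)
  have minus_c: "- T \<in> carrier ?E" if "T \<in> carrier ?E" for T
  proof -
    have "cscale_op (-1) o\<^sub>L T = - T"
      by (intro blinfun_eqI ell2_eqI) (simp add: blinfun.minus_left)
    then show ?thesis using smult_c[OF that, of "-1"] by simp
  qed
  have ag: "abelian_group ?E"
    by (rule abelian_groupI) (auto simp: add_c zero_c add_ac intro!: bexI[OF _ minus_c])
  have ring: "ring ?E"
    by (rule ringI[OF ag]; (rule monoidI)?)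
      (auto simp: mult_c one_c lin intro!: blinfun_eqI)
  have module: "module (ring_of_type_algebra :: complex ring) ?E"
    by (rule moduleI[OF cring_from_type_algebra ag])
      (auto simp: ring_of_type_algebra_def smult_c lin intro!: blinfun_eqI)
  have minus: "T \<ominus>\<^bsub>?E\<^esub> S = T - S" if "T \<in> carrier ?E" "S \<in> carrier ?E" for T S
    using that minus_c by (intro ell2_ops_minus ag)
  have dist: "cdist ?E S T = dist S T" if "T \<in> carrier ?E" "S \<in> carrier ?E" for T S
    using that by (simp add: cdist_def minus dist_norm)
  have star_c: "star ?E T \<in> carrier ?E" if "T \<in> carrier ?E" for T
    by (rule is_adjoint_carrier[OF is_adjoint_star[OF that] that])
  have metric: "Metric_space (carrier ?E) (cdist ?E)"
    by unfold_locales
      (auto simp: dist dist_commute dist_triangle, auto simp: cdist_def minus norm_minus_commute)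
  have complete: "Metric_space.mcomplete (carrier ?E) (cdist ?E)"
  proof -
    interpret M: Metric_space "carrier ?E" "cdist ?E" by (rule metric)
    show ?thesis
      unfolding M.mcomplete_def
    proof (intro allI impI)
      fix \<sigma> assume \<sigma>: "M.MCauchy \<sigma>"
      then have Xc: "\<sigma> n \<in> carrier ?E" for n by (auto simp: M.MCauchy_def)
      have "Cauchy \<sigma>"
        using \<sigma> unfolding M.MCauchy_def Cauchy_altdef2 by (auto simp: dist Xc) (metis Xc dist order_refl)
      then obtain T where T: "\<sigma> \<longlonglongrightarrow> T"
        by (meson Cauchy_convergent_iff convergent_def)
      define Y where "Y n = star ?E (\<sigma> n)" for n
      have adj: "is_adjoint (Y n) (\<sigma> n)" for n
        unfolding Y_def by (rule is_adjoint_star[OF Xc])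
      have "dist (Y m) (Y n) \<le> dist (\<sigma> m) (\<sigma> n)" for m n
        unfolding dist_norm by (rule norm_adjoint_le[OF is_adjoint_diff[OF adj adj]])
      then have "Cauchy Y"
        using \<open>Cauchy \<sigma>\<close> unfolding Cauchy_def by (meson le_less_trans)
      then obtain S where S: "Y \<longlonglongrightarrow> S"
        by (meson Cauchy_convergent_iff convergent_def)
      have app: "(\<lambda>n. Z n v) \<longlonglongrightarrow> U v" if "Z \<longlonglongrightarrow> U" for Z and U :: "'i ell2 \<Rightarrow>\<^sub>L 'i ell2" and v
        by (intro blinfun.tendsto that tendsto_const)
      have "T \<in> carrier ?E"
      proof (rule ell2_ops_carrierI)
        show "T (cscale c v) = cscale c (T v)" for c v
        proof (rule LIMSEQ_unique[OF app[OF T]])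
          show "(\<lambda>n. \<sigma> n (cscale c v)) \<longlonglongrightarrow> cscale c (T v)"
            using bounded_linear.tendsto[OF bounded_linear_cscale app[OF T]]
            by (simp add: ell2_ops_cscale[OF Xc])
        qed
        show "is_adjoint S T"
          unfolding is_adjoint_def
        proof (intro allI)
          fix v w
          have lim: "(\<lambda>n. inner (\<sigma> n v) w) \<longlonglongrightarrow> inner (T v) w"
            by (intro tendsto_intros app T)
          have "(\<lambda>n. inner v (Y n w)) \<longlonglongrightarrow> inner v (S w)"
            by (intro tendsto_intros app S)
          then have "(\<lambda>n. inner (\<sigma> n v) w) \<longlonglongrightarrow> inner v (S w)"
            using adj by (simp add: is_adjoint_def)
          then show "inner (T v) w = inner v (S w)"
            by (rule LIMSEQ_unique[OF lim])
        qed
      qed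
      moreover have "(\<lambda>n. cdist ?E (\<sigma> n) T) \<longlonglongrightarrow> 0"
        using iffD1[OF tendsto_dist_iff T] calculation by (simp add: dist Xc)
      ultimately show "\<exists>T. limitin M.mtopology \<sigma> T sequentially"
        using Xc by (auto simp: M.limitin_metric_dist_null)
    qed
  qed
  have star_eqs: "star ?E (S + T) = star ?E S + star ?E T" "star ?E (S o\<^sub>L T) = star ?E T o\<^sub>L star ?E S"
    if "S \<in> carrier ?E" "T \<in> carrier ?E" for S T
    using that by (auto intro!: star_ell2_ops_eqI is_adjoint_add is_adjoint_compose is_adjoint_star)
  have star_smult: "star ?E (cscale_op c o\<^sub>L T) = cscale_op (cnj c) o\<^sub>L star ?E T" if "T \<in> carrier ?E" for c T
  proof -
    have "star ?E T o\<^sub>L cscale_op (cnj c) = cscale_op (cnj c) o\<^sub>L star ?E T"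
      by (intro blinfun_eqI) (simp add: ell2_ops_cscale star_c that)
    then show ?thesis
      using star_ell2_ops_eqI[OF is_adjoint_cscale[OF is_adjoint_star[OF that], of c]] by simp
  qed
  have ident: "norm (star ?E T o\<^sub>L T) = (norm T)\<^sup>2" if "T \<in> carrier ?E" for T
  proof (rule antisym)
    have "norm (star ?E T o\<^sub>L T) \<le> norm (star ?E T) * norm T"
      by (rule norm_blinfun_compose)
    also have "\<dots> \<le> norm T * norm T"
      by (intro mult_right_mono norm_adjoint_le is_adjoint_star that) simp
    finally show "norm (star ?E T o\<^sub>L T) \<le> (norm T)\<^sup>2" by (simp add: power2_eq_square)
    have "norm T \<le> sqrt (norm (star ?E T o\<^sub>L T))"
    proof (rule norm_blinfun_bound)
      fix v
      have "(norm (T v))\<^sup>2 = inner v ((star ?E T o\<^sub>L T) v)"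
        using is_adjoint_star[OF that] by (simp add: is_adjoint_def power2_norm_eq_inner)
      also have "\<dots> \<le> norm v * norm ((star ?E T o\<^sub>L T) v)"
        by (rule norm_cauchy_schwarz)
      also have "\<dots> \<le> norm v * (norm (star ?E T o\<^sub>L T) * norm v)"
        by (intro mult_left_mono norm_blinfun) simp
      also have "\<dots> = (sqrt (norm (star ?E T o\<^sub>L T)) * norm v)\<^sup>2"
        by (simp add: power_mult_distrib power2_eq_square)
      finally show "norm (T v) \<le> sqrt (norm (star ?E T o\<^sub>L T)) * norm v"
        by (rule power2_le_imp_le) simp
    qed simp
    then show "(norm T)\<^sup>2 \<le> norm (star ?E T o\<^sub>L T)"
      using power_mono[of "norm T" _ 2] by fastforce
  qed
  show ?thesis
    by (intro cstar_algebra.intro cstar_algebra_axioms.intro ring module)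
      (use complete in \<open>auto simp: star_c star_eqs star_smult ident norm_cscale_op_compose
        norm_triangle_ineq norm_blinfun_compose lin
        intro!: blinfun_eqI star_ell2_ops_eqI is_adjoint_sym is_adjoint_star\<close>)
qed

section \<open>Operators on the Hilbert space tensor product\<close>

lemma l2_reindex:
  assumes "bij \<beta>"
  shows "f \<circ> \<beta> \<in> l2 \<longleftrightarrow> f \<in> l2" "l2_inner (f \<circ> \<beta>) (g \<circ> \<beta>) = l2_inner f g"
  using summable_on_reindex_bij_betw[OF assms, of "\<lambda>i. (cmod (f i))\<^sup>2"]
    infsum_reindex_bij_betw[OF assms, of "\<lambda>i. cnj (f i) * g i"]
  by (simp_all add: l2_def l2_inner_def o_def)

text \<open>The unitary operator induced by a bijection of the index sets.\<close>

definition reindex :: "('k \<Rightarrow> 'i) \<Rightarrow> 'i ell2 \<Rightarrow> 'k ell2" where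
  "reindex \<beta> v = Abs_ell2 (coord v \<circ> \<beta>)"

lemma coord_reindex [simp]: "bij \<beta> \<Longrightarrow> coord (reindex \<beta> v) k = coord v (\<beta> k)"
  by (simp add: reindex_def coord_Abs_ell2 l2_reindex)

lemma inner_reindex: "bij \<beta> \<Longrightarrow> inner (reindex \<beta> v) (reindex \<beta> w) = inner v w"
  by (simp add: inner_ell2 reindex_def coord_Abs_ell2 l2_reindex)

lemma norm_reindex: "bij \<beta> \<Longrightarrow> norm (reindex \<beta> v) = norm v"
  by (simp add: norm_eq_sqrt_inner inner_reindex)

lemma reindex_inverse:
  assumes "bij \<beta>"
  shows "reindex \<beta> (reindex (inv_into UNIV \<beta>) v) = v" "reindex (inv_into UNIV \<beta>) (reindex \<beta> w) = w"
  using assms bij_imp_bij_inv[OF assms]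
  by (auto intro!: ell2_eqI simp: bij_inv_eq_iff[symmetric] bij_is_surj surj_f_inv_f bij_is_inj)

lemma bounded_linear_reindex: "bij \<beta> \<Longrightarrow> bounded_linear (reindex \<beta>)"
  by (rule bounded_linear_intro[where K = 1]) (auto intro!: ell2_eqI simp: norm_reindex)

lemma reindex_cscale: "bij \<beta> \<Longrightarrow> reindex \<beta> (cscale c v) = cscale c (reindex \<beta> v)"
  by (auto intro!: ell2_eqI)

definition conj_op :: "('k \<Rightarrow> 'i) \<Rightarrow> ('k ell2 \<Rightarrow>\<^sub>L 'k ell2) \<Rightarrow> 'i ell2 \<Rightarrow>\<^sub>L 'i ell2" where
  "conj_op \<beta> T = Blinfun (\<lambda>v. reindex (inv_into UNIV \<beta>) (T (reindex \<beta> v)))"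

lemma conj_op_apply:
  assumes "bij \<beta>"
  shows "conj_op \<beta> T v = reindex (inv_into UNIV \<beta>) (T (reindex \<beta> v))"
proof -
  have "bounded_linear (\<lambda>v. reindex (inv_into UNIV \<beta>) (T (reindex \<beta> v)))"
    by (intro bounded_linear_compose[OF bounded_linear_reindex[OF bij_imp_bij_inv[OF assms]]]
        bounded_linear_compose[OF blinfun.bounded_linear_right] bounded_linear_reindex assms)
  then show ?thesis
    by (simp add: conj_op_def bounded_linear_Blinfun_apply)
qed

lemma is_adjoint_conj_op:
  assumes "bij \<beta>" "is_adjoint S T"
  shows "is_adjoint (conj_op \<beta> S) (conj_op \<beta> T)"
  unfolding is_adjoint_def
proof (intro allI)
  fix v w
  have "inner (reindex (inv_into UNIV \<beta>) (T (reindex \<beta> v))) w = inner (T (reindex \<beta> v)) (reindex \<beta> w)"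
    using inner_reindex[OF assms(1), of _ w] by (metis reindex_inverse(1)[OF assms(1)])
  also have "\<dots> = inner (reindex \<beta> v) (S (reindex \<beta> w))"
    using assms(2) by (simp add: is_adjoint_def)
  also have "\<dots> = inner v (reindex (inv_into UNIV \<beta>) (S (reindex \<beta> w)))"
    using inner_reindex[OF assms(1), of v] by (metis reindex_inverse(1)[OF assms(1)])
  finally show "inner (conj_op \<beta> T v) w = inner v (conj_op \<beta> S w)"
    by (simp add: conj_op_apply[OF assms(1)])
qed

lemma star_morphism_conj_op:
  assumes "bij \<beta>"
  shows "star_morphism ell2_ops ell2_ops (conj_op \<beta>)"
proof -
  note bi = bij_imp_bij_inv[OF assms]
  note app = conj_op_apply[OF assms] reindex_cscale[OF assms] reindex_cscale[OF bi] reindex_inverse[OF assms]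
  have closed: "conj_op \<beta> T \<in> carrier ell2_ops" if "T \<in> carrier ell2_ops" for T
    by (rule ell2_ops_carrierI[OF _ is_adjoint_conj_op[OF assms is_adjoint_star[OF that]]])
      (simp add: app ell2_ops_cscale[OF that])
  have add: "conj_op \<beta> (S + T) = conj_op \<beta> S + conj_op \<beta> T" for S T
    using bi by (auto intro!: blinfun_eqI ell2_eqI simp: app blinfun.add_left)
  have mult: "conj_op \<beta> (S o\<^sub>L T) = conj_op \<beta> S o\<^sub>L conj_op \<beta> T"
    if "S \<in> carrier ell2_ops" "T \<in> carrier ell2_ops" for S T
    by (auto intro!: blinfun_eqI simp: app)
  have smult: "conj_op \<beta> (cscale_op c o\<^sub>L T) = cscale_op c o\<^sub>L conj_op \<beta> T" for c T
    by (auto intro!: blinfun_eqI simp: app)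
  have star: "conj_op \<beta> (star ell2_ops T) = star ell2_ops (conj_op \<beta> T)" if "T \<in> carrier ell2_ops" for T
    by (rule sym, rule star_ell2_ops_eqI, rule is_adjoint_conj_op[OF assms is_adjoint_star[OF that]])
  show ?thesis
    unfolding star_morphism_def by (auto simp: closed add mult smult star)
qed

lemma norm_conj_op:
  assumes "bij \<beta>" "T \<in> carrier ell2_ops"
  shows "norm (conj_op \<beta> T) = norm T"
proof (rule antisym)
  show "norm (conj_op \<beta> T) \<le> norm T"
    using star_morphism_contractive[OF cstar_algebra_ell2_ops cstar_algebra_ell2_ops
        star_morphism_conj_op[OF assms(1)] assms(2)] by simp
  have "conj_op (inv_into UNIV \<beta>) (conj_op \<beta> T) = T"
    using bij_imp_bij_inv[OF assms(1)]
    by (intro blinfun_eqI) (simp add: conj_op_apply assms(1) reindex_inverse inv_inv_eq)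
  then show "norm T \<le> norm (conj_op \<beta> T)"
    using star_morphism_contractive[OF cstar_algebra_ell2_ops cstar_algebra_ell2_ops
        star_morphism_conj_op[OF bij_imp_bij_inv[OF assms(1)]], of "conj_op \<beta> T"]
      star_morphismD(1)[OF star_morphism_conj_op[OF assms(1)] assms(2)] by simp
qed

text \<open>A vector of the tensor product is a square-summable family of its rows.\<close>

definition row :: "('i \<times> 'j) ell2 \<Rightarrow> 'i \<Rightarrow> 'j ell2" where
  "row F x = Abs_ell2 (\<lambda>y. coord F (x, y))"

lemma coord_row [simp]:
  fixes F :: "('i \<times> 'j) ell2"
  shows "coord (row F x) y = coord F (x, y)"
proof -
  have "(\<lambda>y. coord F (x, y)) \<in> l2"
  proof (rule l2I(1))
    fix I :: "'j set" assume I: "finite I"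
    have "(\<Sum>y\<in>I. (cmod (coord F (x, y)))\<^sup>2) = (\<Sum>p\<in>Pair x ` I. (cmod (coord F p))\<^sup>2)"
      by (subst sum.reindex) (auto simp: inj_on_def)
    then show "(\<Sum>y\<in>I. (cmod (coord F (x, y)))\<^sup>2) \<le> (l2_norm (coord F))\<^sup>2"
      using l2_finite_sum_le[OF coord_l2, of "Pair x ` I" F] I by simp
  qed
  then show ?thesis by (simp add: row_def coord_Abs_ell2)
qed

lemma sum_norm_row_le:
  assumes "finite I"
  shows "(\<Sum>x\<in>I. (norm (row F x))\<^sup>2) \<le> (norm F)\<^sup>2"
proof -
  have s: "(\<lambda>(x, y). (cmod (coord F (x, y)))\<^sup>2) summable_on UNIV \<times> UNIV"
    using coord_l2[of F] by (simp add: l2_def case_prod_unfold)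
  have "(\<Sum>x\<in>I. (norm (row F x))\<^sup>2) = (\<Sum>x\<in>I. \<Sum>\<^sub>\<infinity>y. (cmod (coord F (x, y)))\<^sup>2)"
    by (simp add: norm_ell2 l2_norm_square)
  also have "\<dots> \<le> (\<Sum>\<^sub>\<infinity>x. \<Sum>\<^sub>\<infinity>y. (cmod (coord F (x, y)))\<^sup>2)"
    using summable_on_Sigma_banach[OF s] assms
    by (intro finite_sum_le_infsum) (auto intro: infsum_nonneg)
  also have "\<dots> = (norm F)\<^sup>2"
    using infsum_Sigma'_banach[OF s] by (simp add: norm_ell2 l2_norm_square case_prod_unfold)
  finally show ?thesis .
qed

lemma inner_rows: "inner F G = (\<Sum>\<^sub>\<infinity>x. inner (row F x) (row G x))"
proof -
  have s: "(\<lambda>(x, y). cnj (coord F (x, y)) * coord G (x, y)) summable_on UNIV \<times> UNIV"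
    using l2_inner_summable'[OF coord_l2[of F] coord_l2[of G]] by (simp add: case_prod_unfold)
  have "l2_inner (coord F) (coord G) = (\<Sum>\<^sub>\<infinity>x. l2_inner (coord (row F x)) (coord (row G x)))"
    using infsum_Sigma'_banach[OF s] by (simp add: l2_inner_def case_prod_unfold)
  moreover have "(\<lambda>x. l2_inner (coord (row F x)) (coord (row G x))) summable_on UNIV"
    using summable_on_Sigma_banach[OF s] by (simp add: l2_inner_def)
  ultimately show ?thesis
    by (simp add: inner_ell2 infsum_Re)
qed

lemma l2_of_rows:
  assumes "\<And>I. finite I \<Longrightarrow> (\<Sum>x\<in>I. (norm (c x))\<^sup>2) \<le> K"
  shows "(\<lambda>(x, y). coord (c x) y) \<in> l2" and "(l2_norm (\<lambda>(x, y). coord (c x) y))\<^sup>2 \<le> K"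
proof -
  have *: "(\<Sum>p\<in>I. (cmod ((\<lambda>(x, y). coord (c x) y) p))\<^sup>2) \<le> K" if I: "finite I" for I
  proof -
    have "(\<Sum>p\<in>I. (cmod ((\<lambda>(x, y). coord (c x) y) p))\<^sup>2)
        \<le> (\<Sum>p\<in>fst ` I \<times> snd ` I. (cmod ((\<lambda>(x, y). coord (c x) y) p))\<^sup>2)"
      using I by (intro sum_mono2) force+
    also have "\<dots> = (\<Sum>x\<in>fst ` I. \<Sum>y\<in>snd ` I. (cmod (coord (c x) y))\<^sup>2)"
      by (simp add: sum.cartesian_product case_prod_unfold)
    also have "\<dots> \<le> (\<Sum>x\<in>fst ` I. (norm (c x))\<^sup>2)"
      using I by (intro sum_mono) (simp add: norm_ell2 l2_finite_sum_le)
    also have "\<dots> \<le> K" using I by (intro assms) simp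
    finally show ?thesis .
  qed
  show "(\<lambda>(x, y). coord (c x) y) \<in> l2" "(l2_norm (\<lambda>(x, y). coord (c x) y))\<^sup>2 \<le> K"
    using l2I[of "\<lambda>(x, y). coord (c x) y" K] * by auto
qed

text \<open>The operator \<open>1 \<otimes> T\<close>, which applies \<open>T\<close> to every row. As it is given by a formula on the
  whole Hilbert space tensor product, \<open>S \<otimes> T\<close> can be defined below as a composition.\<close>

definition right_op :: "('j ell2 \<Rightarrow>\<^sub>L 'j ell2) \<Rightarrow> ('i \<times> 'j) ell2 \<Rightarrow>\<^sub>L ('i \<times> 'j) ell2" where
  "right_op T = Blinfun (\<lambda>F. Abs_ell2 (\<lambda>(x, y). coord (T (row F x)) y))"

lemma row_linear: "row (F + G) x = row F x + row G x" "row (r *\<^sub>R F) x = r *\<^sub>R row F x"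
    "row (cscale c F) x = cscale c (row F x)"
  by (auto intro: ell2_eqI)

lemma coord_right_op:
  fixes F :: "('i \<times> 'j) ell2"
  shows "coord (right_op T F) (x, y) = coord (T (row F x)) y"
proof -
  have le: "(\<Sum>x\<in>I. (norm (T (row F x)))\<^sup>2) \<le> (norm T * norm F)\<^sup>2" if "finite I"
    for F :: "('i \<times> 'j) ell2" and I :: "'i set"
  proof -
    have "(\<Sum>x\<in>I. (norm (T (row F x)))\<^sup>2) \<le> (\<Sum>x\<in>I. (norm T)\<^sup>2 * (norm (row F x))\<^sup>2)"
      unfolding power_mult_distrib[symmetric] by (intro sum_mono power_mono norm_blinfun) auto
    also have "\<dots> \<le> (norm T * norm F)\<^sup>2"
      using sum_norm_row_le[OF that, of F]
      by (simp add: power_mult_distrib mult_left_mono flip: sum_distrib_left)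
    finally show ?thesis .
  qed
  have c: "coord (Abs_ell2 (\<lambda>(x, y). coord (T (row F x)) y)) p = coord (T (row F (fst p))) (snd p)"
    for F :: "('i \<times> 'j) ell2" and p
    using l2_of_rows(1)[of "\<lambda>x. T (row F x)", OF le] by (simp add: coord_Abs_ell2 case_prod_unfold)
  have "bounded_linear (\<lambda>F :: ('i \<times> 'j) ell2. Abs_ell2 (\<lambda>(x, y). coord (T (row F x)) y))"
  proof (rule bounded_linear_intro[where K = "norm T"])
    fix F :: "('i \<times> 'j) ell2"
    have "(norm (Abs_ell2 (\<lambda>(x, y). coord (T (row F x)) y)))\<^sup>2 \<le> (norm T * norm F)\<^sup>2"
      using l2_of_rows[of "\<lambda>x. T (row F x)", OF le] by (simp add: norm_ell2 coord_Abs_ell2)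
    then have "norm (Abs_ell2 (\<lambda>(x, y). coord (T (row F x)) y)) \<le> norm T * norm F"
      by (rule power2_le_imp_le) simp
    then show "norm (Abs_ell2 (\<lambda>(x, y). coord (T (row F x)) y)) \<le> norm F * norm T"
      by (simp only: mult.commute)
  qed (rule ell2_eqI, simp only: c coord_simps, simp add: row_linear blinfun.add_right blinfun.scaleR_right)+
  then show ?thesis
    by (simp add: right_op_def bounded_linear_Blinfun_apply c)
qed

lemma row_right_op: "row (right_op T F) x = T (row F x)"
  by (auto intro: ell2_eqI simp: coord_right_op)

lemma is_adjoint_right_op:
  assumes "is_adjoint S T"
  shows "is_adjoint (right_op S) (right_op T)"
  using assms by (simp add: is_adjoint_def inner_rows row_right_op)

lemma star_morphism_right_op: "star_morphism ell2_ops ell2_ops right_op"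
proof -
  have closed: "right_op T \<in> carrier ell2_ops" if "T \<in> carrier ell2_ops" for T
    by (rule ell2_ops_carrierI[OF _ is_adjoint_right_op[OF is_adjoint_star[OF that]]])
      (auto intro!: ell2_eqI simp: coord_right_op row_linear ell2_ops_cscale[OF that])
  have add: "right_op (S + T) = right_op S + right_op T" for S T
    by (auto intro!: blinfun_eqI ell2_eqI simp: coord_right_op blinfun.add_left)
  have mult: "right_op (S o\<^sub>L T) = right_op S o\<^sub>L right_op T"
    if "S \<in> carrier ell2_ops" "T \<in> carrier ell2_ops" for S T
    by (auto intro!: blinfun_eqI ell2_eqI simp: coord_right_op row_right_op)
  have smult: "right_op (cscale_op c o\<^sub>L T) = cscale_op c o\<^sub>L right_op T" for c T
    by (auto intro!: blinfun_eqI ell2_eqI simp: coord_right_op)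
  have star: "right_op (star ell2_ops T) = star ell2_ops (right_op T)" if "T \<in> carrier ell2_ops" for T
    by (rule sym, rule star_ell2_ops_eqI, rule is_adjoint_right_op[OF is_adjoint_star[OF that]])
  show ?thesis
    unfolding star_morphism_def by (auto simp: closed add mult smult star)
qed

text \<open>The operator \<open>T \<otimes> 1\<close>.\<close>

definition left_op :: "('i ell2 \<Rightarrow>\<^sub>L 'i ell2) \<Rightarrow> ('i \<times> 'j) ell2 \<Rightarrow>\<^sub>L ('i \<times> 'j) ell2" where
  "left_op T = conj_op prod.swap (right_op T)"

lemma star_morphism_left_op: "star_morphism ell2_ops ell2_ops left_op"
  using star_morphism_comp[OF star_morphism_right_op star_morphism_conj_op[of prod.swap]]
  by (simp add: left_op_def[abs_def])

definition ten :: "'i ell2 \<Rightarrow> 'j ell2 \<Rightarrow> ('i \<times> 'j) ell2" where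
  "ten f g = Abs_ell2 (\<lambda>(x, y). coord f x * coord g y)"

lemma sum_norm_cscale_le:
  assumes "finite I"
  shows "(\<Sum>x\<in>I. (norm (cscale (coord f x) g))\<^sup>2) \<le> (norm f * norm g)\<^sup>2"
proof -
  have "(\<Sum>x\<in>I. (norm (cscale (coord f x) g))\<^sup>2) = (\<Sum>x\<in>I. (cmod (coord f x))\<^sup>2) * (norm g)\<^sup>2"
    by (simp add: norm_cscale power_mult_distrib flip: sum_distrib_right)
  also have "\<dots> \<le> (norm f)\<^sup>2 * (norm g)\<^sup>2"
    using l2_finite_sum_le[OF coord_l2[of f] assms] by (simp add: norm_ell2 mult_right_mono)
  finally show ?thesis by (simp add: power_mult_distrib)
qed

lemma coord_ten: "coord (ten f g) (x, y) = coord f x * coord g y"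
  using l2_of_rows(1)[of "\<lambda>x. cscale (coord f x) g", OF sum_norm_cscale_le]
  by (simp add: ten_def coord_Abs_ell2 case_prod_unfold)

lemma row_ten: "row (ten f g) x = cscale (coord f x) g"
  by (auto intro: ell2_eqI simp: coord_ten)

lemma right_op_ten: "T \<in> carrier ell2_ops \<Longrightarrow> right_op T (ten f g) = ten f (T g)"
  by (auto intro!: ell2_eqI simp: coord_right_op row_ten ell2_ops_cscale coord_ten)

lemma reindex_swap_ten: "reindex prod.swap (ten f g) = ten g f"
  by (auto intro!: ell2_eqI simp: coord_ten)

lemma inv_swap: "inv_into UNIV prod.swap = prod.swap"
  by (rule inv_equality) auto

lemma left_op_ten: "T \<in> carrier ell2_ops \<Longrightarrow> left_op T (ten f g) = ten (T f) g"
  by (simp add: left_op_def conj_op_apply inv_swap reindex_swap_ten right_op_ten)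

definition delta :: "'i \<Rightarrow> 'i ell2" where
  "delta i = Abs_ell2 (\<lambda>k. if k = i then 1 else 0)"

lemma coord_delta:
  fixes i :: 'i
  shows "coord (delta i) k = (if k = i then 1 else 0)"
proof -
  have "(\<lambda>k. if k = i then 1 else 0 :: complex) \<in> l2"
  proof (rule l2I(1))
    fix F :: "'i set" assume "finite F"
    moreover have "(cmod (if k = i then 1 else 0))\<^sup>2 = (if k = i then 1 else 0)" for k
      by simp
    ultimately show "(\<Sum>k\<in>F. (cmod (if k = i then 1 else 0))\<^sup>2) \<le> 1"
      by (simp add: sum.delta)
  qed
  then show ?thesis by (simp add: delta_def coord_Abs_ell2)
qed

text \<open>Truncation of \<open>v\<close> to a finite set of coordinates gives a finite sum of elementary tensors, with an error that
  is a tail of the series for \<open>\<parallel>v\<parallel>\<^sup>2\<close>.\<close>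

lemma finite_ten_sums_dense:
  "v \<in> closure {\<Sum>j<k. ten (f j) (g j) | (k :: nat) f g. True}"
  unfolding closure_approachable
proof (intro allI impI)
  fix e :: real assume e: "e > 0"
  have s: "(\<lambda>p. (cmod (coord v p))\<^sup>2) summable_on UNIV"
    using coord_l2[of v] by (simp add: l2_def)
  have "0 < e\<^sup>2 / 2" using e by simp
  then obtain I where I: "finite I" "dist (\<Sum>p\<in>I. (cmod (coord v p))\<^sup>2) (\<Sum>\<^sub>\<infinity>p. (cmod (coord v p))\<^sup>2) \<le> e\<^sup>2 / 2"
    using infsum_finite_approximation[OF s, of "e\<^sup>2 / 2"] by blast
  define w where "w = (\<Sum>p\<in>I. ten (cscale (coord v p) (delta (fst p))) (delta (snd p)))"
  have cw: "coord w p = (if p \<in> I then coord v p else 0)" for p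
  proof -
    obtain x y where p: "p = (x, y)" by (cases p)
    have "coord w p = (\<Sum>q\<in>I. if p = q then coord v q else 0)"
      unfolding w_def p coord_sum
      by (intro sum.cong) (auto simp: coord_ten coord_delta)
    then show ?thesis using I(1) by (simp add: sum.delta)
  qed
  obtain h where h: "bij_betw h {..<card I} I"
    using ex_bij_betw_nat_finite[OF I(1)] by (auto simp: atLeast0LessThan)
  have "w = (\<Sum>j<card I. ten (cscale (coord v (h j)) (delta (fst (h j)))) (delta (snd (h j))))"
    unfolding w_def by (rule sum.reindex_bij_betw[OF h, symmetric])
  then have "w \<in> {\<Sum>j<k. ten (f j) (g j) | (k :: nat) f g. True}"
    by (intro CollectI exI conjI TrueI)
  moreover have "dist w v < e"
  proof -
    have "(\<Sum>p\<in>J. (cmod (coord (v - w) p))\<^sup>2) \<le> e\<^sup>2 / 2" if J: "finite J" for J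
    proof -
      have "(\<Sum>p\<in>J. (cmod (coord (v - w) p))\<^sup>2) = (\<Sum>p\<in>J - I. (cmod (coord v p))\<^sup>2)"
        by (rule sum.mono_neutral_cong_right) (auto simp: cw J)
      also have "\<dots> = (\<Sum>p\<in>J \<union> I. (cmod (coord v p))\<^sup>2) - (\<Sum>p\<in>I. (cmod (coord v p))\<^sup>2)"
        using sum.union_disjoint[of "J - I" I "\<lambda>p. (cmod (coord v p))\<^sup>2"] I(1) J
        by (simp add: Int_Diff Diff_Int_distrib2)
      also have "\<dots> \<le> (\<Sum>\<^sub>\<infinity>p. (cmod (coord v p))\<^sup>2) - (\<Sum>p\<in>I. (cmod (coord v p))\<^sup>2)"
        using I(1) J by (intro diff_right_mono finite_sum_le_infsum s) auto
      also have "\<dots> \<le> e\<^sup>2 / 2"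
        using I(2) unfolding dist_real_def by linarith
      finally show ?thesis .
    qed
    then have "(norm (v - w))\<^sup>2 \<le> e\<^sup>2 / 2"
      unfolding norm_ell2 by (rule l2I(2))
    also have "\<dots> < e\<^sup>2" using e by simp
    finally have "norm (v - w) < e"
      using e by (simp add: power_less_imp_less_base)
    then show ?thesis by (simp add: dist_norm norm_minus_commute)
  qed
  ultimately show "\<exists>y\<in>{\<Sum>j<k. ten (f j) (g j) | (k :: nat) f g. True}. dist y v < e"
    by blast
qed

text \<open>This passes from the vectors on which the spatial norm is computed to the operator norm.\<close>

lemma norm_le_on_tens:
  assumes K: "0 \<le> K"
    and "\<And>k f g. norm (blinfun_apply T (\<Sum>j<(k::nat). ten (f j) (g j))) \<le> K * norm (\<Sum>j<k. ten (f j) (g j))"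
  shows "norm T \<le> K"
proof (rule norm_blinfun_bound[OF K])
  fix v
  have "closed {v. norm (T v) \<le> K * norm v}"
    by (intro closed_Collect_le continuous_intros)
  then have "closure {\<Sum>j<k. ten (f j) (g j) | (k :: nat) f g. True} \<subseteq> {v. norm (T v) \<le> K * norm v}"
    using assms(2) by (intro closure_minimal) auto
  then show "norm (T v) \<le> K * norm v"
    using finite_ten_sums_dense[of v] by blast
qed

lemma eq_on_tens:
  assumes "\<And>f g. blinfun_apply S (ten f g) = blinfun_apply T (ten f g)"
  shows "S = T"
proof -
  have "norm (S - T) \<le> 0"
    by (rule norm_le_on_tens) (simp_all add: blinfun.diff_left blinfun.sum_right assms)
  then show ?thesis by simp
qed

text \<open>The operator \<open>S \<otimes> T\<close>.\<close>

definition prod_op :: "('i ell2 \<Rightarrow>\<^sub>L 'i ell2) \<Rightarrow> ('j ell2 \<Rightarrow>\<^sub>L 'j ell2) \<Rightarrow> ('i \<times> 'j) ell2 \<Rightarrow>\<^sub>L ('i \<times> 'j) ell2" where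
  "prod_op S T = left_op S o\<^sub>L right_op T"

lemma prod_op_ten:
  "S \<in> carrier ell2_ops \<Longrightarrow> T \<in> carrier ell2_ops \<Longrightarrow> prod_op S T (ten f g) = ten (S f) (T g)"
  by (simp add: prod_op_def left_op_ten right_op_ten)

lemma prod_op_commute:
  assumes "S \<in> carrier ell2_ops" "T \<in> carrier ell2_ops"
  shows "prod_op S T = right_op T o\<^sub>L left_op S"
  using assms by (intro eq_on_tens) (simp add: prod_op_ten left_op_ten right_op_ten)

lemma norm_prod_op_le:
  assumes "S \<in> carrier ell2_ops" "T \<in> carrier ell2_ops"
  shows "norm (prod_op S T) \<le> norm S * norm T"
proof -
  note c = star_morphism_contractive[OF cstar_algebra_ell2_ops cstar_algebra_ell2_ops, simplified]
  have "norm (prod_op S T) \<le> norm (left_op S :: ('a \<times> 'b) ell2 \<Rightarrow>\<^sub>L _) * norm (right_op T :: ('a \<times> 'b) ell2 \<Rightarrow>\<^sub>L _)"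
    unfolding prod_op_def by (rule norm_blinfun_compose)
  also have "\<dots> \<le> norm S * norm T"
    using c[OF star_morphism_left_op assms(1)] c[OF star_morphism_right_op assms(2)]
    by (intro mult_mono) auto
  finally show ?thesis .
qed

lemma prod_op_closed:
  assumes "S \<in> carrier ell2_ops" "T \<in> carrier ell2_ops"
  shows "prod_op S T \<in> carrier ell2_ops"
proof -
  interpret E: cstar_algebra "ell2_ops :: (('a \<times> 'b) ell2 \<Rightarrow>\<^sub>L ('a \<times> 'b) ell2) cstar_alg"
    by (rule cstar_algebra_ell2_ops)
  show ?thesis
    using E.m_closed[OF star_morphismD(1)[OF star_morphism_left_op assms(1)]
        star_morphismD(1)[OF star_morphism_right_op assms(2)]]
    by (simp add: prod_op_def)
qed

lemma ten_cscale: "ten (cscale c f) g = cscale c (ten f g)" "ten f (cscale c g) = cscale c (ten f g)"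
  by (auto intro!: ell2_eqI simp: coord_ten algebra_simps)

lemma prod_op_mult:
  assumes "S \<in> carrier ell2_ops" "S' \<in> carrier ell2_ops" "T \<in> carrier ell2_ops" "T' \<in> carrier ell2_ops"
  shows "prod_op (S o\<^sub>L S') (T o\<^sub>L T') = prod_op S T o\<^sub>L prod_op S' T'"
  using assms
  by (intro eq_on_tens) (simp add: prod_op_ten cstar_algebra.m_closed[OF cstar_algebra_ell2_ops, simplified])

lemma prod_op_smult:
  assumes "S \<in> carrier ell2_ops" "T \<in> carrier ell2_ops"
  shows "prod_op (cscale_op a o\<^sub>L S) T = cscale_op a o\<^sub>L prod_op S T"
  using assms
  by (intro eq_on_tens)
    (simp add: prod_op_ten ten_cscale cstar_algebra.smult_closed'[OF cstar_algebra_ell2_ops, simplified])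

lemma prod_op_star:
  assumes c: "S \<in> carrier ell2_ops" "T \<in> carrier ell2_ops"
  shows "prod_op (star ell2_ops S) (star ell2_ops T) = star ell2_ops (prod_op S T)"
proof -
  interpret E: cstar_algebra "ell2_ops :: (('a \<times> 'b) ell2 \<Rightarrow>\<^sub>L ('a \<times> 'b) ell2) cstar_alg"
    by (rule cstar_algebra_ell2_ops)
  have "star ell2_ops (prod_op S T) = star ell2_ops (right_op T o\<^sub>L left_op S)"
    using c by (simp add: prod_op_commute)
  also have "\<dots> = prod_op (star ell2_ops S) (star ell2_ops T)"
    using E.star_mult[OF star_morphismD(1)[OF star_morphism_right_op c(2)]
        star_morphismD(1)[OF star_morphism_left_op c(1)]]
    by (simp add: prod_op_def star_morphismD(5)[OF star_morphism_right_op c(2)]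
        star_morphismD(5)[OF star_morphism_left_op c(1)])
  finally show ?thesis ..
qed

lemma norm_ten: "norm (ten f g) = norm f * norm g"
proof -
  have "(norm (ten f g))\<^sup>2 = (\<Sum>\<^sub>\<infinity>x. inner (cscale (coord f x) g) (cscale (coord f x) g))"
    by (simp add: power2_norm_eq_inner inner_rows row_ten)
  also have "\<dots> = (\<Sum>\<^sub>\<infinity>x. (cmod (coord f x))\<^sup>2 * (norm g)\<^sup>2)"
    by (simp add: power2_norm_eq_inner[symmetric] norm_cscale power_mult_distrib)
  also have "\<dots> = (norm f * norm g)\<^sup>2"
    by (simp add: infsum_cmult_left' norm_ell2 l2_norm_square power_mult_distrib)
  finally show ?thesis by (simp add: power2_eq_iff_nonneg)
qed

lemma norm_delta: "norm (delta i) = 1"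
proof -
  have "(norm (delta i))\<^sup>2 = (\<Sum>\<^sub>\<infinity>k. if k = i then 1 else 0)"
    unfolding norm_ell2 l2_norm_square by (intro infsum_cong) (simp add: coord_delta)
  also have "\<dots> = (\<Sum>\<^sub>\<infinity>k\<in>{i}. 1)"
    by (intro infsum_cong_neutral) auto
  finally show ?thesis
    using norm_ge_zero[of "delta i"] by (auto simp: power2_eq_1_iff)
qed

text \<open>\<open>1 \<otimes> T\<close> maps \<open>f \<otimes> g\<close> to \<open>f \<otimes> T g\<close>, of norm \<open>\<parallel>f\<parallel> \<parallel>T g\<parallel>\<close>; so \<open>T \<mapsto> 1 \<otimes> T\<close> is isometric.\<close>

lemma norm_right_op_ge:
  assumes "T \<in> carrier ell2_ops"
  shows "norm T \<le> norm (right_op T :: ('i \<times> 'j) ell2 \<Rightarrow>\<^sub>L ('i \<times> 'j) ell2)"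
proof (rule norm_blinfun_bound)
  fix g :: "'j ell2"
  show "norm (T g) \<le> norm (right_op T :: ('i \<times> 'j) ell2 \<Rightarrow>\<^sub>L _) * norm g"
    using norm_blinfun[of "right_op T" "ten (delta undefined :: 'i ell2) g"] assms
    by (simp add: right_op_ten norm_ten norm_delta)
qed simp

section \<open>Representations and the spatial norm\<close>

lemma coord_fun:
  "coord (v + w) = (\<lambda>i. coord v i + coord w i)" "coord (cscale c v) = (\<lambda>i. c * coord v i)"
  "coord (r *\<^sub>R v) = (\<lambda>i. of_real r * coord v i)"
  by (auto intro: ext)

lemma Abs_ell2_linear:
  "\<lbrakk>f \<in> l2; g \<in> l2\<rbrakk> \<Longrightarrow> Abs_ell2 (\<lambda>i. f i + g i) = Abs_ell2 f + Abs_ell2 g"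
  "f \<in> l2 \<Longrightarrow> Abs_ell2 (\<lambda>i. c * f i) = cscale c (Abs_ell2 f)"
  by (auto intro!: ell2_eqI simp: coord_Abs_ell2 l2_add l2_scale)

lemma Re_l2_inner: "Re (c * l2_inner (coord v) (coord w)) = inner v (cscale c w)"
  by (simp add: inner_ell2 coord_fun l2_inner_scale_right)

text \<open>Representations are the same as morphisms into the C*-algebra of operators. In this form they are contractive
  by the general result on morphisms, and can be composed with morphisms on either side.\<close>

lemma star_rep_morphism:
  fixes A :: "('u, 'm) cstar_alg_scheme"
  assumes "cstar_algebra A" and \<pi>: "star_rep A \<pi>"
  obtains \<phi> where "star_morphism A ell2_ops \<phi>"
    and "\<And>a v. a \<in> carrier A \<Longrightarrow> coord (blinfun_apply (\<phi> a) v) = \<pi> a (coord v)"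
proof -
  interpret A: cstar_algebra A by fact
  define \<phi> where "\<phi> a = Blinfun (\<lambda>v. Abs_ell2 (\<pi> a (coord v)))" for a
  have bdd: "l2_bounded_operator (\<pi> a)" if "a \<in> carrier A" for a
    using \<pi> that by (simp add: star_rep_def)
  have c: "coord (Abs_ell2 (\<pi> a (coord v))) = \<pi> a (coord v)" if "a \<in> carrier A" for a v
    using bdd[OF that] by (simp add: l2_bounded_operator_def coord_Abs_ell2)
  have app: "coord (\<phi> a v) = \<pi> a (coord v)" if a: "a \<in> carrier A" for a v
  proof -
    obtain K where K: "\<And>f. f \<in> l2 \<Longrightarrow> l2_norm (\<pi> a f) \<le> K * l2_norm f"
      using bdd[OF a] unfolding l2_bounded_operator_def by blast
    have "bounded_linear (\<lambda>v. Abs_ell2 (\<pi> a (coord v)))"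
    proof (rule bounded_linear_intro[where K = K])
      show "norm (Abs_ell2 (\<pi> a (coord v))) \<le> norm v * K" for v
        using K[OF coord_l2[of v]] by (simp add: norm_ell2 c[OF a] mult.commute)
    qed (rule ell2_eqI, simp only: c[OF a] coord_simps,
        use bdd[OF a] in \<open>simp add: coord_fun l2_bounded_operator_def\<close>)+
    then show ?thesis by (simp add: \<phi>_def bounded_linear_Blinfun_apply c[OF a])
  qed
  have adj: "is_adjoint (\<phi> (star A a)) (\<phi> a)" if a: "a \<in> carrier A" for a
  proof -
    have "l2_inner (\<pi> (star A a) f) g = l2_inner f (\<pi> a g)" if "f \<in> l2" "g \<in> l2" for f g
      using \<pi> a that by (simp add: star_rep_def)
    then have "inner (\<phi> (star A a) v) w = inner v (\<phi> a w)" for v w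
      using a by (simp add: inner_ell2 app)
    then show ?thesis
      by (simp add: is_adjoint_def inner_commute)
  qed
  have closed: "\<phi> a \<in> carrier ell2_ops" if a: "a \<in> carrier A" for a
    by (rule ell2_ops_carrierI[OF _ adj[OF a]], rule ell2_eqI)
      (use bdd[OF a] in \<open>simp add: app[OF a] coord_fun l2_bounded_operator_def\<close>)
  have "star_morphism A ell2_ops \<phi>"
    unfolding star_morphism_def
  proof (intro conjI ballI allI)
    fix a b :: 'u and k :: complex assume a: "a \<in> carrier A"
    show "\<phi> (k \<odot>\<^bsub>A\<^esub> a) = k \<odot>\<^bsub>ell2_ops\<^esub> \<phi> a"
      using \<pi> a by (auto intro!: blinfun_eqI ell2_eqI simp: app star_rep_def)
    show "\<phi> (star A a) = star ell2_ops (\<phi> a)"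
      using star_ell2_ops_eqI[OF adj[OF a]] by simp
    assume b: "b \<in> carrier A"
    show "\<phi> (a \<oplus>\<^bsub>A\<^esub> b) = \<phi> a \<oplus>\<^bsub>ell2_ops\<^esub> \<phi> b" "\<phi> (a \<otimes>\<^bsub>A\<^esub> b) = \<phi> a \<otimes>\<^bsub>ell2_ops\<^esub> \<phi> b"
      using \<pi> a b by (auto intro!: blinfun_eqI ell2_eqI simp: app star_rep_def blinfun.add_left)
  qed (rule closed)
  then show ?thesis using that app by blast
qed

lemma morphism_star_rep:
  fixes A :: "('u, 'm) cstar_alg_scheme"
  assumes \<phi>: "star_morphism A ell2_ops \<phi>"
  shows "star_rep A (\<lambda>a f. coord (blinfun_apply (\<phi> a) (Abs_ell2 f)))"
proof -
  note hom = star_morphismD[OF \<phi>]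
  have "l2_bounded_operator (\<lambda>f. coord (\<phi> a (Abs_ell2 f)))" if a: "a \<in> carrier A" for a
  proof -
    have "l2_norm (coord (\<phi> a (Abs_ell2 f))) \<le> norm (\<phi> a) * l2_norm f" if "f \<in> l2" for f
      using norm_blinfun[of "\<phi> a" "Abs_ell2 f"] that by (simp add: norm_ell2 coord_Abs_ell2)
    then show ?thesis
      unfolding l2_bounded_operator_def
      by (auto simp: Abs_ell2_linear blinfun.add_right coord_fun ell2_ops_cscale[OF hom(1)[OF a]])
  qed
  moreover have "l2_inner (coord (\<phi> (star A a) (Abs_ell2 f))) g = l2_inner f (coord (\<phi> a (Abs_ell2 g)))"
    if a: "a \<in> carrier A" and f: "f \<in> l2" and g: "g \<in> l2" for a f g
  proof (rule l2_inner_eqI)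
    fix c
    let ?v = "Abs_ell2 f" and ?w = "Abs_ell2 g"
    have adj: "is_adjoint (\<phi> (star A a)) (\<phi> a)"
      using is_adjoint_star[OF hom(1)[OF a]] by (simp add: hom(5)[OF a])
    have "inner (\<phi> (star A a) ?v) (cscale c ?w) = inner ?v (cscale c (\<phi> a ?w))"
      using adj by (metis is_adjoint_def inner_commute ell2_ops_cscale[OF hom(1)[OF a]])
    then show "Re (c * l2_inner (coord (\<phi> (star A a) ?v)) g) = Re (c * l2_inner f (coord (\<phi> a ?w)))"
      using Re_l2_inner[of c "\<phi> (star A a) ?v" ?w] Re_l2_inner[of c ?v "\<phi> a ?w"] f g
      by (simp add: coord_Abs_ell2)
  qed
  ultimately show ?thesis
    unfolding star_rep_def
    by (simp add: hom coord_fun blinfun.add_left coord_inverse)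
qed

lemma spatial_value:
  fixes k m :: nat
  assumes "\<And>i v. i < m \<Longrightarrow> coord (blinfun_apply (\<phi> (a i)) v) = \<pi> (a i) (coord v)"
    and "\<And>i v. i < m \<Longrightarrow> coord (blinfun_apply (\<psi> (b i)) v) = \<rho> (b i) (coord v)"
    and c: "\<And>i. i < m \<Longrightarrow> \<phi> (a i) \<in> carrier ell2_ops" "\<And>i. i < m \<Longrightarrow> \<psi> (b i) \<in> carrier ell2_ops"
    and f: "\<And>j. j < k \<Longrightarrow> f j \<in> l2 \<and> g j \<in> l2"
  shows "l2_norm (\<lambda>(x, y). \<Sum>i<m. \<Sum>j<k. \<pi> (a i) (f j) x * \<rho> (b i) (g j) y) =
    norm ((\<Sum>i<m. prod_op (\<phi> (a i)) (\<psi> (b i))) (\<Sum>j<k. ten (Abs_ell2 (f j)) (Abs_ell2 (g j))))"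
proof -
  let ?W = "(\<Sum>i<m. prod_op (\<phi> (a i)) (\<psi> (b i))) (\<Sum>j<k. ten (Abs_ell2 (f j)) (Abs_ell2 (g j)))"
  have "coord ?W (x, y) = (\<Sum>i<m. \<Sum>j<k. \<pi> (a i) (f j) x * \<rho> (b i) (g j) y)" for x y
    using assms by (simp add: blinfun.sum_left blinfun.sum_right coord_sum prod_op_ten coord_ten coord_Abs_ell2)
      (rule sum.swap)
  then have "coord ?W = (\<lambda>(x, y). \<Sum>i<m. \<Sum>j<k. \<pi> (a i) (f j) x * \<rho> (b i) (g j) y)"
    by (auto intro!: ext)
  then show ?thesis by (simp add: norm_ell2)
qed

lemma spatial_value_l2_norm:
  fixes k :: nat
  assumes f: "\<And>j. j < k \<Longrightarrow> f j \<in> l2 \<and> g j \<in> l2"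
  shows "l2_norm (\<lambda>(x, y). \<Sum>j<k. f j x * g j y) = norm (\<Sum>j<k. ten (Abs_ell2 (f j)) (Abs_ell2 (g j)))"
proof -
  let ?W = "\<Sum>j<k. ten (Abs_ell2 (f j)) (Abs_ell2 (g j))"
  have "coord ?W (x, y) = (\<Sum>j<k. f j x * g j y)" for x y
    using assms by (simp add: coord_sum coord_ten coord_Abs_ell2)
  then have "coord ?W = (\<lambda>(x, y). \<Sum>j<k. f j x * g j y)"
    by (auto intro!: ext)
  then show ?thesis by (simp add: norm_ell2)
qed

context
  fixes U V :: "'u cstar_alg" and a b :: "nat \<Rightarrow> 'u" and m :: nat
  assumes U: "cstar_algebra U" and V: "cstar_algebra V"
    and a: "\<And>i. i < m \<Longrightarrow> a i \<in> carrier U" and b: "\<And>i. i < m \<Longrightarrow> b i \<in> carrier V"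
begin

definition spatial_values :: "real set" where
  "spatial_values = {l2_norm (\<lambda>(x, y). \<Sum>i<m. \<Sum>j<k. \<pi> (a i) (f j) x * \<rho> (b i) (g j) y) | \<pi> \<rho> k f g.
        star_rep U \<pi> \<and> star_rep V \<rho> \<and>
        (\<forall>j<k. f j \<in> l2 \<and> g j \<in> l2) \<and>
        l2_norm (\<lambda>(x, y). \<Sum>j<(k::nat). f j x * g j y) \<le> 1}"

lemma spatial_norm_Sup: "spatial_norm U V m a b = Sup spatial_values"
  by (simp add: spatial_norm_def spatial_values_def)

lemma spatial_values_le:
  assumes s: "s \<in> spatial_values"
    and K: "\<And>\<phi> \<psi>. \<lbrakk>star_morphism U (ell2_ops :: ('u ell2 \<Rightarrow>\<^sub>L 'u ell2) cstar_alg) \<phi>;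
        star_morphism V (ell2_ops :: ('u ell2 \<Rightarrow>\<^sub>L 'u ell2) cstar_alg) \<psi>\<rbrakk>
      \<Longrightarrow> norm (\<Sum>i<m. prod_op (\<phi> (a i)) (\<psi> (b i))) \<le> K"
  shows "s \<le> K"
proof -
  obtain \<pi> \<rho> k f g where s_eq: "s = l2_norm (\<lambda>(x, y). \<Sum>i<m. \<Sum>j<k. \<pi> (a i) (f j) x * \<rho> (b i) (g j) y)"
    and \<pi>: "star_rep U \<pi>" and \<rho>: "star_rep V \<rho>" and fg: "\<And>j. j < k \<Longrightarrow> f j \<in> l2 \<and> g j \<in> l2"
    and unit: "l2_norm (\<lambda>(x, y). \<Sum>j<(k::nat). f j x * g j y) \<le> 1"
    using s unfolding spatial_values_def by blast
  obtain \<phi> where \<phi>: "star_morphism U (ell2_ops :: ('u ell2 \<Rightarrow>\<^sub>L 'u ell2) cstar_alg) \<phi>"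
    "\<And>a v. a \<in> carrier U \<Longrightarrow> coord (blinfun_apply (\<phi> a) v) = \<pi> a (coord v)"
    using star_rep_morphism[OF U \<pi>] by blast
  obtain \<psi> where \<psi>: "star_morphism V (ell2_ops :: ('u ell2 \<Rightarrow>\<^sub>L 'u ell2) cstar_alg) \<psi>"
    "\<And>a v. a \<in> carrier V \<Longrightarrow> coord (blinfun_apply (\<psi> a) v) = \<rho> a (coord v)"
    using star_rep_morphism[OF V \<rho>] by blast
  let ?W = "\<Sum>i<m. prod_op (\<phi> (a i)) (\<psi> (b i))"
  let ?F = "\<Sum>j<k. ten (Abs_ell2 (f j)) (Abs_ell2 (g j))"
  have F: "norm ?F \<le> 1"
    using unit spatial_value_l2_norm[OF fg] by simp
  have "s = norm (?W ?F)"
    unfolding s_eq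
    using spatial_value[of m \<phi> a \<pi> \<psi> b \<rho> k f g] \<phi>(2)[OF a] \<psi>(2)[OF b] fg
      star_morphismD(1)[OF \<phi>(1) a] star_morphismD(1)[OF \<psi>(1) b] by simp
  also have "\<dots> \<le> norm ?W * norm ?F" by (rule norm_blinfun)
  also have "\<dots> \<le> norm ?W * 1" using F by (intro mult_left_mono) auto
  also have "\<dots> \<le> K" using K[OF \<phi>(1) \<psi>(1)] by simp
  finally show ?thesis .
qed

text \<open>The supremum that defines the spatial norm is finite because representations are contractive.\<close>

lemma spatial_values_bounded: "bdd_above spatial_values"
proof (rule bdd_aboveI)
  fix s assume "s \<in> spatial_values"
  then show "s \<le> (\<Sum>i<m. cnorm U (a i) * cnorm V (b i))"
  proof (rule spatial_values_le)
    fix \<phi> \<psi> :: "'u \<Rightarrow> 'u ell2 \<Rightarrow>\<^sub>L 'u ell2"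
    assume \<phi>: "star_morphism U ell2_ops \<phi>" and \<psi>: "star_morphism V ell2_ops \<psi>"
    note le = star_morphism_contractive[OF U cstar_algebra_ell2_ops \<phi>, simplified]
      star_morphism_contractive[OF V cstar_algebra_ell2_ops \<psi>, simplified]
    have "norm (prod_op (\<phi> (a i)) (\<psi> (b i))) \<le> cnorm U (a i) * cnorm V (b i)" if "i < m" for i
      using le(1)[OF a[OF that]] le(2)[OF b[OF that]]
      by (intro order_trans[OF norm_prod_op_le[OF star_morphismD(1)[OF \<phi> a[OF that]]
            star_morphismD(1)[OF \<psi> b[OF that]]]] mult_mono cstar_algebra.norm_nonneg[OF U a[OF that]]) auto
    then show "norm (\<Sum>i<m. prod_op (\<phi> (a i)) (\<psi> (b i))) \<le> (\<Sum>i<m. cnorm U (a i) * cnorm V (b i))"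
      by (intro sum_norm_le) auto
  qed
qed

lemma spatial_valuesI:
  fixes \<phi> \<psi> :: "'u \<Rightarrow> 'u ell2 \<Rightarrow>\<^sub>L 'u ell2"
  assumes \<phi>: "star_morphism U ell2_ops \<phi>" and \<psi>: "star_morphism V ell2_ops \<psi>"
    and F: "norm (\<Sum>j<(k::nat). ten (f j) (g j)) \<le> 1"
  shows "norm ((\<Sum>i<m. prod_op (\<phi> (a i)) (\<psi> (b i))) (\<Sum>j<k. ten (f j) (g j))) \<in> spatial_values"
proof -
  let ?\<pi> = "\<lambda>a f. coord (blinfun_apply (\<phi> a) (Abs_ell2 f))" and ?\<rho> = "\<lambda>a f. coord (blinfun_apply (\<psi> a) (Abs_ell2 f))"
  have val: "norm ((\<Sum>i<m. prod_op (\<phi> (a i)) (\<psi> (b i))) (\<Sum>j<k. ten (f j) (g j)))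
      = l2_norm (\<lambda>(x, y). \<Sum>i<m. \<Sum>j<k. ?\<pi> (a i) (coord (f j)) x * ?\<rho> (b i) (coord (g j)) y)"
    using spatial_value[of m \<phi> a ?\<pi> \<psi> b ?\<rho> k "\<lambda>j. coord (f j)" "\<lambda>j. coord (g j)"]
      star_morphismD(1)[OF \<phi> a] star_morphismD(1)[OF \<psi> b] by (simp add: coord_inverse)
  moreover have "l2_norm (\<lambda>(x, y). \<Sum>j<k. coord (f j) x * coord (g j) y) \<le> 1"
    using F spatial_value_l2_norm[of k "\<lambda>j. coord (f j)" "\<lambda>j. coord (g j)"] by (simp add: coord_inverse)
  ultimately show ?thesis
    unfolding spatial_values_def mem_Collect_eq
    using morphism_star_rep[OF \<phi>] morphism_star_rep[OF \<psi>]
    by (intro exI[of _ ?\<pi>] exI[of _ ?\<rho>] exI[of _ k] exI[of _ "\<lambda>j. coord (f j)"]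
        exI[of _ "\<lambda>j. coord (g j)"]) auto
qed

lemma zero_spatial_values: "0 \<in> spatial_values"
proof -
  interpret E: cstar_algebra "ell2_ops :: ('u ell2 \<Rightarrow>\<^sub>L 'u ell2) cstar_alg" by (rule cstar_algebra_ell2_ops)
  have z: "star_morphism A (ell2_ops :: ('u ell2 \<Rightarrow>\<^sub>L 'u ell2) cstar_alg) (\<lambda>x. 0)" for A :: "'u cstar_alg"
    using E.star_zero E.smult_zero ring.ring_simprules(2)[OF E.is_ring] by (simp add: star_morphism_def)
  show ?thesis
    using spatial_valuesI[OF z z, where k = 0] by simp
qed

text \<open>The supremum runs over vectors of norm at most 1 in the algebraic tensor product; by scaling and density it bounds
  the operator norm.\<close>

lemma spatial_norm_ge:
  fixes \<phi> \<psi> :: "'u \<Rightarrow> 'u ell2 \<Rightarrow>\<^sub>L 'u ell2"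
  assumes \<phi>: "star_morphism U ell2_ops \<phi>" and \<psi>: "star_morphism V ell2_ops \<psi>"
  shows "norm (\<Sum>i<m. prod_op (\<phi> (a i)) (\<psi> (b i))) \<le> spatial_norm U V m a b"
proof (rule norm_le_on_tens)
  have upper: "s \<le> spatial_norm U V m a b" if "s \<in> spatial_values" for s
    unfolding spatial_norm_Sup by (rule cSup_upper[OF that spatial_values_bounded])
  show "0 \<le> spatial_norm U V m a b" by (rule upper[OF zero_spatial_values])
  fix k :: nat and f g :: "nat \<Rightarrow> 'u ell2"
  let ?W = "\<Sum>i<m. prod_op (\<phi> (a i)) (\<psi> (b i))" and ?F = "\<Sum>j<k. ten (f j) (g j)"
  show "norm (?W ?F) \<le> spatial_norm U V m a b * norm ?F"
  proof (cases "norm ?F = 0")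
    case False
    then have F: "norm ?F > 0" by simp
    define r where "r = inverse (norm ?F)"
    have scale: "(\<Sum>j<k. ten (cscale (of_real r) (f j)) (g j)) = r *\<^sub>R ?F"
      unfolding scaleR_sum_right by (intro sum.cong ell2_eqI refl) (auto simp: ten_cscale)
    have "norm (?W (\<Sum>j<k. ten (cscale (of_real r) (f j)) (g j))) \<in> spatial_values"
      by (rule spatial_valuesI[OF \<phi> \<psi>]) (unfold scale, use F in \<open>simp add: r_def\<close>)
    from upper[OF this] have "r * norm (?W ?F) \<le> spatial_norm U V m a b"
      unfolding scale using F by (simp add: blinfun.scaleR_right r_def)
    then show ?thesis using F by (simp add: r_def field_simps)
  qed simp
qed

lemma spatial_norm_le:
  assumes "\<And>\<phi> \<psi>. \<lbrakk>star_morphism U (ell2_ops :: ('u ell2 \<Rightarrow>\<^sub>L 'u ell2) cstar_alg) \<phi>;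
        star_morphism V (ell2_ops :: ('u ell2 \<Rightarrow>\<^sub>L 'u ell2) cstar_alg) \<psi>\<rbrakk>
      \<Longrightarrow> norm (\<Sum>i<m. prod_op (\<phi> (a i)) (\<psi> (b i))) \<le> K"
  shows "spatial_norm U V m a b \<le> K"
  unfolding spatial_norm_Sup
  by (rule cSup_least) (use zero_spatial_values assms in \<open>auto intro: spatial_values_le\<close>)

end


section \<open>Minimal tensor products\<close>

lemma finsum_lessThan_Suc:
  assumes "cstar_algebra A" "f \<in> {..<Suc m} \<rightarrow> carrier A"
  shows "(\<Oplus>\<^bsub>A\<^esub>i\<in>{..<Suc m}. f i) = (\<Oplus>\<^bsub>A\<^esub>i\<in>{..<m}. f i) \<oplus>\<^bsub>A\<^esub> f m"
proof -
  interpret A: cstar_algebra A by fact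
  have "f m \<in> carrier A" "f \<in> {..<m} \<rightarrow> carrier A" using assms(2) by auto
  then show ?thesis
    by (simp add: lessThan_Suc A.finsum_insert A.a_comm A.finsum_closed)
qed

lemma pair_span_sum:
  assumes A: "cstar_algebra A" and D: "cstar_algebra D" and G: "G \<subseteq> carrier A \<times> carrier D"
    and "pair_span A D G z d"
  obtains m :: nat and s e where "\<And>i. i < m \<Longrightarrow> (s i, e i) \<in> G"
    and "z = (\<Oplus>\<^bsub>A\<^esub>i\<in>{..<m}. s i)" "d = (\<Oplus>\<^bsub>D\<^esub>i\<in>{..<m}. e i)"
proof -
  interpret A: cstar_algebra A by fact
  interpret D: cstar_algebra D by fact
  have "\<exists>(m::nat) s e. (\<forall>i<m. (s i, e i) \<in> G) \<and> z = (\<Oplus>\<^bsub>A\<^esub>i\<in>{..<m}. s i) \<and> d = (\<Oplus>\<^bsub>D\<^esub>i\<in>{..<m}. e i)"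
    using assms(4)
  proof induction
    case zero
    then show ?case by (intro exI[of _ 0]) (simp add: A.finsum_empty D.finsum_empty)
  next
    case (add z d x y)
    then obtain m :: nat and s e where m: "\<And>i. i < m \<Longrightarrow> (s i, e i) \<in> G"
      "z = (\<Oplus>\<^bsub>A\<^esub>i\<in>{..<m}. s i)" "d = (\<Oplus>\<^bsub>D\<^esub>i\<in>{..<m}. e i)" by blast
    have c: "s i \<in> carrier A" "e i \<in> carrier D" if "i < m" for i
      using m(1)[OF that] G by auto
    let ?s = "s(m := x)" and ?e = "e(m := y)"
    have *: "(?s i, ?e i) \<in> G" if "i < Suc m" for i
      using m(1) add.hyps(2) that by (cases "i = m") auto
    have zd: "z = (\<Oplus>\<^bsub>A\<^esub>i\<in>{..<m}. ?s i)" "d = (\<Oplus>\<^bsub>D\<^esub>i\<in>{..<m}. ?e i)"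
      unfolding m(2,3) by (auto intro!: A.finsum_cong' D.finsum_cong' simp: c)
    have se: "?s \<in> {..<Suc m} \<rightarrow> carrier A" "?e \<in> {..<Suc m} \<rightarrow> carrier D"
      using subsetD[OF G *] by (simp_all only: Pi_iff lessThan_iff mem_Times_iff fst_conv snd_conv) auto
    have "z \<oplus>\<^bsub>A\<^esub> x = (\<Oplus>\<^bsub>A\<^esub>i\<in>{..<Suc m}. ?s i)" "d \<oplus>\<^bsub>D\<^esub> y = (\<Oplus>\<^bsub>D\<^esub>i\<in>{..<Suc m}. ?e i)"
      unfolding finsum_lessThan_Suc[OF A se(1)] finsum_lessThan_Suc[OF D se(2)]
      by (simp_all only: fun_upd_same flip: zd)
    then show ?case using * by blast
  qed
  then show ?thesis using that by blast
qed

lemma finsum_ell2_ops: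
  assumes "f \<in> {..<m::nat} \<rightarrow> carrier ell2_ops"
  shows "(\<Oplus>\<^bsub>ell2_ops\<^esub>i\<in>{..<m}. f i) = (\<Sum>i<m. f i)"
  using assms
proof (induction m)
  case 0
  then show ?case
    using cstar_algebra.finsum_empty[OF cstar_algebra_ell2_ops] by simp
next
  case (Suc m)
  then have "f \<in> {..<m} \<rightarrow> carrier ell2_ops" by auto
  then show ?case
    using Suc finsum_lessThan_Suc[OF cstar_algebra_ell2_ops Suc.prems] by simp
qed

locale min_tensor =
  fixes U V T :: "'u cstar_alg" and t :: "'u \<Rightarrow> 'u \<Rightarrow> 'u"
  assumes U: "cstar_algebra U" and V: "cstar_algebra V" and tensor: "is_minimal_tensor_product U V T t"
begin

lemma T: "cstar_algebra T"
  using tensor by (simp add: is_minimal_tensor_product_def)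

sublocale U: cstar_algebra U by (rule U)
sublocale V: cstar_algebra V by (rule V)
sublocale T: cstar_algebra T by (rule T)

lemma t_closed [simp, intro]: "\<lbrakk>x \<in> carrier U; y \<in> carrier V\<rbrakk> \<Longrightarrow> t x y \<in> carrier T"
  and t_add_left: "\<lbrakk>x \<in> carrier U; x' \<in> carrier U; y \<in> carrier V\<rbrakk> \<Longrightarrow> t (x \<oplus>\<^bsub>U\<^esub> x') y = t x y \<oplus>\<^bsub>T\<^esub> t x' y"
  and t_add_right: "\<lbrakk>x \<in> carrier U; y \<in> carrier V; y' \<in> carrier V\<rbrakk> \<Longrightarrow> t x (y \<oplus>\<^bsub>V\<^esub> y') = t x y \<oplus>\<^bsub>T\<^esub> t x y'"
  and t_smult_left: "\<lbrakk>x \<in> carrier U; y \<in> carrier V\<rbrakk> \<Longrightarrow> t (c \<odot>\<^bsub>U\<^esub> x) y = c \<odot>\<^bsub>T\<^esub> t x y"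
  and t_smult_right: "\<lbrakk>x \<in> carrier U; y \<in> carrier V\<rbrakk> \<Longrightarrow> t x (c \<odot>\<^bsub>V\<^esub> y) = c \<odot>\<^bsub>T\<^esub> t x y"
  and t_mult: "\<lbrakk>x \<in> carrier U; x' \<in> carrier U; y \<in> carrier V; y' \<in> carrier V\<rbrakk>
      \<Longrightarrow> t x y \<otimes>\<^bsub>T\<^esub> t x' y' = t (x \<otimes>\<^bsub>U\<^esub> x') (y \<otimes>\<^bsub>V\<^esub> y')"
  and t_one: "t \<one>\<^bsub>U\<^esub> \<one>\<^bsub>V\<^esub> = \<one>\<^bsub>T\<^esub>"
  and t_star: "\<lbrakk>x \<in> carrier U; y \<in> carrier V\<rbrakk> \<Longrightarrow> star T (t x y) = t (star U x) (star V y)"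
  and norm_tensor_sum: "\<lbrakk>a \<in> {..<m} \<rightarrow> carrier U; b \<in> {..<m} \<rightarrow> carrier V\<rbrakk>
      \<Longrightarrow> cnorm T (\<Oplus>\<^bsub>T\<^esub>i\<in>{..<m}. t (a i) (b i)) = spatial_norm U V m a b"
  using tensor unfolding is_minimal_tensor_product_def by simp_all

lemma t_zero_left: "y \<in> carrier V \<Longrightarrow> t \<zero>\<^bsub>U\<^esub> y = \<zero>\<^bsub>T\<^esub>"
  using t_smult_left[of "\<zero>\<^bsub>U\<^esub>" y 0] by simp

lemma t_zero_right: "x \<in> carrier U \<Longrightarrow> t x \<zero>\<^bsub>V\<^esub> = \<zero>\<^bsub>T\<^esub>"
  using t_smult_right[of x "\<zero>\<^bsub>V\<^esub>" 0] by simp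

definition tensors :: "'u set" where
  "tensors = {t x y | x y. x \<in> carrier U \<and> y \<in> carrier V}"

lemma dense_tensors: "dense_span T tensors"
  unfolding dense_span_def
proof (intro conjI ballI allI impI)
  show "tensors \<subseteq> carrier T" by (auto simp: tensors_def)
  fix z and \<epsilon> :: real assume z: "z \<in> carrier T" and \<epsilon>: "0 < \<epsilon>"
  interpret M: Metric_space "carrier T" "cdist T" by (rule T.Metric_space_cdist)
  have "ctopology T closure_of {\<Oplus>\<^bsub>T\<^esub>i \<in> {..<m}. t (a i) (b i) | (m::nat) a b.
      a \<in> {..<m} \<rightarrow> carrier U \<and> b \<in> {..<m} \<rightarrow> carrier V} = carrier T"
    using tensor by (simp add: is_minimal_tensor_product_def)
  with z \<epsilon> obtain m :: nat and a b where ab: "a \<in> {..<m} \<rightarrow> carrier U" "b \<in> {..<m} \<rightarrow> carrier V"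
    and in_ball: "(\<Oplus>\<^bsub>T\<^esub>i \<in> {..<m}. t (a i) (b i)) \<in> M.mball z \<epsilon>"
    unfolding M.metric_closure_of by blast
  have "(\<Oplus>\<^bsub>T\<^esub>i \<in> {..<m}. t (a i) (b i)) \<in> additive_span T tensors"
    using ab
  proof (induction m)
    case 0
    then show ?case using T.finsum_empty by (simp add: additive_span.zero)
  next
    case (Suc m)
    then have "a m \<in> carrier U" "b m \<in> carrier V" "a \<in> {..<m} \<rightarrow> carrier U" "b \<in> {..<m} \<rightarrow> carrier V"
      by auto
    then show ?case
      using Suc by (subst finsum_lessThan_Suc[OF T]) (auto intro!: additive_span.add simp: tensors_def)
  qed
  with in_ball show "\<exists>s\<in>additive_span T tensors. cnorm T (z \<ominus>\<^bsub>T\<^esub> s) < \<epsilon>"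
    by (auto simp: M.in_mball cdist_def)
qed

text \<open>On sums of elementary tensors \<open>\<phi> \<otimes> \<psi>\<close> is bounded by the spatial norm, by definition of the latter; so it
  extends to the completion.\<close>

lemma product_rep_exists:
  fixes \<phi> \<psi> :: "'u \<Rightarrow> 'u ell2 \<Rightarrow>\<^sub>L 'u ell2"
  assumes \<phi>: "star_morphism U ell2_ops \<phi>" and \<psi>: "star_morphism V ell2_ops \<psi>"
  shows "\<exists>\<sigma>. star_morphism T ell2_ops \<sigma> \<and>
    (\<forall>x \<in> carrier U. \<forall>y \<in> carrier V. \<sigma> (t x y) = prod_op (\<phi> x) (\<psi> y))"
proof -
  let ?E = "ell2_ops :: (('u \<times> 'u) ell2 \<Rightarrow>\<^sub>L ('u \<times> 'u) ell2) cstar_alg"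
  define G where "G = {(t x y, prod_op (\<phi> x) (\<psi> y)) | x y. x \<in> carrier U \<and> y \<in> carrier V}"
  note h\<phi> = star_morphismD[OF \<phi>] and h\<psi> = star_morphismD[OF \<psi>]
  have GI: "(t x y, prod_op (\<phi> x) (\<psi> y)) \<in> G" if "x \<in> carrier U" "y \<in> carrier V" for x y
    using that unfolding G_def by blast
  have Gc: "G \<subseteq> carrier T \<times> carrier ?E"
    by (auto simp: G_def prod_op_closed h\<phi>(1) h\<psi>(1))
  obtain \<sigma> where \<sigma>: "star_morphism T ?E \<sigma>" "\<And>s e. (s, e) \<in> G \<Longrightarrow> \<sigma> s = e"
  proof (rule star_morphism_extension[OF T cstar_algebra_ell2_ops Gc, where K = 1])
    fix F assume "star_morphism T ?E F" "\<And>s e. (s, e) \<in> G \<Longrightarrow> F s = e"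
    then show thesis by (rule that)
  next
    fix s e s' e' assume "(s, e) \<in> G" "(s', e') \<in> G"
    then obtain x y x' y' where s: "s = t x y" "e = prod_op (\<phi> x) (\<psi> y)" "s' = t x' y'" "e' = prod_op (\<phi> x') (\<psi> y')"
      and c: "x \<in> carrier U" "y \<in> carrier V" "x' \<in> carrier U" "y' \<in> carrier V"
      unfolding G_def by blast
    show "(s \<otimes>\<^bsub>T\<^esub> s', e \<otimes>\<^bsub>?E\<^esub> e') \<in> G"
      using GI[of "x \<otimes>\<^bsub>U\<^esub> x'" "y \<otimes>\<^bsub>V\<^esub> y'"] c
      by (simp add: s t_mult h\<phi> h\<psi> U.m_closed V.m_closed prod_op_mult)
  next
    fix c s e assume "(s, e) \<in> G"
    then obtain x y where s: "s = t x y" "e = prod_op (\<phi> x) (\<psi> y)" and xy: "x \<in> carrier U" "y \<in> carrier V"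
      unfolding G_def by blast
    show "(c \<odot>\<^bsub>T\<^esub> s, c \<odot>\<^bsub>?E\<^esub> e) \<in> G"
      using GI[of "c \<odot>\<^bsub>U\<^esub> x" y] xy by (simp add: s t_smult_left h\<phi> h\<psi> prod_op_smult)
    show "(star T s, star ?E e) \<in> G"
      using GI[of "star U x" "star V y"] xy by (simp add: s t_star h\<phi> h\<psi> prod_op_star)
  next
    have "fst ` G = tensors" by (force simp: G_def tensors_def)
    then show "dense_span T (fst ` G)" using dense_tensors by simp
  next
    fix z d assume "pair_span T ?E G z d"
    then obtain m :: nat and s e where m: "\<And>i. i < m \<Longrightarrow> (s i, e i) \<in> G"
      and z: "z = (\<Oplus>\<^bsub>T\<^esub>i\<in>{..<m}. s i)" and d: "d = (\<Oplus>\<^bsub>?E\<^esub>i\<in>{..<m}. e i)"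
      using pair_span_sum[OF T cstar_algebra_ell2_ops Gc] by blast
    have "\<forall>i. \<exists>x y. i < m \<longrightarrow> x \<in> carrier U \<and> y \<in> carrier V \<and> s i = t x y \<and> e i = prod_op (\<phi> x) (\<psi> y)"
      using m unfolding G_def by blast
    then obtain a b where ab: "\<And>i. i < m \<Longrightarrow> a i \<in> carrier U" "\<And>i. i < m \<Longrightarrow> b i \<in> carrier V"
      "\<And>i. i < m \<Longrightarrow> s i = t (a i) (b i)" "\<And>i. i < m \<Longrightarrow> e i = prod_op (\<phi> (a i)) (\<psi> (b i))"
      by metis
    have "z = (\<Oplus>\<^bsub>T\<^esub>i\<in>{..<m}. t (a i) (b i))"
      unfolding z using ab by (intro T.finsum_cong') auto
    then have "cnorm T z = spatial_norm U V m a b"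
      using norm_tensor_sum[of a m b] ab by auto
    moreover have "d = (\<Sum>i<m. prod_op (\<phi> (a i)) (\<psi> (b i)))"
      unfolding d using ab by (subst finsum_ell2_ops) (auto simp: prod_op_closed h\<phi>(1) h\<psi>(1))
    ultimately show "cnorm ?E d \<le> 1 * cnorm T z"
      using spatial_norm_ge[OF U V ab(1,2) \<phi> \<psi>] by simp
  qed
  then show ?thesis using GI by blast
qed

definition product_rep ::
  "('u \<Rightarrow> 'u ell2 \<Rightarrow>\<^sub>L 'u ell2) \<Rightarrow> ('u \<Rightarrow> 'u ell2 \<Rightarrow>\<^sub>L 'u ell2) \<Rightarrow> 'u \<Rightarrow> ('u \<times> 'u) ell2 \<Rightarrow>\<^sub>L ('u \<times> 'u) ell2"
  where "product_rep \<phi> \<psi> = (SOME \<sigma>. star_morphism T ell2_ops \<sigma> \<and>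
    (\<forall>x \<in> carrier U. \<forall>y \<in> carrier V. \<sigma> (t x y) = prod_op (\<phi> x) (\<psi> y)))"

lemma
  assumes \<phi>: "star_morphism U ell2_ops \<phi>" and \<psi>: "star_morphism V ell2_ops \<psi>"
  shows product_rep: "star_morphism T ell2_ops (product_rep \<phi> \<psi>)"
    and product_rep_tensor: "\<lbrakk>x \<in> carrier U; y \<in> carrier V\<rbrakk> \<Longrightarrow> product_rep \<phi> \<psi> (t x y) = prod_op (\<phi> x) (\<psi> y)"
  using someI_ex[OF product_rep_exists[OF assms]] unfolding product_rep_def by blast+

text \<open>By density, the description of the spatial norm by pairs of representations extends from sums of
  elementary tensors to all elements.\<close>

lemma norm_le_product_reps:
  assumes z: "z \<in> carrier T"
    and K: "\<And>\<phi> \<psi>. \<lbrakk>star_morphism U (ell2_ops :: ('u ell2 \<Rightarrow>\<^sub>L 'u ell2) cstar_alg) \<phi>;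
        star_morphism V (ell2_ops :: ('u ell2 \<Rightarrow>\<^sub>L 'u ell2) cstar_alg) \<psi>\<rbrakk>
      \<Longrightarrow> norm (product_rep \<phi> \<psi> z) \<le> K"
  shows "cnorm T z \<le> K"
proof (rule field_le_epsilon)
  fix \<epsilon> :: real assume \<epsilon>: "0 < \<epsilon>"
  obtain s where s: "s \<in> additive_span T tensors" "cnorm T (z \<ominus>\<^bsub>T\<^esub> s) < \<epsilon> / 2"
    using dense_tensors z half_gt_zero[OF \<epsilon>] unfolding dense_span_def by blast
  have sc: "s \<in> carrier T"
    by (rule additive_span_closed[OF T _ s(1)]) (auto simp: tensors_def)
  have "\<exists>(m::nat) a b. a \<in> {..<m} \<rightarrow> carrier U \<and> b \<in> {..<m} \<rightarrow> carrier V \<and> s = (\<Oplus>\<^bsub>T\<^esub>i\<in>{..<m}. t (a i) (b i))"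
    using s(1)
  proof induction
    case zero
    then show ?case using T.finsum_empty by (intro exI[of _ 0]) simp
  next
    case (add s e)
    then obtain m :: nat and a b x y where m: "a \<in> {..<m} \<rightarrow> carrier U" "b \<in> {..<m} \<rightarrow> carrier V"
      "s = (\<Oplus>\<^bsub>T\<^esub>i\<in>{..<m}. t (a i) (b i))" and xy: "x \<in> carrier U" "y \<in> carrier V" "e = t x y"
      unfolding tensors_def by blast
    let ?a = "a(m := x)" and ?b = "b(m := y)"
    have c: "?a \<in> {..<Suc m} \<rightarrow> carrier U" "?b \<in> {..<Suc m} \<rightarrow> carrier V"
      using m xy by (auto simp: Pi_def less_Suc_eq)
    have "t (a i) (b i) \<in> carrier T" if "i < m" for i
      using m(1,2) that by auto
    then have "s = (\<Oplus>\<^bsub>T\<^esub>i\<in>{..<m}. t (?a i) (?b i))"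
      unfolding m(3) by (intro T.finsum_cong') auto
    then have "s \<oplus>\<^bsub>T\<^esub> e = (\<Oplus>\<^bsub>T\<^esub>i\<in>{..<Suc m}. t (?a i) (?b i))"
      using c xy by (subst finsum_lessThan_Suc[OF T]) (auto simp: Pi_def)
    then show ?case using c by blast
  qed
  then obtain m :: nat and a b where ab: "a \<in> {..<m} \<rightarrow> carrier U" "b \<in> {..<m} \<rightarrow> carrier V"
    "s = (\<Oplus>\<^bsub>T\<^esub>i\<in>{..<m}. t (a i) (b i))" by blast
  have "cnorm T s \<le> K + \<epsilon> / 2"
    unfolding ab(3) norm_tensor_sum[OF ab(1,2)]
  proof (rule spatial_norm_le[OF U V])
    fix \<phi> \<psi> :: "'u \<Rightarrow> 'u ell2 \<Rightarrow>\<^sub>L 'u ell2"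
    assume \<phi>: "star_morphism U ell2_ops \<phi>" and \<psi>: "star_morphism V ell2_ops \<psi>"
    let ?E = "ell2_ops :: (('u \<times> 'u) ell2 \<Rightarrow>\<^sub>L ('u \<times> 'u) ell2) cstar_alg"
    interpret E: cstar_algebra ?E by (rule cstar_algebra_ell2_ops)
    note pr = product_rep[OF \<phi> \<psi>]
    have abc: "a i \<in> carrier U" "b i \<in> carrier V" if "i < m" for i
      using ab(1,2) that by auto
    then have tc: "t (a i) (b i) \<in> carrier T" if "i < m" for i
      using that by auto
    have "(\<Sum>i<m. prod_op (\<phi> (a i)) (\<psi> (b i))) = (\<Oplus>\<^bsub>?E\<^esub>i\<in>{..<m}. prod_op (\<phi> (a i)) (\<psi> (b i)))"
      using abc star_morphismD(1)[OF \<phi>] star_morphismD(1)[OF \<psi>]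
      by (intro finsum_ell2_ops[symmetric]) (auto simp: prod_op_closed)
    also have "\<dots> = (\<Oplus>\<^bsub>?E\<^esub>i\<in>{..<m}. product_rep \<phi> \<psi> (t (a i) (b i)))"
      using abc star_morphismD(1)[OF \<phi>] star_morphismD(1)[OF \<psi>]
      by (intro E.finsum_cong') (auto simp: product_rep_tensor[OF \<phi> \<psi>] prod_op_closed)
    also have "\<dots> = product_rep \<phi> \<psi> s"
      unfolding ab(3) using ab(1,2)
      by (intro star_morphism_finsum[OF T cstar_algebra_ell2_ops pr, symmetric]) (auto simp: tc)
    finally have sum: "(\<Sum>i<m. prod_op (\<phi> (a i)) (\<psi> (b i))) = product_rep \<phi> \<psi> s" .
    have "norm (product_rep \<phi> \<psi> (s \<ominus>\<^bsub>T\<^esub> z)) \<le> cnorm T (s \<ominus>\<^bsub>T\<^esub> z)"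
      using star_morphism_contractive[OF T cstar_algebra_ell2_ops pr, of "s \<ominus>\<^bsub>T\<^esub> z"] sc z by simp
    moreover have "product_rep \<phi> \<psi> s = product_rep \<phi> \<psi> z + product_rep \<phi> \<psi> (s \<ominus>\<^bsub>T\<^esub> z)"
    proof -
      have "s = z \<oplus>\<^bsub>T\<^esub> (s \<ominus>\<^bsub>T\<^esub> z)"
        using sc z by (simp add: T.minus_eq T.a_lcomm T.r_neg)
      then show ?thesis
        using star_morphismD(2)[OF pr, of z "s \<ominus>\<^bsub>T\<^esub> z"] sc z by simp
    qed
    ultimately have "norm (product_rep \<phi> \<psi> s) \<le> K + \<epsilon> / 2"
      using K[OF \<phi> \<psi>] s(2) norm_triangle_ineq[of "product_rep \<phi> \<psi> z" "product_rep \<phi> \<psi> (s \<ominus>\<^bsub>T\<^esub> z)"]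
        T.norm_diff_commute[OF sc z] by simp
    then show "norm (\<Sum>i<m. prod_op (\<phi> (a i)) (\<psi> (b i))) \<le> K + \<epsilon> / 2"
      by (simp only: sum)
  qed (use ab in auto)
  then show "cnorm T z \<le> K + \<epsilon>"
    using T.norm_le_diff[OF z sc] s(2) by linarith
qed

lemma norm_tensor_le:
  assumes "x \<in> carrier U" "y \<in> carrier V"
  shows "cnorm T (t x y) \<le> cnorm U x * cnorm V y"
proof (rule norm_le_product_reps)
  fix \<phi> \<psi> :: "'u \<Rightarrow> 'u ell2 \<Rightarrow>\<^sub>L 'u ell2"
  assume \<phi>: "star_morphism U ell2_ops \<phi>" and \<psi>: "star_morphism V ell2_ops \<psi>"
  have "norm (prod_op (\<phi> x) (\<psi> y)) \<le> norm (\<phi> x) * norm (\<psi> y)"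
    by (rule norm_prod_op_le) (use assms star_morphismD(1)[OF \<phi>] star_morphismD(1)[OF \<psi>] in auto)
  also have "\<dots> \<le> cnorm U x * cnorm V y"
    using star_morphism_contractive[OF U cstar_algebra_ell2_ops \<phi> assms(1)]
      star_morphism_contractive[OF V cstar_algebra_ell2_ops \<psi> assms(2)] U.norm_nonneg[OF assms(1)]
    by (intro mult_mono) auto
  finally show "norm (product_rep \<phi> \<psi> (t x y)) \<le> cnorm U x * cnorm V y"
    by (simp add: product_rep_tensor[OF \<phi> \<psi> assms])
qed (use assms in auto)

lemma lim_tensor_left:
  assumes "U.lim f x" "y \<in> carrier V"
  shows "T.lim (\<lambda>n. t (f n) y) (t x y)"
proof (rule T.limI)
  note c = U.lim_closed[OF assms(1)]
  show "cnorm T (t (f n) y \<ominus>\<^bsub>T\<^esub> t x y) \<le> cnorm U (f n \<ominus>\<^bsub>U\<^esub> x) * cnorm V y" for n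
  proof -
    have "t (f n) y \<ominus>\<^bsub>T\<^esub> t x y = t (f n \<ominus>\<^bsub>U\<^esub> x) y"
      using c assms(2)
      by (simp add: U.minus_eq T.minus_eq U.minus_eq_smult T.minus_eq_smult t_add_left t_smult_left)
    then show ?thesis using norm_tensor_le[of "f n \<ominus>\<^bsub>U\<^esub> x" y] c assms(2) by simp
  qed
  show "(\<lambda>n. cnorm U (f n \<ominus>\<^bsub>U\<^esub> x) * cnorm V y) \<longlonglongrightarrow> 0"
    using assms(1) unfolding U.lim_def by (intro tendsto_mult_left_zero) auto
qed (use U.lim_closed[OF assms(1)] assms(2) in auto)

lemma lim_tensor_right:
  assumes "x \<in> carrier U" "V.lim g y"
  shows "T.lim (\<lambda>n. t x (g n)) (t x y)"
proof (rule T.limI)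
  note c = V.lim_closed[OF assms(2)]
  show "cnorm T (t x (g n) \<ominus>\<^bsub>T\<^esub> t x y) \<le> cnorm U x * cnorm V (g n \<ominus>\<^bsub>V\<^esub> y)" for n
  proof -
    have "t x (g n) \<ominus>\<^bsub>T\<^esub> t x y = t x (g n \<ominus>\<^bsub>V\<^esub> y)"
      using c assms(1)
      by (simp add: V.minus_eq T.minus_eq V.minus_eq_smult T.minus_eq_smult t_add_right t_smult_right)
    then show ?thesis using norm_tensor_le[of x "g n \<ominus>\<^bsub>V\<^esub> y"] c assms(1) by simp
  qed
  show "(\<lambda>n. cnorm U x * cnorm V (g n \<ominus>\<^bsub>V\<^esub> y)) \<longlonglongrightarrow> 0"
    using assms(2) unfolding V.lim_def by (intro tendsto_mult_right_zero) auto
qed (use V.lim_closed[OF assms(2)] assms(1) in auto)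

end

section \<open>Morphisms between tensor products\<close>

definition approx_by :: "('a, 'm) cstar_alg_scheme \<Rightarrow> 'a set \<Rightarrow> 'a \<Rightarrow> bool" where
  "approx_by A S z \<longleftrightarrow> z \<in> carrier A \<and> (\<forall>\<epsilon>>0. \<exists>s \<in> additive_span A S. cnorm A (z \<ominus>\<^bsub>A\<^esub> s) < \<epsilon>)"

lemma additive_span_add:
  assumes "cstar_algebra A" "S \<subseteq> carrier A" "s' \<in> additive_span A S" "s \<in> additive_span A S"
  shows "s \<oplus>\<^bsub>A\<^esub> s' \<in> additive_span A S"
proof -
  interpret A: cstar_algebra A by fact
  note c = additive_span_closed[OF assms(1,2)]
  show ?thesis
    using assms(3)
  proof induction
    case zero
    then show ?case using assms(4) c by simp
  next
    case (add z x)
    have "(s \<oplus>\<^bsub>A\<^esub> z) \<oplus>\<^bsub>A\<^esub> x \<in> additive_span A S"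
      by (rule additive_span.add[OF add.IH add.hyps(2)])
    then show ?case
      using add.hyps assms(2) c[OF assms(4)] c[OF add.hyps(1)] by (simp add: A.a_assoc subset_iff)
  qed
qed

lemma approx_by_zero:
  assumes "cstar_algebra A"
  shows "approx_by A S \<zero>\<^bsub>A\<^esub>"
proof -
  interpret A: cstar_algebra A by fact
  show ?thesis
    unfolding approx_by_def
    by (auto intro!: bexI[OF _ additive_span.zero] simp: A.minus_eq A.r_neg)
qed

lemma approx_by_mem:
  assumes "cstar_algebra A" "S \<subseteq> carrier A" "s \<in> S"
  shows "approx_by A S s"
proof -
  interpret A: cstar_algebra A by fact
  have "s \<in> carrier A" "\<zero>\<^bsub>A\<^esub> \<oplus>\<^bsub>A\<^esub> s \<in> additive_span A S"
    using assms by (auto intro: additive_span.intros)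
  then show ?thesis
    unfolding approx_by_def by (auto intro!: bexI[of _ s] simp: A.minus_eq A.r_neg)
qed

lemma approx_by_add:
  assumes "cstar_algebra A" and S: "S \<subseteq> carrier A" and z: "approx_by A S z" and z': "approx_by A S z'"
  shows "approx_by A S (z \<oplus>\<^bsub>A\<^esub> z')"
proof -
  interpret A: cstar_algebra A by fact
  have c: "z \<in> carrier A" "z' \<in> carrier A" using z z' by (auto simp: approx_by_def)
  have "\<exists>s \<in> additive_span A S. cnorm A ((z \<oplus>\<^bsub>A\<^esub> z') \<ominus>\<^bsub>A\<^esub> s) < \<epsilon>" if "\<epsilon> > 0" for \<epsilon>
  proof -
    obtain s s' where s: "s \<in> additive_span A S" "cnorm A (z \<ominus>\<^bsub>A\<^esub> s) < \<epsilon> / 2"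
      "s' \<in> additive_span A S" "cnorm A (z' \<ominus>\<^bsub>A\<^esub> s') < \<epsilon> / 2"
      using z z' half_gt_zero[OF \<open>\<epsilon> > 0\<close>] unfolding approx_by_def by blast
    have sc: "s \<in> carrier A" "s' \<in> carrier A"
      using s additive_span_closed[OF assms(1) S] by auto
    have "cnorm A ((z \<oplus>\<^bsub>A\<^esub> z') \<ominus>\<^bsub>A\<^esub> (s \<oplus>\<^bsub>A\<^esub> s')) \<le> cnorm A (z \<ominus>\<^bsub>A\<^esub> s) + cnorm A (z' \<ominus>\<^bsub>A\<^esub> s')"
      using c sc by (simp add: A.diff_add_distrib A.norm_add)
    then show ?thesis
      using s additive_span_add[OF assms(1) S s(3,1)] by (intro bexI[of _ "s \<oplus>\<^bsub>A\<^esub> s'"]) auto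
  qed
  then show ?thesis using c by (simp add: approx_by_def)
qed

lemma approx_by_lim:
  assumes "cstar_algebra A" and S: "S \<subseteq> carrier A" and lim: "cstar_algebra.lim A f z"
    and f: "\<And>n. approx_by A S (f n)"
  shows "approx_by A S z"
proof -
  interpret A: cstar_algebra A by fact
  note c = A.lim_closed[OF lim]
  have "\<exists>s \<in> additive_span A S. cnorm A (z \<ominus>\<^bsub>A\<^esub> s) < \<epsilon>" if \<epsilon>: "\<epsilon> > 0" for \<epsilon>
  proof -
    have "\<forall>\<^sub>F n in sequentially. cnorm A (f n \<ominus>\<^bsub>A\<^esub> z) < \<epsilon> / 2"
      using lim \<epsilon> unfolding A.lim_def by (intro order_tendstoD(2)) auto
    then obtain n where n: "cnorm A (f n \<ominus>\<^bsub>A\<^esub> z) < \<epsilon> / 2"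
      unfolding eventually_sequentially by blast
    obtain s where s: "s \<in> additive_span A S" "cnorm A (f n \<ominus>\<^bsub>A\<^esub> s) < \<epsilon> / 2"
      using f[of n] half_gt_zero[OF \<epsilon>] unfolding approx_by_def by blast
    have sc: "s \<in> carrier A" using s additive_span_closed[OF assms(1) S] by auto
    have "cnorm A (z \<ominus>\<^bsub>A\<^esub> s) < \<epsilon>"
      using A.norm_diff_triangle[OF c(2) c(1) sc, of n] A.norm_diff_commute[OF c(2) c(1), of n] n s(2)
      by linarith
    then show ?thesis using s by blast
  qed
  then show ?thesis using c by (simp add: approx_by_def)
qed

lemma dense_span_carrier:
  assumes "cstar_algebra A"
  shows "dense_span A (carrier A)"
  using approx_by_mem[OF assms order_refl] by (simp add: dense_span_def approx_by_def)

context min_tensor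
begin

text \<open>By the cross norm estimate, \<open>t\<close> is separately continuous; so one factor at a time can be approximated.\<close>

lemma dense_tensors_of_dense:
  assumes SU: "dense_span U SU" and SV: "dense_span V SV"
  shows "dense_span T {t x y | x y. x \<in> SU \<and> y \<in> SV}"
proof -
  let ?S = "{t x y | x y. x \<in> SU \<and> y \<in> SV}"
  have c: "SU \<subseteq> carrier U" "SV \<subseteq> carrier V"
    using SU SV by (auto simp: dense_span_def)
  have S: "?S \<subseteq> carrier T" using c by auto
  have right: "approx_by T ?S (t x y)" if x: "x \<in> SU" and y: "y \<in> carrier V" for x y
    using V SV y
  proof (induction rule: dense_span_induct)
    case zero
    show ?case using x c approx_by_zero[OF T] by (auto simp: t_zero_right)
  next
    case (add y s)
    then have "approx_by T ?S (t x s)"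
      using x by (intro approx_by_mem[OF T S]) blast
    then have "approx_by T ?S (t x y \<oplus>\<^bsub>T\<^esub> t x s)"
      by (rule approx_by_add[OF T S add.IH])
    then show ?case using add x c by (simp add: t_add_right subset_iff)
  next
    case (lim f y)
    have xc: "x \<in> carrier U" using x c by blast
    show ?case by (rule approx_by_lim[OF T S lim_tensor_right[OF xc lim(1)] lim(2)])
  qed
  have "approx_by T ?S (t x y)" if x: "x \<in> carrier U" and y: "y \<in> carrier V" for x y
    using U SU x
  proof (induction rule: dense_span_induct)
    case zero
    show ?case using y approx_by_zero[OF T] by (auto simp: t_zero_left)
  next
    case (add x s)
    have "approx_by T ?S (t x y \<oplus>\<^bsub>T\<^esub> t s y)"
      by (rule approx_by_add[OF T S add.IH right[OF add.hyps(2) y]])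
    then show ?case using add y c by (simp add: t_add_left subset_iff)
  next
    case (lim f x)
    show ?case by (rule approx_by_lim[OF T S lim_tensor_left[OF lim(1) y] lim(2)])
  qed
  then have tens: "approx_by T ?S s" if "s \<in> tensors" for s
    using that by (auto simp: tensors_def)
  have "approx_by T ?S z" if z: "z \<in> carrier T" for z
    using T dense_tensors z
  proof (induction rule: dense_span_induct)
    case zero
    show ?case by (rule approx_by_zero[OF T])
  next
    case (add z s)
    show ?case by (rule approx_by_add[OF T S add.IH tens[OF add.hyps(2)]])
  next
    case (lim f z)
    show ?case by (rule approx_by_lim[OF T S lim])
  qed
  then show ?thesis using S by (simp add: dense_span_def approx_by_def)
qed

lemma morphism_eqI_tensors:
  assumes "cstar_algebra D" "star_morphism T D \<phi>" "star_morphism T D \<psi>"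
    and "\<And>x y. \<lbrakk>x \<in> carrier U; y \<in> carrier V\<rbrakk> \<Longrightarrow> \<phi> (t x y) = \<psi> (t x y)"
    and "z \<in> carrier T"
  shows "\<phi> z = \<psi> z"
  by (rule star_morphism_eqI[OF T assms(1) dense_tensors assms(2,3) _ assms(5)])
    (auto simp: tensors_def assms(4))

end

text \<open>A relation \<open>G\<close> between two algebras along which representations can be pulled back. The graph of a morphism is
  one. Another one is the graph of the slice map \<open>b \<otimes> y \<mapsto> \<omega>(b) y\<close> on elementary tensors: its composition with
  any representation is bounded, although the map itself is known to be bounded only if the norm of its target is
  detected by representations on the given Hilbert space.\<close>

definition star_relation :: "'u cstar_alg \<Rightarrow> 'u cstar_alg \<Rightarrow> ('u \<times> 'u) set \<Rightarrow> bool" where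
  "star_relation A D G \<longleftrightarrow> G \<subseteq> carrier A \<times> carrier D \<and>
     (\<forall>s e s' e'. (s, e) \<in> G \<longrightarrow> (s', e') \<in> G \<longrightarrow> (s \<otimes>\<^bsub>A\<^esub> s', e \<otimes>\<^bsub>D\<^esub> e') \<in> G) \<and>
     (\<forall>c s e. (s, e) \<in> G \<longrightarrow> (c \<odot>\<^bsub>A\<^esub> s, c \<odot>\<^bsub>D\<^esub> e) \<in> G) \<and>
     (\<forall>s e. (s, e) \<in> G \<longrightarrow> (star A s, star D e) \<in> G) \<and>
     dense_span A (fst ` G) \<and>
     (\<forall>\<rho> :: 'u \<Rightarrow> 'u ell2 \<Rightarrow>\<^sub>L 'u ell2. star_morphism D ell2_ops \<rho> \<longrightarrow>
        (\<exists>\<sigma>. star_morphism A ell2_ops \<sigma> \<and> (\<forall>s e. (s, e) \<in> G \<longrightarrow> \<sigma> s = \<rho> e)))"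

lemma star_relationI:
  assumes "G \<subseteq> carrier A \<times> carrier D"
    and "\<And>s e s' e'. \<lbrakk>(s, e) \<in> G; (s', e') \<in> G\<rbrakk> \<Longrightarrow> (s \<otimes>\<^bsub>A\<^esub> s', e \<otimes>\<^bsub>D\<^esub> e') \<in> G"
    and "\<And>c s e. (s, e) \<in> G \<Longrightarrow> (c \<odot>\<^bsub>A\<^esub> s, c \<odot>\<^bsub>D\<^esub> e) \<in> G"
    and "\<And>s e. (s, e) \<in> G \<Longrightarrow> (star A s, star D e) \<in> G"
    and "dense_span A (fst ` G)"
    and "\<And>\<rho> :: 'u \<Rightarrow> 'u ell2 \<Rightarrow>\<^sub>L 'u ell2. star_morphism D ell2_ops \<rho> \<Longrightarrow>
      \<exists>\<sigma>. star_morphism A ell2_ops \<sigma> \<and> (\<forall>s e. (s, e) \<in> G \<longrightarrow> \<sigma> s = \<rho> e)"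
  shows "star_relation A D (G :: ('u \<times> 'u) set)"
  unfolding star_relation_def using assms by simp

lemma star_relationD:
  fixes \<rho> :: "'u \<Rightarrow> 'u ell2 \<Rightarrow>\<^sub>L 'u ell2"
  assumes "star_relation A D G"
  shows "(s, e) \<in> G \<Longrightarrow> s \<in> carrier A" "(s, e) \<in> G \<Longrightarrow> e \<in> carrier D"
    and "\<lbrakk>(s, e) \<in> G; (s', e') \<in> G\<rbrakk> \<Longrightarrow> (s \<otimes>\<^bsub>A\<^esub> s', e \<otimes>\<^bsub>D\<^esub> e') \<in> G"
    and "(s, e) \<in> G \<Longrightarrow> (c \<odot>\<^bsub>A\<^esub> s, c \<odot>\<^bsub>D\<^esub> e) \<in> G"
    and "(s, e) \<in> G \<Longrightarrow> (star A s, star D e) \<in> G"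
    and "dense_span A (fst ` G)"
    and "star_morphism D ell2_ops \<rho> \<Longrightarrow> \<exists>\<sigma>. star_morphism A ell2_ops \<sigma> \<and> (\<forall>s e. (s, e) \<in> G \<longrightarrow> \<sigma> s = \<rho> e)"
  using assms unfolding star_relation_def by (simp_all add: subset_iff)

lemma star_relation_graph:
  assumes A: "cstar_algebra A" and \<phi>: "star_morphism A D \<phi>"
  shows "star_relation A D {(x, \<phi> x) | x. x \<in> carrier A}"
proof -
  interpret A: cstar_algebra A by fact
  note hom = star_morphismD[OF \<phi>]
  have "fst ` {(x, \<phi> x) | x. x \<in> carrier A} = carrier A" by force
  then show ?thesis
    using dense_span_carrier[OF A] star_morphism_comp[OF \<phi>]
    by (intro star_relationI) (auto simp: hom A.m_closed)
qed

lemma star_morphism_id: "star_morphism A A (\<lambda>x. x)"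
  by (simp add: star_morphism_def)

text \<open>The norm of the target is the supremum over products of representations of \<open>U'\<close> and \<open>V'\<close>. Pulled back to \<open>U\<close>
  and \<open>V\<close>, these give products of representations of the source, which are contractive.\<close>

theorem tensor_relation_morphism:
  assumes "min_tensor U V T t" and "min_tensor U' V' T' t'"
    and GU: "star_relation U U' GU" and GV: "star_relation V V' GV"
  obtains F where "star_morphism T T' F" "F \<in> extensional (carrier T)"
    and "\<And>x x' y y'. \<lbrakk>(x, x') \<in> GU; (y, y') \<in> GV\<rbrakk> \<Longrightarrow> F (t x y) = t' x' y'"
proof -
  interpret S: min_tensor U V T t by fact
  interpret S': min_tensor U' V' T' t' by fact
  note dU = star_relationD[OF GU] and dV = star_relationD[OF GV]
  define G where "G = {(t x y, t' x' y') | x x' y y'. (x, x') \<in> GU \<and> (y, y') \<in> GV}"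
  have GI: "(t x y, t' x' y') \<in> G" if "(x, x') \<in> GU" "(y, y') \<in> GV" for x x' y y'
    using that unfolding G_def by blast
  have Gc: "G \<subseteq> carrier T \<times> carrier T'"
    unfolding G_def using dU(1,2) dV(1,2) by auto
  show ?thesis
  proof (rule star_morphism_extension[OF S.T S'.T Gc, where K = 1])
    fix F assume F: "star_morphism T T' F" "F \<in> extensional (carrier T)" "\<And>s e. (s, e) \<in> G \<Longrightarrow> F s = e"
    show thesis by (rule that[OF F(1,2) F(3)[OF GI]])
  next
    fix s e s2 e2 assume "(s, e) \<in> G" "(s2, e2) \<in> G"
    then obtain x x' y y' x2 x2' y2 y2' where s: "s = t x y" "e = t' x' y'" "s2 = t x2 y2" "e2 = t' x2' y2'"
      and g: "(x, x') \<in> GU" "(y, y') \<in> GV" "(x2, x2') \<in> GU" "(y2, y2') \<in> GV"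
      unfolding G_def by blast
    show "(s \<otimes>\<^bsub>T\<^esub> s2, e \<otimes>\<^bsub>T'\<^esub> e2) \<in> G"
      using GI[OF dU(3)[OF g(1,3)] dV(3)[OF g(2,4)]] g dU(1,2) dV(1,2)
      by (simp add: s S.t_mult S'.t_mult)
  next
    fix c s e assume "(s, e) \<in> G"
    then obtain x x' y y' where s: "s = t x y" "e = t' x' y'" and g: "(x, x') \<in> GU" "(y, y') \<in> GV"
      unfolding G_def by blast
    note cl = dU(1,2)[OF g(1)] dV(1,2)[OF g(2)]
    show "(c \<odot>\<^bsub>T\<^esub> s, c \<odot>\<^bsub>T'\<^esub> e) \<in> G"
      using GI[OF dU(4)[OF g(1)] g(2), of c] cl by (simp add: s S.t_smult_left S'.t_smult_left)
    show "(star T s, star T' e) \<in> G"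
      using GI[OF dU(5)[OF g(1)] dV(5)[OF g(2)]] cl by (simp add: s S.t_star S'.t_star)
  next
    have "fst ` G = {t x y | x y. x \<in> fst ` GU \<and> y \<in> fst ` GV}"
      unfolding G_def by force
    then show "dense_span T (fst ` G)"
      using S.dense_tensors_of_dense[OF dU(6) dV(6)] by simp
  next
    fix z d assume zd: "pair_span T T' G z d"
    show "cnorm T' d \<le> 1 * cnorm T z"
    proof (rule S'.norm_le_product_reps)
      show "d \<in> carrier T'" by (rule pair_span_closed[OF S.T S'.T Gc zd])
      fix \<phi>' \<psi>' :: "'a \<Rightarrow> 'a ell2 \<Rightarrow>\<^sub>L 'a ell2"
      assume \<phi>': "star_morphism U' ell2_ops \<phi>'" and \<psi>': "star_morphism V' ell2_ops \<psi>'"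
      obtain \<phi> where \<phi>: "star_morphism U ell2_ops \<phi>" "\<And>s e. (s, e) \<in> GU \<Longrightarrow> \<phi> s = \<phi>' e"
        using dU(7)[OF \<phi>'] by blast
      obtain \<psi> where \<psi>: "star_morphism V ell2_ops \<psi>" "\<And>s e. (s, e) \<in> GV \<Longrightarrow> \<psi> s = \<psi>' e"
        using dV(7)[OF \<psi>'] by blast
      have "S'.product_rep \<phi>' \<psi>' e = S.product_rep \<phi> \<psi> s" if se: "(s, e) \<in> G" for s e
      proof -
        obtain x x' y y' where s: "s = t x y" "e = t' x' y'" and g: "(x, x') \<in> GU" "(y, y') \<in> GV"
          using se unfolding G_def by blast
        show ?thesis
          using dU(1,2)[OF g(1)] dV(1,2)[OF g(2)]
          by (simp add: s S.product_rep_tensor[OF \<phi>(1) \<psi>(1)] S'.product_rep_tensor[OF \<phi>' \<psi>']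
              \<phi>(2)[OF g(1)] \<psi>(2)[OF g(2)])
      qed
      from pair_span_norm_le[OF S.T S'.T cstar_algebra_ell2_ops S.product_rep[OF \<phi>(1) \<psi>(1)]
          S'.product_rep[OF \<phi>' \<psi>'] Gc this zd]
      show "norm (S'.product_rep \<phi>' \<psi>' d) \<le> 1 * cnorm T z" by simp
    qed
  qed
qed

lemma tensor_morphism:
  fixes U V T U' V' T' :: "'u cstar_alg"
  assumes "min_tensor U V T t" and "min_tensor U' V' T' t'"
    and "star_morphism U U' \<phi>" and "star_morphism V V' \<psi>"
  obtains F where "star_morphism T T' F" "F \<in> extensional (carrier T)"
    and "\<And>x y. \<lbrakk>x \<in> carrier U; y \<in> carrier V\<rbrakk> \<Longrightarrow> F (t x y) = t' (\<phi> x) (\<psi> y)"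
proof -
  interpret S: min_tensor U V T t by fact
  note rel = star_relation_graph[OF S.U assms(3)] star_relation_graph[OF S.V assms(4)]
  obtain F where F: "star_morphism T T' F" "F \<in> extensional (carrier T)"
    "\<And>x x' y y'. \<lbrakk>(x, x') \<in> {(x, \<phi> x) | x. x \<in> carrier U}; (y, y') \<in> {(y, \<psi> y) | y. y \<in> carrier V}\<rbrakk>
      \<Longrightarrow> F (t x y) = t' x' y'"
    using tensor_relation_morphism[OF assms(1,2) rel] by blast
  show ?thesis
    by (rule that[OF F(1,2)], rule F(3)) auto
qed

text \<open>The unitary flip of the two Hilbert spaces turns \<open>\<phi> \<otimes> \<psi>\<close> into \<open>\<psi> \<otimes> \<phi>\<close>.\<close>

lemma flip_morphism:
  assumes "min_tensor U V T t" and "min_tensor V U T' t'"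
  obtains F where "star_morphism T T' F" "F \<in> extensional (carrier T)"
    and "\<And>x y. \<lbrakk>x \<in> carrier U; y \<in> carrier V\<rbrakk> \<Longrightarrow> F (t x y) = t' y x"
proof -
  interpret S: min_tensor U V T t by fact
  interpret S': min_tensor V U T' t' by fact
  define G where "G = {(t x y, t' y x) | x y. x \<in> carrier U \<and> y \<in> carrier V}"
  have GI: "(t x y, t' y x) \<in> G" if "x \<in> carrier U" "y \<in> carrier V" for x y
    using that unfolding G_def by blast
  have Gc: "G \<subseteq> carrier T \<times> carrier T'"
    unfolding G_def by auto
  show ?thesis
  proof (rule star_morphism_extension[OF S.T S'.T Gc, where K = 1])
    fix F assume F: "star_morphism T T' F" "F \<in> extensional (carrier T)" "\<And>s e. (s, e) \<in> G \<Longrightarrow> F s = e"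
    show thesis by (rule that[OF F(1,2) F(3)[OF GI]])
  next
    fix s e s2 e2 assume "(s, e) \<in> G" "(s2, e2) \<in> G"
    then obtain x y x2 y2 where s: "s = t x y" "e = t' y x" "s2 = t x2 y2" "e2 = t' y2 x2"
      and g: "x \<in> carrier U" "y \<in> carrier V" "x2 \<in> carrier U" "y2 \<in> carrier V"
      unfolding G_def by blast
    show "(s \<otimes>\<^bsub>T\<^esub> s2, e \<otimes>\<^bsub>T'\<^esub> e2) \<in> G"
      using GI[OF S.U.m_closed S.V.m_closed, of x x2 y y2] g by (simp add: s S.t_mult S'.t_mult)
  next
    fix c s e assume "(s, e) \<in> G"
    then obtain x y where s: "s = t x y" "e = t' y x" and g: "x \<in> carrier U" "y \<in> carrier V"
      unfolding G_def by blast
    show "(c \<odot>\<^bsub>T\<^esub> s, c \<odot>\<^bsub>T'\<^esub> e) \<in> G"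
      using GI[of "c \<odot>\<^bsub>U\<^esub> x" y] g by (simp add: s S.t_smult_left S'.t_smult_right)
    show "(star T s, star T' e) \<in> G"
      using GI[of "star U x" "star V y"] g by (simp add: s S.t_star S'.t_star)
  next
    have "fst ` G = S.tensors"
      unfolding G_def S.tensors_def by force
    then show "dense_span T (fst ` G)"
      using S.dense_tensors by simp
  next
    fix z d assume zd: "pair_span T T' G z d"
    show "cnorm T' d \<le> 1 * cnorm T z"
    proof (rule S'.norm_le_product_reps)
      show "d \<in> carrier T'" by (rule pair_span_closed[OF S.T S'.T Gc zd])
      fix \<phi> \<psi> :: "'a \<Rightarrow> 'a ell2 \<Rightarrow>\<^sub>L 'a ell2"
      assume \<psi>: "star_morphism V ell2_ops \<psi>" and \<phi>: "star_morphism U ell2_ops \<phi>"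
      let ?c = "conj_op prod.swap :: _ \<Rightarrow> ('a \<times> 'a) ell2 \<Rightarrow>\<^sub>L ('a \<times> 'a) ell2"
      have cm: "star_morphism ell2_ops ell2_ops ?c" by (rule star_morphism_conj_op) simp
      have swap: "prod_op (\<psi> y) (\<phi> x) = ?c (prod_op (\<phi> x) (\<psi> y))" if "x \<in> carrier U" "y \<in> carrier V" for x y
        using that star_morphismD(1)[OF \<phi>] star_morphismD(1)[OF \<psi>]
        by (intro eq_on_tens) (simp add: conj_op_apply inv_swap reindex_swap_ten prod_op_ten)
      have "S'.product_rep \<psi> \<phi> e = ?c (S.product_rep \<phi> \<psi> s)" if "(s, e) \<in> G" for s e
        using that unfolding G_def
        by (auto simp: S.product_rep_tensor[OF \<phi> \<psi>] S'.product_rep_tensor[OF \<psi> \<phi>] swap)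
      from pair_span_norm_le[OF S.T S'.T cstar_algebra_ell2_ops star_morphism_comp[OF S.product_rep[OF \<phi> \<psi>] cm]
          S'.product_rep[OF \<psi> \<phi>] Gc this zd]
      show "norm (S'.product_rep \<psi> \<phi> d) \<le> 1 * cnorm T z" by simp
    qed
  qed
qed


section \<open>Slice maps\<close>

definition character :: "'u cstar_alg \<Rightarrow> ('u \<Rightarrow> complex) \<Rightarrow> bool" where
  "character B \<omega> \<longleftrightarrow>
     (\<forall>x \<in> carrier B. \<forall>y \<in> carrier B. \<omega> (x \<oplus>\<^bsub>B\<^esub> y) = \<omega> x + \<omega> y \<and> \<omega> (x \<otimes>\<^bsub>B\<^esub> y) = \<omega> x * \<omega> y) \<and>
     (\<forall>c. \<forall>x \<in> carrier B. \<omega> (c \<odot>\<^bsub>B\<^esub> x) = c * \<omega> x) \<and>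
     (\<forall>x \<in> carrier B. \<omega> (star B x) = cnj (\<omega> x)) \<and> \<omega> \<one>\<^bsub>B\<^esub> = 1"

lemma cscale_op_closed: "cscale_op c \<in> carrier ell2_ops"
  and star_cscale_op: "star ell2_ops (cscale_op c) = cscale_op (cnj c)"
proof -
  have adj: "is_adjoint (cscale_op (cnj c)) (cscale_op c)"
    by (simp add: is_adjoint_def inner_cscale)
  show "cscale_op c \<in> carrier ell2_ops"
    by (rule ell2_ops_carrierI[OF _ adj]) (simp add: cscale_simps mult.commute)
  show "star ell2_ops (cscale_op c) = cscale_op (cnj c)"
    by (rule star_ell2_ops_eqI[OF adj])
qed

lemma character_rep:
  assumes "character B \<omega>"
  shows "star_morphism B ell2_ops (\<lambda>b. cscale_op (\<omega> b))"
  using assms unfolding star_morphism_def character_def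
  by (auto simp: cscale_op_closed star_cscale_op cscale_simps blinfun.add_left intro!: blinfun_eqI)

lemma prod_op_cscale_left:
  assumes "T \<in> carrier ell2_ops"
  shows "prod_op (cscale_op c) T = right_op (cscale_op c o\<^sub>L T)"
  using cstar_algebra.smult_closed'[OF cstar_algebra_ell2_ops assms, of c] assms
  by (intro eq_on_tens) (simp add: prod_op_ten cscale_op_closed right_op_ten ten_cscale)

text \<open>A representation of \<open>A\<close> that factors through an isometric representation \<open>\<kappa>\<close> of the operators on a smaller
  Hilbert space, on a multiplicative set with dense span, factors through it everywhere.\<close>

lemma rep_descends:
  fixes \<kappa> :: "('u ell2 \<Rightarrow>\<^sub>L 'u ell2) \<Rightarrow> 'i ell2 \<Rightarrow>\<^sub>L 'i ell2"
  assumes A: "cstar_algebra A" and \<sigma>: "star_morphism A ell2_ops \<sigma>"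
    and \<kappa>: "star_morphism ell2_ops ell2_ops \<kappa>"
    and iso: "\<And>S. S \<in> carrier ell2_ops \<Longrightarrow> norm S \<le> norm (\<kappa> S)"
    and G: "G \<subseteq> carrier A \<times> carrier ell2_ops"
    and Gmult: "\<And>s e s' e'. \<lbrakk>(s, e) \<in> G; (s', e') \<in> G\<rbrakk> \<Longrightarrow> (s \<otimes>\<^bsub>A\<^esub> s', e o\<^sub>L e') \<in> G"
    and Gsmult: "\<And>c s e. (s, e) \<in> G \<Longrightarrow> (c \<odot>\<^bsub>A\<^esub> s, cscale_op c o\<^sub>L e) \<in> G"
    and Gstar: "\<And>s e. (s, e) \<in> G \<Longrightarrow> (star A s, star ell2_ops e) \<in> G"
    and dense: "dense_span A (fst ` G)"
    and eq: "\<And>s e. (s, e) \<in> G \<Longrightarrow> \<sigma> s = \<kappa> e"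
  obtains \<tau> where "star_morphism A ell2_ops \<tau>" "\<And>s e. (s, e) \<in> G \<Longrightarrow> \<tau> s = e"
proof (rule star_morphism_extension[OF A cstar_algebra_ell2_ops G _ _ _ dense, where K = 1])
  fix z d assume zd: "pair_span A ell2_ops G z d"
  have "norm d \<le> norm (\<kappa> d)"
    by (rule iso[OF pair_span_closed(2)[OF A cstar_algebra_ell2_ops G zd]])
  also have "\<dots> \<le> cnorm A z"
    using pair_span_norm_le[OF A cstar_algebra_ell2_ops cstar_algebra_ell2_ops \<sigma> \<kappa> G eq[symmetric] zd] by simp
  finally show "cnorm ell2_ops d \<le> 1 * cnorm A z" by simp
qed (use Gmult Gsmult Gstar that in auto)

text \<open>The character \<open>\<omega>\<close> acts as a representation by scalars. Its product with a representation \<open>\<rho>\<close> of \<open>V\<close> is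
  \<open>b \<otimes> y \<mapsto> 1 \<otimes> \<rho>(\<omega>(b) y)\<close>, which descends to the Hilbert space of \<open>\<rho>\<close>.\<close>

lemma slice_left_relation:
  assumes "min_tensor B V T t" and \<omega>: "character B \<omega>"
  shows "star_relation T V {(t b y, \<omega> b \<odot>\<^bsub>V\<^esub> y) | b y. b \<in> carrier B \<and> y \<in> carrier V}" (is "star_relation T V ?G")
proof -
  interpret S: min_tensor B V T t by fact
  have \<omega>': "\<omega> (x \<otimes>\<^bsub>B\<^esub> y) = \<omega> x * \<omega> y" "\<omega> (c \<odot>\<^bsub>B\<^esub> x) = c * \<omega> x" "\<omega> (star B x) = cnj (\<omega> x)"
    if "x \<in> carrier B" "y \<in> carrier B" for x y c
    using \<omega> that by (auto simp: character_def)
  have GI: "(t b y, \<omega> b \<odot>\<^bsub>V\<^esub> y) \<in> ?G" if "b \<in> carrier B" "y \<in> carrier V" for b y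
    using that by blast
  have mult: "(s \<otimes>\<^bsub>T\<^esub> s', e \<otimes>\<^bsub>V\<^esub> e') \<in> ?G" if "(s, e) \<in> ?G" "(s', e') \<in> ?G" for s e s' e'
  proof -
    from that obtain b y b' y' where s: "s = t b y" "e = \<omega> b \<odot>\<^bsub>V\<^esub> y" "s' = t b' y'" "e' = \<omega> b' \<odot>\<^bsub>V\<^esub> y'"
      and c: "b \<in> carrier B" "y \<in> carrier V" "b' \<in> carrier B" "y' \<in> carrier V" by blast
    then show ?thesis
      using GI[OF S.U.m_closed S.V.m_closed, of b b' y y']
      by (simp add: S.t_mult \<omega>' S.V.smult_mult_left S.V.smult_mult_right S.V.smult_smult S.V.m_closed mult.commute)
  qed
  have smult: "(c \<odot>\<^bsub>T\<^esub> s, c \<odot>\<^bsub>V\<^esub> e) \<in> ?G" if "(s, e) \<in> ?G" for s e c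
  proof -
    from that obtain b y where s: "s = t b y" "e = \<omega> b \<odot>\<^bsub>V\<^esub> y" and c: "b \<in> carrier B" "y \<in> carrier V" by blast
    then show ?thesis
      using GI[of "c \<odot>\<^bsub>B\<^esub> b" y] by (simp add: S.t_smult_left \<omega>' S.V.smult_smult)
  qed
  have star: "(star T s, star V e) \<in> ?G" if "(s, e) \<in> ?G" for s e
  proof -
    from that obtain b y where s: "s = t b y" "e = \<omega> b \<odot>\<^bsub>V\<^esub> y" and c: "b \<in> carrier B" "y \<in> carrier V" by blast
    then show ?thesis
      using GI[of "star B b" "star V y"] by (simp add: S.t_star \<omega>' S.V.star_smult)
  qed
  have fst: "fst ` ?G = S.tensors"
    unfolding S.tensors_def by force
  have closed: "?G \<subseteq> carrier T \<times> carrier V" by auto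
  have pull: "\<exists>\<sigma>. star_morphism T ell2_ops \<sigma> \<and> (\<forall>s e. (s, e) \<in> ?G \<longrightarrow> \<sigma> s = \<rho> e)"
    if \<rho>: "star_morphism V ell2_ops \<rho>" for \<rho> :: "'a \<Rightarrow> 'a ell2 \<Rightarrow>\<^sub>L 'a ell2"
  proof -
    let ?H = "{(s, \<rho> e) | s e. (s, e) \<in> ?G}"
    note h = star_morphismD[OF \<rho>]
    have HI: "(s, \<rho> e) \<in> ?H" if "(s, e) \<in> ?G" for s e using that by blast
    have ec: "e \<in> carrier V" if "(s, e) \<in> ?G" for s e using that by auto
    note pr = S.product_rep[OF character_rep[OF \<omega>] \<rho>]
    obtain \<tau> where \<tau>: "star_morphism T ell2_ops \<tau>" "\<And>s e. (s, e) \<in> ?H \<Longrightarrow> \<tau> s = e"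
    proof (rule rep_descends[OF S.T pr star_morphism_right_op norm_right_op_ge, of ?H])
      show "?H \<subseteq> carrier T \<times> carrier ell2_ops" using closed h(1) by auto
      fix s e s' e' assume "(s, e) \<in> ?H" "(s', e') \<in> ?H"
      then obtain x x' where x: "e = \<rho> x" "e' = \<rho> x'" "(s, x) \<in> ?G" "(s', x') \<in> ?G" by blast
      show "(s \<otimes>\<^bsub>T\<^esub> s', e o\<^sub>L e') \<in> ?H"
        using HI[OF mult[OF x(3,4)]] ec[OF x(3)] ec[OF x(4)] by (simp only: x h ell2_ops_sel)
    next
      fix c s e assume "(s, e) \<in> ?H"
      then obtain x where x: "e = \<rho> x" "(s, x) \<in> ?G" by blast
      show "(c \<odot>\<^bsub>T\<^esub> s, cscale_op c o\<^sub>L e) \<in> ?H"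
        using HI[OF smult[OF x(2)], of c] ec[OF x(2)] by (simp only: x h ell2_ops_sel)
      show "(star T s, star ell2_ops e) \<in> ?H"
        using HI[OF star[OF x(2)]] ec[OF x(2)] by (simp only: x h)
      obtain b y where b: "s = t b y" "x = \<omega> b \<odot>\<^bsub>V\<^esub> y" "b \<in> carrier B" "y \<in> carrier V"
        using x(2) by blast
      show "S.product_rep (\<lambda>b. cscale_op (\<omega> b)) \<rho> s = right_op e"
        using b by (simp add: x S.product_rep_tensor[OF character_rep[OF \<omega>] \<rho>] prod_op_cscale_left h)
    next
      have "fst ` ?H = fst ` ?G" by force
      then show "dense_span T (fst ` ?H)"
        using S.dense_tensors by (simp only: fst)
    next
      fix \<tau> assume "star_morphism T ell2_ops \<tau>" "\<And>s e. (s, e) \<in> ?H \<Longrightarrow> \<tau> s = e"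
      then show thesis by (rule that)
    qed
    then show ?thesis using HI by blast
  qed
  show ?thesis
    by (rule star_relationI[OF closed mult smult star _ pull]) (simp_all only: fst S.dense_tensors)
qed

text \<open>Up to a constant, the norm is the supremum over representations on the given Hilbert space. Tensor products have
  this property because representations define their norm, and \<open>\<complex>\<^sup>n\<close> has it because its coordinates are
  representations. Slice maps into such algebras are bounded.\<close>

definition faithful :: "'u cstar_alg \<Rightarrow> bool" where
  "faithful D \<longleftrightarrow> (\<exists>M. \<forall>d \<in> carrier D. \<forall>K.
     (\<forall>\<rho> :: 'u \<Rightarrow> 'u ell2 \<Rightarrow>\<^sub>L 'u ell2. star_morphism D ell2_ops \<rho> \<longrightarrow> norm (\<rho> d) \<le> K) \<longrightarrow> cnorm D d \<le> M * K)"

text \<open>The products of representations act on \<open>\<ell>\<^sup>2('u \<times> 'u)\<close>, which for infinite \<open>'u\<close> is unitarily equivalent to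
  \<open>\<ell>\<^sup>2('u)\<close>.\<close>

lemma (in min_tensor) faithful_tensor_product:
  assumes "infinite (UNIV :: 'u set)"
  shows "faithful T"
proof -
  have "(card_of (UNIV :: ('u \<times> 'u) set), card_of (UNIV :: 'u set)) \<in> ordIso"
    using card_of_Times_same_infinite[OF assms] by simp
  then obtain \<beta> :: "'u \<times> 'u \<Rightarrow> 'u" where \<beta>: "bij \<beta>"
    using card_of_ordIso[of "UNIV :: ('u \<times> 'u) set" "UNIV :: 'u set"] by auto
  have "cnorm T d \<le> 1 * K" if d: "d \<in> carrier T"
    and K: "\<forall>\<rho> :: 'u \<Rightarrow> 'u ell2 \<Rightarrow>\<^sub>L 'u ell2. star_morphism T ell2_ops \<rho> \<longrightarrow> norm (\<rho> d) \<le> K" for d K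
  proof -
    have "cnorm T d \<le> K"
    proof (rule norm_le_product_reps[OF d])
      fix \<phi> \<psi> :: "'u \<Rightarrow> 'u ell2 \<Rightarrow>\<^sub>L 'u ell2"
      assume \<phi>: "star_morphism U ell2_ops \<phi>" and \<psi>: "star_morphism V ell2_ops \<psi>"
      note pr = product_rep[OF \<phi> \<psi>]
      have "norm (conj_op \<beta> (product_rep \<phi> \<psi> d)) \<le> K"
        using K star_morphism_comp[OF pr star_morphism_conj_op[OF \<beta>]] by blast
      then show "norm (product_rep \<phi> \<psi> d) \<le> K"
        by (simp add: norm_conj_op[OF \<beta> star_morphismD(1)[OF pr d]])
    qed
    then show ?thesis by simp
  qed
  then show ?thesis unfolding faithful_def by blast
qed

lemma star_relation_faithful_morphism:
  assumes A: "cstar_algebra A" and D: "cstar_algebra D" and G: "star_relation A D G" and "faithful D"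
  obtains F where "star_morphism A D F" "\<And>s e. (s, e) \<in> G \<Longrightarrow> F s = e"
proof -
  note g = star_relationD[OF G]
  obtain M where M: "\<And>d K. \<lbrakk>d \<in> carrier D;
      \<And>\<rho> :: 'a \<Rightarrow> 'a ell2 \<Rightarrow>\<^sub>L 'a ell2. star_morphism D ell2_ops \<rho> \<Longrightarrow> norm (\<rho> d) \<le> K\<rbrakk>
      \<Longrightarrow> cnorm D d \<le> M * K"
    using assms(4) unfolding faithful_def by blast
  have Gc: "G \<subseteq> carrier A \<times> carrier D" using g(1,2) by auto
  show ?thesis
  proof (rule star_morphism_extension[OF A D Gc _ _ _ g(6)])
    fix z d assume zd: "pair_span A D G z d"
    show "cnorm D d \<le> M * cnorm A z"
    proof (rule M[OF pair_span_closed(2)[OF A D Gc zd]])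
      fix \<rho> :: "'a \<Rightarrow> 'a ell2 \<Rightarrow>\<^sub>L 'a ell2" assume \<rho>: "star_morphism D ell2_ops \<rho>"
      obtain \<sigma> where \<sigma>: "star_morphism A ell2_ops \<sigma>" "\<And>s e. (s, e) \<in> G \<Longrightarrow> \<sigma> s = \<rho> e"
        using g(7)[OF \<rho>] by blast
      show "norm (\<rho> d) \<le> cnorm A z"
        using pair_span_norm_le[OF A D cstar_algebra_ell2_ops \<sigma>(1) \<rho> Gc \<sigma>(2)[symmetric] zd] by simp
    qed
  qed (use g(3-5) that in blast)+
qed

lemma finite_universe_trivial:
  assumes "cstar_algebra (D :: 'u cstar_alg)" "finite (UNIV :: 'u set)" "x \<in> carrier D"
  shows "x = \<zero>\<^bsub>D\<^esub>"
proof (rule ccontr)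
  interpret D: cstar_algebra D by fact
  assume x: "x \<noteq> \<zero>\<^bsub>D\<^esub>"
  have "inj (\<lambda>c. c \<odot>\<^bsub>D\<^esub> x)"
  proof (rule injI)
    fix c d assume "c \<odot>\<^bsub>D\<^esub> x = d \<odot>\<^bsub>D\<^esub> x"
    then have "(c - d) \<odot>\<^bsub>D\<^esub> x = \<zero>\<^bsub>D\<^esub>"
      using assms(3) D.add_smult[of x c "-d"] D.smult_smult[of x "-1" d] D.r_neg[of "d \<odot>\<^bsub>D\<^esub> x"]
      by (simp add: D.minus_eq_smult)
    then have "cmod (c - d) * cnorm D x = 0"
      using D.norm_smult[OF assms(3), of "c - d"] by simp
    then show "c = d" using x assms(3) by (simp add: D.norm_eq_zero)
  qed
  then have "finite (UNIV :: complex set)"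
    using finite_subset[OF subset_UNIV assms(2)] finite_imageD by blast
  then show False using infinite_UNIV_char_0 by blast
qed


section \<open>The algebra of tuples\<close>

text \<open>The structure of \<open>\<complex>\<^sup>n\<close>, transported to \<open>B\<close>: minimal projections \<open>e\<^sub>k\<close> and coordinates \<open>\<omega>\<^sub>k\<close>.\<close>

locale coordinate_algebra = B: cstar_algebra B for B :: "'u cstar_alg" +
  fixes n :: nat and e :: "nat \<Rightarrow> 'u" and \<omega> :: "nat \<Rightarrow> 'u \<Rightarrow> complex"
  assumes e_closed: "k \<in> {1..n} \<Longrightarrow> e k \<in> carrier B"
    and e_star: "k \<in> {1..n} \<Longrightarrow> star B (e k) = e k"
    and e_mult: "\<lbrakk>k \<in> {1..n}; l \<in> {1..n}\<rbrakk> \<Longrightarrow> e k \<otimes>\<^bsub>B\<^esub> e l = (if k = l then e k else \<zero>\<^bsub>B\<^esub>)"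
    and e_sum: "(\<Oplus>\<^bsub>B\<^esub>k\<in>{1..n}. e k) = \<one>\<^bsub>B\<^esub>"
    and commute: "\<lbrakk>x \<in> carrier B; y \<in> carrier B\<rbrakk> \<Longrightarrow> x \<otimes>\<^bsub>B\<^esub> y = y \<otimes>\<^bsub>B\<^esub> x"
    and character: "k \<in> {1..n} \<Longrightarrow> character B (\<omega> k)"
    and \<omega>_e: "\<lbrakk>k \<in> {1..n}; l \<in> {1..n}\<rbrakk> \<Longrightarrow> \<omega> k (e l) = (if k = l then 1 else 0)"
    and expand: "b \<in> carrier B \<Longrightarrow> b = (\<Oplus>\<^bsub>B\<^esub>k\<in>{1..n}. \<omega> k b \<odot>\<^bsub>B\<^esub> e k)"

lemma complex_power_sel [simp]:
  "carrier (complex_power n) = {1..n} \<rightarrow>\<^sub>E UNIV"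
  "mult (complex_power n) = (\<lambda>x y. \<lambda>i \<in> {1..n}. x i * y i)"
  "one (complex_power n) = (\<lambda>i \<in> {1..n}. 1)"
  "zero (complex_power n) = (\<lambda>i \<in> {1..n}. 0)"
  "add (complex_power n) = (\<lambda>x y. \<lambda>i \<in> {1..n}. x i + y i)"
  "smult (complex_power n) = (\<lambda>c x. \<lambda>i \<in> {1..n}. c * x i)"
  "star (complex_power n) = (\<lambda>x. \<lambda>i \<in> {1..n}. cnj (x i))"
  by (simp_all add: complex_power_def)

lemma coordinate_algebra_iso:
  assumes B: "cstar_algebra B" and j: "j \<in> cstar_iso (complex_power n) B"
    and e: "\<And>i. i \<in> {1..n} \<Longrightarrow> e i = j (unit_vec n i)"
  shows "coordinate_algebra B n e (\<lambda>k b. inv_into (carrier (complex_power n)) j b k)"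
proof -
  interpret B: cstar_algebra B by fact
  let ?P = "complex_power n"
  define h where "h = inv_into (carrier ?P) j"
  have jm: "star_morphism ?P B j" and j1: "j \<one>\<^bsub>?P\<^esub> = \<one>\<^bsub>B\<^esub>" and bij: "bij_betw j (carrier ?P) (carrier B)"
    using j by (auto simp: cstar_iso_def cstar_hom_iff)
  note hom = star_morphismD[OF jm]
  have hc: "h b \<in> carrier ?P" if "b \<in> carrier B" for b
    unfolding h_def using bij that by (metis bij_betw_def inv_into_into)
  have jh: "j (h b) = b" if "b \<in> carrier B" for b
    unfolding h_def by (rule bij_betw_inv_into_right[OF bij that])
  have hj: "h (j x) = x" if "x \<in> carrier ?P" for x
    unfolding h_def by (rule bij_betw_inv_into_left[OF bij that])
  have uc: "unit_vec n k \<in> carrier ?P" for k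
    by (simp add: unit_vec_def)
  have j0: "j \<zero>\<^bsub>?P\<^esub> = \<zero>\<^bsub>B\<^esub>"
  proof -
    have "j (0 \<odot>\<^bsub>?P\<^esub> \<one>\<^bsub>?P\<^esub>) = 0 \<odot>\<^bsub>B\<^esub> j \<one>\<^bsub>?P\<^esub>" by (rule hom(4)) simp
    moreover have "0 \<odot>\<^bsub>?P\<^esub> \<one>\<^bsub>?P\<^esub> = \<zero>\<^bsub>?P\<^esub>" by (auto intro!: ext)
    ultimately show ?thesis by (simp only: j1 B.zero_smult[OF ring.ring_simprules(6)[OF B.is_ring]])
  qed
  have jsum: "(\<Oplus>\<^bsub>B\<^esub>k\<in>{1..m}. c k \<odot>\<^bsub>B\<^esub> e k) = j (\<lambda>i\<in>{1..n}. if i \<le> m then c i else 0)" if "m \<le> n" for m c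
    using that
  proof (induction m)
    case 0
    have "(\<lambda>i\<in>{1..n}. if i \<le> 0 then c i else 0) = \<zero>\<^bsub>?P\<^esub>" by (auto intro!: ext)
    then show ?case by (simp only: j0) (simp add: B.finsum_empty)
  next
    case (Suc m)
    let ?f = "\<lambda>m. \<lambda>i\<in>{1..n}. if i \<le> m then c i else 0"
    have ec: "c k \<odot>\<^bsub>B\<^esub> e k \<in> carrier B" if "k \<in> {1..n}" for k
      using that hom(1)[OF uc] by (simp add: e)
    have "(\<Oplus>\<^bsub>B\<^esub>k\<in>{1..Suc m}. c k \<odot>\<^bsub>B\<^esub> e k) = c (Suc m) \<odot>\<^bsub>B\<^esub> e (Suc m) \<oplus>\<^bsub>B\<^esub> (\<Oplus>\<^bsub>B\<^esub>k\<in>{1..m}. c k \<odot>\<^bsub>B\<^esub> e k)"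
      using Suc.prems by (subst atLeastAtMostSuc_conv) (auto intro!: B.finsum_insert ec)
    also have "\<dots> = c (Suc m) \<odot>\<^bsub>B\<^esub> j (unit_vec n (Suc m)) \<oplus>\<^bsub>B\<^esub> j (?f m)"
    proof -
      have "e (Suc m) = j (unit_vec n (Suc m))" using Suc.prems by (intro e) auto
      then show ?thesis by (simp only: Suc.IH[OF Suc_leD[OF Suc.prems]])
    qed
    also have "\<dots> = j (c (Suc m) \<odot>\<^bsub>?P\<^esub> unit_vec n (Suc m) \<oplus>\<^bsub>?P\<^esub> ?f m)"
      using uc[of "Suc m"] by (subst hom(2)) (simp_all only: hom(4)[OF uc], auto)
    also have "c (Suc m) \<odot>\<^bsub>?P\<^esub> unit_vec n (Suc m) \<oplus>\<^bsub>?P\<^esub> ?f m = ?f (Suc m)"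
      by (auto intro!: ext simp: unit_vec_def le_Suc_eq)
    finally show ?case .
  qed
  have expand: "b = (\<Oplus>\<^bsub>B\<^esub>k\<in>{1..n}. h b k \<odot>\<^bsub>B\<^esub> e k)" if b: "b \<in> carrier B" for b
  proof -
    have "(\<lambda>i\<in>{1..n}. if i \<le> n then h b i else 0) = h b"
      using hc[OF b] by (auto intro!: ext simp: PiE_def extensional_def)
    then show ?thesis using jsum[of n "h b"] jh[OF b] by simp
  qed
  have hops: "h (x \<oplus>\<^bsub>B\<^esub> y) = h x \<oplus>\<^bsub>?P\<^esub> h y" "h (x \<otimes>\<^bsub>B\<^esub> y) = h x \<otimes>\<^bsub>?P\<^esub> h y"
    if "x \<in> carrier B" "y \<in> carrier B" for x y
  proof -
    have "j (h x \<oplus>\<^bsub>?P\<^esub> h y) = x \<oplus>\<^bsub>B\<^esub> y" "j (h x \<otimes>\<^bsub>?P\<^esub> h y) = x \<otimes>\<^bsub>B\<^esub> y"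
      using hom(2,3)[OF hc[OF that(1)] hc[OF that(2)]] that by (simp_all only: jh)
    moreover have "h x \<oplus>\<^bsub>?P\<^esub> h y \<in> carrier ?P" "h x \<otimes>\<^bsub>?P\<^esub> h y \<in> carrier ?P" by auto
    ultimately show "h (x \<oplus>\<^bsub>B\<^esub> y) = h x \<oplus>\<^bsub>?P\<^esub> h y" "h (x \<otimes>\<^bsub>B\<^esub> y) = h x \<otimes>\<^bsub>?P\<^esub> h y"
      by (metis hj)+
  qed
  have hops': "h (c \<odot>\<^bsub>B\<^esub> x) = c \<odot>\<^bsub>?P\<^esub> h x" "h (star B x) = star ?P (h x)"
    if "x \<in> carrier B" for x c
  proof -
    have "j (c \<odot>\<^bsub>?P\<^esub> h x) = c \<odot>\<^bsub>B\<^esub> x" "j (star ?P (h x)) = star B x"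
      using hom(4,5)[OF hc[OF that]] that by (simp_all only: jh)
    moreover have "c \<odot>\<^bsub>?P\<^esub> h x \<in> carrier ?P" "star ?P (h x) \<in> carrier ?P" by auto
    ultimately show "h (c \<odot>\<^bsub>B\<^esub> x) = c \<odot>\<^bsub>?P\<^esub> h x" "h (star B x) = star ?P (h x)"
      by (metis hj)+
  qed
  have h1: "h \<one>\<^bsub>B\<^esub> = \<one>\<^bsub>?P\<^esub>"
    using hj[of "\<one>\<^bsub>?P\<^esub>"] by (simp only: j1) simp
  show ?thesis
    unfolding h_def[symmetric]
  proof (unfold_locales, goal_cases)
    case (1 k) then show ?case using hom(1)[OF uc] by (simp add: e)
  next
    case (2 k)
    have "star ?P (unit_vec n k) = unit_vec n k" by (auto intro!: ext simp: unit_vec_def)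
    then show ?case using hom(5)[OF uc, of k] 2 by (simp only: e)
  next
    case (3 k l)
    have "unit_vec n k \<otimes>\<^bsub>?P\<^esub> unit_vec n l = (if k = l then unit_vec n k else \<zero>\<^bsub>?P\<^esub>)"
      by (auto intro!: ext simp: unit_vec_def)
    then show ?case using hom(3)[OF uc uc, of k l] 3 j0 by (auto simp only: e split: if_splits)
  next
    case 4
    have "(\<lambda>i\<in>{1..n}. if i \<le> n then 1 else 0) = \<one>\<^bsub>?P\<^esub>" by (auto intro!: ext)
    moreover have "(\<Oplus>\<^bsub>B\<^esub>k\<in>{1..n}. e k) = (\<Oplus>\<^bsub>B\<^esub>k\<in>{1..n}. 1 \<odot>\<^bsub>B\<^esub> e k)"
      using hom(1)[OF uc] by (intro B.finsum_cong') (auto simp: e)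
    ultimately show ?case using jsum[of n "\<lambda>_. 1"] j1 by (simp only: order_refl)
  next
    case (5 x y)
    have "h x \<otimes>\<^bsub>?P\<^esub> h y = h y \<otimes>\<^bsub>?P\<^esub> h x" by (simp add: mult.commute)
    then have "h (x \<otimes>\<^bsub>B\<^esub> y) = h (y \<otimes>\<^bsub>B\<^esub> x)" using 5 by (simp only: hops)
    then show ?case using 5 jh B.m_closed by metis
  next
    case (6 k)
    then show ?case
      unfolding character_def by (simp add: hops hops' h1)
  next
    case (7 k l)
    then show ?case by (simp add: e hj[OF uc]) (simp add: unit_vec_def)
  next
    case (8 b) then show ?case by (rule expand)
  qed
qed

context coordinate_algebra
begin

lemma sum_expand:
  assumes D: "cstar_algebra D" and b: "b \<in> carrier B"
    and N: "\<And>x. x \<in> carrier B \<Longrightarrow> N x \<in> carrier D"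
      "\<And>x y. \<lbrakk>x \<in> carrier B; y \<in> carrier B\<rbrakk> \<Longrightarrow> N (x \<oplus>\<^bsub>B\<^esub> y) = N x \<oplus>\<^bsub>D\<^esub> N y" "N \<zero>\<^bsub>B\<^esub> = \<zero>\<^bsub>D\<^esub>"
  shows "(\<Oplus>\<^bsub>D\<^esub>k\<in>{1..n}. N (\<omega> k b \<odot>\<^bsub>B\<^esub> e k)) = N b"
proof -
  have "N (\<Oplus>\<^bsub>B\<^esub>k\<in>{1..n}. \<omega> k b \<odot>\<^bsub>B\<^esub> e k) = (\<Oplus>\<^bsub>D\<^esub>k\<in>{1..n}. N (\<omega> k b \<odot>\<^bsub>B\<^esub> e k))"
    by (rule additive_finsum[OF B.cstar_algebra_axioms D N(1,3,2)]) (auto simp: e_closed)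
  then show ?thesis using expand[OF b] by simp
qed

text \<open>The multiplication of \<open>B\<close> and the associators below have the form \<open>\<Sum>\<^sub>k J\<^sub>k \<circ> S\<^sub>k\<close>, where \<open>S\<^sub>k\<close> evaluates a factor \<open>B\<close> at the point \<open>k\<close> and
  \<open>J\<^sub>k\<close> inserts \<open>e\<^sub>k\<close> at another place. The \<open>J\<^sub>k\<close> have orthogonal ranges because their units are the images of
  the \<open>e\<^sub>k\<close> under a unital morphism \<open>L\<close>.\<close>

lemma sum_of_slices_hom:
  assumes T: "cstar_algebra T" and W: "cstar_algebra W" and D: "cstar_algebra D"
    and S: "\<And>k. k \<in> {1..n} \<Longrightarrow> star_morphism T W (S k)" "\<And>k. k \<in> {1..n} \<Longrightarrow> S k \<one>\<^bsub>T\<^esub> = \<one>\<^bsub>W\<^esub>"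
    and J: "\<And>k. k \<in> {1..n} \<Longrightarrow> star_morphism W D (J k)" "\<And>k. k \<in> {1..n} \<Longrightarrow> J k \<one>\<^bsub>W\<^esub> = L (e k)"
    and L: "star_morphism B D L" "L \<one>\<^bsub>B\<^esub> = \<one>\<^bsub>D\<^esub>"
  shows "(\<lambda>z \<in> carrier T. \<Oplus>\<^bsub>D\<^esub>k\<in>{1..n}. J k (S k z)) \<in> cstar_hom T D"
proof (rule orthogonal_sum_hom[OF T D])
  fix k l assume kl: "k \<in> {1..n}" "l \<in> {1..n}" "k \<noteq> l"
  then show "J k (S k \<one>\<^bsub>T\<^esub>) \<otimes>\<^bsub>D\<^esub> J l (S l \<one>\<^bsub>T\<^esub>) = \<zero>\<^bsub>D\<^esub>"
    using star_morphismD(3)[OF L(1) e_closed e_closed, of k l] star_morphism_zero[OF B.cstar_algebra_axioms D L(1)]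
    by (simp add: S J e_mult)
next
  interpret D: cstar_algebra D by fact
  have "(\<Oplus>\<^bsub>D\<^esub>k\<in>{1..n}. J k (S k \<one>\<^bsub>T\<^esub>)) = (\<Oplus>\<^bsub>D\<^esub>k\<in>{1..n}. L (e k))"
    by (rule D.finsum_cong') (auto simp: S J e_closed star_morphismD(1)[OF L(1)])
  also have "\<dots> = L (\<Oplus>\<^bsub>B\<^esub>k\<in>{1..n}. e k)"
    by (rule star_morphism_finsum[OF B.cstar_algebra_axioms D L(1), symmetric]) (auto simp: e_closed)
  finally show "(\<Oplus>\<^bsub>D\<^esub>k\<in>{1..n}. J k (S k \<one>\<^bsub>T\<^esub>)) = \<one>\<^bsub>D\<^esub>"
    by (simp only: e_sum L)
qed (auto intro!: star_morphism_comp[OF S(1) J(1)])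

lemma faithful_B: "faithful B"
proof -
  have "cnorm B b \<le> real n * K" if b: "b \<in> carrier B"
    and K: "\<forall>\<rho> :: 'u \<Rightarrow> 'u ell2 \<Rightarrow>\<^sub>L 'u ell2. star_morphism B ell2_ops \<rho> \<longrightarrow> norm (\<rho> b) \<le> K" for b K
  proof -
    have le: "cmod (\<omega> k b) \<le> K" if "k \<in> {1..n}" for k
    proof -
      have "norm (cscale_op (\<omega> k b) (delta undefined :: 'u ell2)) \<le> norm (cscale_op (\<omega> k b) :: 'u ell2 \<Rightarrow>\<^sub>L 'u ell2)"
        using norm_blinfun[of "cscale_op (\<omega> k b)" "delta undefined :: 'u ell2"] by (simp add: norm_delta)
      also have "\<dots> \<le> K"
        using K character_rep[OF character[OF that]] by blast
      finally show ?thesis by (simp add: norm_cscale norm_delta)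
    qed
    have "cnorm B (\<Oplus>\<^bsub>B\<^esub>k\<in>I. \<omega> k b \<odot>\<^bsub>B\<^esub> e k) \<le> real (card I) * K" if "I \<subseteq> {1..n}" for I
      using finite_subset[OF that finite_atLeastAtMost] that
    proof (induction I)
      case (insert k I)
      then have k: "k \<in> {1..n}" by auto
      have c: "(\<lambda>k. \<omega> k b \<odot>\<^bsub>B\<^esub> e k) \<in> I \<rightarrow> carrier B"
        using insert by (auto simp: e_closed)
      have "cnorm B (\<omega> k b \<odot>\<^bsub>B\<^esub> e k) \<le> cmod (\<omega> k b) * 1"
        using B.norm_projection_le_one[OF e_closed e_star, of k] k
        by (simp add: B.norm_smult e_closed e_mult mult_left_le)
      then have "cnorm B (\<omega> k b \<odot>\<^bsub>B\<^esub> e k \<oplus>\<^bsub>B\<^esub> (\<Oplus>\<^bsub>B\<^esub>k\<in>I. \<omega> k b \<odot>\<^bsub>B\<^esub> e k)) \<le> K + real (card I) * K"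
        using le[OF k] insert k by (intro order_trans[OF B.norm_add]) (auto simp: e_closed B.finsum_closed[OF c])
      then show ?case
        using insert k by (subst B.finsum_insert[OF _ _ c]) (auto simp: e_closed algebra_simps)
    qed (simp add: B.finsum_empty)
    from this[of "{1..n}"] show ?thesis using expand[OF b] by simp
  qed
  then show ?thesis unfolding faithful_def by blast
qed

end

context min_tensor
begin

lemma embed_left:
  assumes "q \<in> carrier V" "star V q = q" "q \<otimes>\<^bsub>V\<^esub> q = q"
  shows "star_morphism U T (\<lambda>x. t x q)"
  unfolding star_morphism_def
  using assms by (auto simp: t_add_left t_smult_left t_star t_mult)

lemma embed_right:
  assumes "p \<in> carrier U" "star U p = p" "p \<otimes>\<^bsub>U\<^esub> p = p"
  shows "star_morphism V T (\<lambda>y. t p y)"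
  unfolding star_morphism_def
  using assms by (auto simp: t_add_right t_smult_right t_star t_mult)

end


section \<open>The structural maps\<close>

context minimal_tensor_system
begin

lemma mt: "\<lbrakk>cstar_algebra P; cstar_algebra Q\<rbrakk> \<Longrightarrow> min_tensor P Q (P \<boxtimes> Q) (tens \<T> P Q)"
  by (simp add: min_tensor_def minimal_tensor_product)

lemma cstar_tprod: "\<lbrakk>cstar_algebra P; cstar_algebra Q\<rbrakk> \<Longrightarrow> cstar_algebra (P \<boxtimes> Q)"
  using min_tensor.T[OF mt] .

lemma hom_eqI:
  assumes "cstar_algebra T" "cstar_algebra D" "dense_span T S" "\<phi> \<in> cstar_hom T D" "\<psi> \<in> cstar_hom T D"
    and "\<And>s. s \<in> S \<Longrightarrow> \<phi> s = \<psi> s"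
  shows "\<phi> = \<psi>"
proof (rule extensionalityI)
  show "\<phi> \<in> extensional (carrier T)" "\<psi> \<in> extensional (carrier T)"
    using assms(4,5) by (auto simp: cstar_hom_iff)
  show "\<phi> z = \<psi> z" if "z \<in> carrier T" for z
    by (rule star_morphism_eqI[OF assms(1-3) _ _ assms(6) that]) (use assms(4,5) in \<open>auto simp: cstar_hom_iff\<close>)
qed

lemma hom_of_tensors:
  assumes P: "cstar_algebra P" and Q: "cstar_algebra Q" and D: "cstar_algebra D"
    and F: "F \<in> cstar_hom (P \<boxtimes> Q) D" "\<And>a b. \<lbrakk>a \<in> carrier P; b \<in> carrier Q\<rbrakk> \<Longrightarrow> F (tens \<T> P Q a b) = h a b"
  shows "hom_of_tensors \<T> P Q D h \<in> cstar_hom (P \<boxtimes> Q) D"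
    and "\<lbrakk>a \<in> carrier P; b \<in> carrier Q\<rbrakk> \<Longrightarrow> hom_of_tensors \<T> P Q D h (tens \<T> P Q a b) = h a b"
proof -
  interpret S: min_tensor P Q "P \<boxtimes> Q" "tens \<T> P Q" by (rule mt[OF P Q])
  have "\<exists>!F. F \<in> cstar_hom (P \<boxtimes> Q) D \<and> (\<forall>a \<in> carrier P. \<forall>b \<in> carrier Q. F (tens \<T> P Q a b) = h a b)"
  proof (rule ex1I)
    show "F \<in> cstar_hom (P \<boxtimes> Q) D \<and> (\<forall>a \<in> carrier P. \<forall>b \<in> carrier Q. F (tens \<T> P Q a b) = h a b)"
      using F by blast
    fix F' assume F': "F' \<in> cstar_hom (P \<boxtimes> Q) D \<and> (\<forall>a \<in> carrier P. \<forall>b \<in> carrier Q. F' (tens \<T> P Q a b) = h a b)"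
    then show "F' = F"
      by (intro hom_eqI[OF S.T D S.dense_tensors]) (use F in \<open>auto simp: S.tensors_def\<close>)
  qed
  from theI'[OF this]
  show "hom_of_tensors \<T> P Q D h \<in> cstar_hom (P \<boxtimes> Q) D"
    "\<lbrakk>a \<in> carrier P; b \<in> carrier Q\<rbrakk> \<Longrightarrow> hom_of_tensors \<T> P Q D h (tens \<T> P Q a b) = h a b"
    unfolding hom_of_tensors_def by blast+
qed

lemma tensor_map:
  assumes c: "cstar_algebra P" "cstar_algebra Q" "cstar_algebra P'" "cstar_algebra Q'"
    and \<phi>: "\<phi> \<in> cstar_hom P P'" and \<psi>: "\<psi> \<in> cstar_hom Q Q'"
  shows "tensor_map \<T> P P' Q Q' \<phi> \<psi> \<in> cstar_hom (P \<boxtimes> Q) (P' \<boxtimes> Q')"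
    and "\<lbrakk>a \<in> carrier P; b \<in> carrier Q\<rbrakk>
      \<Longrightarrow> tensor_map \<T> P P' Q Q' \<phi> \<psi> (tens \<T> P Q a b) = tens \<T> P' Q' (\<phi> a) (\<psi> b)"
proof -
  interpret S: min_tensor P Q "P \<boxtimes> Q" "tens \<T> P Q" by (rule mt[OF c(1,2)])
  interpret S': min_tensor P' Q' "P' \<boxtimes> Q'" "tens \<T> P' Q'" by (rule mt[OF c(3,4)])
  have \<phi>': "star_morphism P P' \<phi>" "\<phi> \<one>\<^bsub>P\<^esub> = \<one>\<^bsub>P'\<^esub>" and \<psi>': "star_morphism Q Q' \<psi>" "\<psi> \<one>\<^bsub>Q\<^esub> = \<one>\<^bsub>Q'\<^esub>"
    using \<phi> \<psi> by (auto simp: cstar_hom_iff)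
  obtain F where F: "star_morphism (P \<boxtimes> Q) (P' \<boxtimes> Q') F" "F \<in> extensional (carrier (P \<boxtimes> Q))"
    "\<And>x y. \<lbrakk>x \<in> carrier P; y \<in> carrier Q\<rbrakk> \<Longrightarrow> F (tens \<T> P Q x y) = tens \<T> P' Q' (\<phi> x) (\<psi> y)"
    using tensor_morphism[OF mt[OF c(1,2)] mt[OF c(3,4)] \<phi>'(1) \<psi>'(1)] by blast
  have "F \<in> cstar_hom (P \<boxtimes> Q) (P' \<boxtimes> Q')"
    using F F(3)[of "\<one>\<^bsub>P\<^esub>" "\<one>\<^bsub>Q\<^esub>"] by (simp add: cstar_hom_iff S.t_one S'.t_one \<phi>' \<psi>')
  from hom_of_tensors[OF c(1,2) S'.T this F(3)]
  show "tensor_map \<T> P P' Q Q' \<phi> \<psi> \<in> cstar_hom (P \<boxtimes> Q) (P' \<boxtimes> Q')"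
    "\<lbrakk>a \<in> carrier P; b \<in> carrier Q\<rbrakk> \<Longrightarrow> tensor_map \<T> P P' Q Q' \<phi> \<psi> (tens \<T> P Q a b) = tens \<T> P' Q' (\<phi> a) (\<psi> b)"
    unfolding tensor_map_def by blast+
qed

lemma flip_map:
  assumes c: "cstar_algebra P" "cstar_algebra Q"
  shows "flip_map \<T> P Q \<in> cstar_hom (P \<boxtimes> Q) (Q \<boxtimes> P)"
    and "\<lbrakk>a \<in> carrier P; b \<in> carrier Q\<rbrakk> \<Longrightarrow> flip_map \<T> P Q (tens \<T> P Q a b) = tens \<T> Q P b a"
proof -
  interpret S: min_tensor P Q "P \<boxtimes> Q" "tens \<T> P Q" by (rule mt[OF c])
  interpret S': min_tensor Q P "Q \<boxtimes> P" "tens \<T> Q P" by (rule mt[OF c(2,1)])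
  obtain F where F: "star_morphism (P \<boxtimes> Q) (Q \<boxtimes> P) F" "F \<in> extensional (carrier (P \<boxtimes> Q))"
    "\<And>x y. \<lbrakk>x \<in> carrier P; y \<in> carrier Q\<rbrakk> \<Longrightarrow> F (tens \<T> P Q x y) = tens \<T> Q P y x"
    using flip_morphism[OF mt[OF c] mt[OF c(2,1)]] by blast
  have "F \<in> cstar_hom (P \<boxtimes> Q) (Q \<boxtimes> P)"
    using F F(3)[of "\<one>\<^bsub>P\<^esub>" "\<one>\<^bsub>Q\<^esub>"] by (simp add: cstar_hom_iff S.t_one S'.t_one)
  from hom_of_tensors[OF c S'.T this F(3)]
  show "flip_map \<T> P Q \<in> cstar_hom (P \<boxtimes> Q) (Q \<boxtimes> P)"
    "\<lbrakk>a \<in> carrier P; b \<in> carrier Q\<rbrakk> \<Longrightarrow> flip_map \<T> P Q (tens \<T> P Q a b) = tens \<T> Q P b a"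
    unfolding flip_map_def by blast+
qed

lemma id_hom: "cstar_algebra P \<Longrightarrow> id_hom P \<in> cstar_hom P P"
  using ring.ring_simprules(6)[OF cstar_algebra.is_ring] star_morphism_id[of P]
    cstar_algebra.a_closed[of P] cstar_algebra.m_closed[of P] cstar_algebra.smult_closed'[of P] cstar_algebra.star_closed[of P]
  by (auto simp: cstar_hom_iff id_hom_def star_morphism_def)

text \<open>Any homomorphism with the values of an associator on elementary tensors is the associator selected by the
  definite description, because these tensors have dense span.\<close>

lemma assoc_map:
  assumes c: "cstar_algebra P" "cstar_algebra Q" "cstar_algebra R"
    and F: "F \<in> cstar_hom ((P \<boxtimes> Q) \<boxtimes> R) (P \<boxtimes> (Q \<boxtimes> R))"
      "\<And>p q r. \<lbrakk>p \<in> carrier P; q \<in> carrier Q; r \<in> carrier R\<rbrakk> \<Longrightarrow>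
        F (tens \<T> (P \<boxtimes> Q) R (tens \<T> P Q p q) r) = tens \<T> P (Q \<boxtimes> R) p (tens \<T> Q R q r)"
  shows "assoc_map \<T> P Q R = F"
  unfolding assoc_map_def
proof (rule the_equality)
  fix F' assume F': "F' \<in> cstar_hom ((P \<boxtimes> Q) \<boxtimes> R) (P \<boxtimes> (Q \<boxtimes> R)) \<and>
    (\<forall>a \<in> carrier P. \<forall>b \<in> carrier Q. \<forall>c \<in> carrier R.
       F' (tens \<T> (P \<boxtimes> Q) R (tens \<T> P Q a b) c) = tens \<T> P (Q \<boxtimes> R) a (tens \<T> Q R b c))"
  interpret S: min_tensor P Q "P \<boxtimes> Q" "tens \<T> P Q" by (rule mt[OF c(1,2)])
  interpret S': min_tensor "P \<boxtimes> Q" R "(P \<boxtimes> Q) \<boxtimes> R" "tens \<T> (P \<boxtimes> Q) R" by (rule mt[OF S.T c(3)])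
  show "F' = F"
    by (rule hom_eqI[OF S'.T cstar_tprod[OF c(1) cstar_tprod[OF c(2,3)]]
          S'.dense_tensors_of_dense[OF S.dense_tensors dense_span_carrier[OF c(3)]]])
      (use F F' in \<open>auto simp: S.tensors_def\<close>)
qed (use F in auto)

lemma assoc_inv_map:
  assumes c: "cstar_algebra P" "cstar_algebra Q" "cstar_algebra R"
    and F: "F \<in> cstar_hom (P \<boxtimes> (Q \<boxtimes> R)) ((P \<boxtimes> Q) \<boxtimes> R)"
      "\<And>p q r. \<lbrakk>p \<in> carrier P; q \<in> carrier Q; r \<in> carrier R\<rbrakk> \<Longrightarrow>
        F (tens \<T> P (Q \<boxtimes> R) p (tens \<T> Q R q r)) = tens \<T> (P \<boxtimes> Q) R (tens \<T> P Q p q) r"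
  shows "assoc_inv_map \<T> P Q R = F"
  unfolding assoc_inv_map_def
proof (rule the_equality)
  fix F' assume F': "F' \<in> cstar_hom (P \<boxtimes> (Q \<boxtimes> R)) ((P \<boxtimes> Q) \<boxtimes> R) \<and>
    (\<forall>a \<in> carrier P. \<forall>b \<in> carrier Q. \<forall>c \<in> carrier R.
       F' (tens \<T> P (Q \<boxtimes> R) a (tens \<T> Q R b c)) = tens \<T> (P \<boxtimes> Q) R (tens \<T> P Q a b) c)"
  interpret S: min_tensor Q R "Q \<boxtimes> R" "tens \<T> Q R" by (rule mt[OF c(2,3)])
  interpret S': min_tensor P "Q \<boxtimes> R" "P \<boxtimes> (Q \<boxtimes> R)" "tens \<T> P (Q \<boxtimes> R)" by (rule mt[OF c(1) S.T])
  show "F' = F"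
    by (rule hom_eqI[OF S'.T cstar_tprod[OF cstar_tprod[OF c(1,2)] c(3)]
          S'.dense_tensors_of_dense[OF dense_span_carrier[OF c(1)] S.dense_tensors]])
      (use F F' in \<open>auto simp: S.tensors_def\<close>)
qed (use F in auto)

end

locale coordinate_tensor_system = minimal_tensor_system \<T> + coordinate_algebra B n e \<omega>
  for \<T> :: "'u tensor_system" (structure) and B :: "'u cstar_alg" and n e \<omega> +
  assumes infinite: "infinite (UNIV :: 'u set)"
begin

lemma cB: "cstar_algebra B" ..

lemma \<omega>_one: "k \<in> {1..n} \<Longrightarrow> \<omega> k \<one>\<^bsub>B\<^esub> = 1"
  using character by (simp add: character_def)

lemma one_projection:
  assumes "cstar_algebra P"
  shows "\<one>\<^bsub>P\<^esub> \<in> carrier P" "star P \<one>\<^bsub>P\<^esub> = \<one>\<^bsub>P\<^esub>" "\<one>\<^bsub>P\<^esub> \<otimes>\<^bsub>P\<^esub> \<one>\<^bsub>P\<^esub> = \<one>\<^bsub>P\<^esub>" "x \<in> carrier P \<Longrightarrow> 1 \<odot>\<^bsub>P\<^esub> x = x"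
  using ring.ring_simprules(6,12)[OF cstar_algebra.is_ring[OF assms]] cstar_algebra.star_one[OF assms]
    cstar_algebra.one_smult[OF assms] by auto

lemma e_projection: "k \<in> {1..n} \<Longrightarrow> e k \<in> carrier B \<and> star B (e k) = e k \<and> e k \<otimes>\<^bsub>B\<^esub> e k = e k"
  by (simp add: e_closed e_star e_mult)

lemma slice_exists:
  assumes Q: "cstar_algebra Q" and f: "faithful Q" and k: "k \<in> {1..n}"
  shows "\<exists>S. star_morphism (B \<boxtimes> Q) Q S \<and> (\<forall>b \<in> carrier B. \<forall>q \<in> carrier Q. S (tens \<T> B Q b q) = \<omega> k b \<odot>\<^bsub>Q\<^esub> q)"
proof -
  obtain S where "star_morphism (B \<boxtimes> Q) Q S"
    "\<And>s q. (s, q) \<in> {(tens \<T> B Q b y, \<omega> k b \<odot>\<^bsub>Q\<^esub> y) | b y. b \<in> carrier B \<and> y \<in> carrier Q} \<Longrightarrow> S s = q"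
    using star_relation_faithful_morphism[OF cstar_tprod[OF cB Q] Q slice_left_relation[OF mt[OF cB Q] character[OF k]] f]
    by blast
  then show ?thesis by blast
qed

text \<open>Here \<open>J\<^sub>k\<close> is multiplication by \<open>e\<^sub>k\<close>, and \<open>\<Sum>\<^sub>k \<omega>\<^sub>k(a) b e\<^sub>k = b a = a b\<close>.\<close>

lemma mult_map:
  "mult_map \<T> B \<in> cstar_hom (B \<boxtimes> B) B"
  "\<lbrakk>a \<in> carrier B; b \<in> carrier B\<rbrakk> \<Longrightarrow> mult_map \<T> B (tens \<T> B B a b) = a \<otimes>\<^bsub>B\<^esub> b"
proof -
  interpret S: min_tensor B B "B \<boxtimes> B" "tens \<T> B B" by (rule mt[OF cB cB])
  note one = one_projection[OF cB]
  obtain S where S: "\<And>k. k \<in> {1..n} \<Longrightarrow> star_morphism (B \<boxtimes> B) B (S k)"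
    "\<And>k b q. \<lbrakk>k \<in> {1..n}; b \<in> carrier B; q \<in> carrier B\<rbrakk> \<Longrightarrow> S k (tens \<T> B B b q) = \<omega> k b \<odot>\<^bsub>B\<^esub> q"
    using slice_exists[OF cB faithful_B] by metis
  define F where "F = (\<lambda>z \<in> carrier (B \<boxtimes> B). \<Oplus>\<^bsub>B\<^esub>k\<in>{1..n}. S k z \<otimes>\<^bsub>B\<^esub> e k)"
  have "F \<in> cstar_hom (B \<boxtimes> B) B"
    unfolding F_def
  proof (rule sum_of_slices_hom[OF S.T cB cB S(1), where J = "\<lambda>k x. x \<otimes>\<^bsub>B\<^esub> e k" and L = "\<lambda>x. x"])
    fix k assume k: "k \<in> {1..n}"
    show "S k \<one>\<^bsub>B \<boxtimes> B\<^esub> = \<one>\<^bsub>B\<^esub>"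
      using S(2)[OF k one(1) one(1)] one k by (simp only: S.t_one \<omega>_one)
    show "\<one>\<^bsub>B\<^esub> \<otimes>\<^bsub>B\<^esub> e k = e k" using e_closed[OF k] by simp
    note ek = e_projection[OF k]
    have mult: "(x \<otimes>\<^bsub>B\<^esub> y) \<otimes>\<^bsub>B\<^esub> e k = (x \<otimes>\<^bsub>B\<^esub> e k) \<otimes>\<^bsub>B\<^esub> (y \<otimes>\<^bsub>B\<^esub> e k)" if "x \<in> carrier B" "y \<in> carrier B" for x y
    proof -
      have "(x \<otimes>\<^bsub>B\<^esub> e k) \<otimes>\<^bsub>B\<^esub> (y \<otimes>\<^bsub>B\<^esub> e k) = x \<otimes>\<^bsub>B\<^esub> ((e k \<otimes>\<^bsub>B\<^esub> y) \<otimes>\<^bsub>B\<^esub> e k)"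
        using that ek by (simp add: B.m_assoc B.m_closed)
      also have "\<dots> = x \<otimes>\<^bsub>B\<^esub> ((y \<otimes>\<^bsub>B\<^esub> e k) \<otimes>\<^bsub>B\<^esub> e k)"
        using that ek commute[of "e k" y] by simp
      finally show ?thesis using that ek by (simp add: B.m_assoc B.m_closed)
    qed
    show "star_morphism B B (\<lambda>x. x \<otimes>\<^bsub>B\<^esub> e k)"
      unfolding star_morphism_def
      using ek mult commute[of "e k"] by (auto simp: B.m_closed B.l_distr B.smult_mult_left B.star_mult)
  qed (auto intro: star_morphism_id)
  moreover have "F (tens \<T> B B a b) = a \<otimes>\<^bsub>B\<^esub> b" if ab: "a \<in> carrier B" "b \<in> carrier B" for a b
  proof -
    have "F (tens \<T> B B a b) = (\<Oplus>\<^bsub>B\<^esub>k\<in>{1..n}. (\<omega> k a \<odot>\<^bsub>B\<^esub> b) \<otimes>\<^bsub>B\<^esub> e k)"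
      unfolding F_def using ab by (simp, intro B.finsum_cong') (auto simp: S(2) B.m_closed e_closed)
    also have "\<dots> = (\<Oplus>\<^bsub>B\<^esub>k\<in>{1..n}. b \<otimes>\<^bsub>B\<^esub> (\<omega> k a \<odot>\<^bsub>B\<^esub> e k))"
      using ab by (intro B.finsum_cong') (auto simp: B.m_closed e_closed B.smult_mult_left B.smult_mult_right)
    also have "\<dots> = b \<otimes>\<^bsub>B\<^esub> a"
      by (rule sum_expand[OF cB ab(1)]) (use ab in \<open>auto simp: B.m_closed B.r_distr\<close>)
    finally show ?thesis using commute[OF ab] by simp
  qed
  ultimately show "mult_map \<T> B \<in> cstar_hom (B \<boxtimes> B) B"
    "\<lbrakk>a \<in> carrier B; b \<in> carrier B\<rbrakk> \<Longrightarrow> mult_map \<T> B (tens \<T> B B a b) = a \<otimes>\<^bsub>B\<^esub> b"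
    unfolding mult_map_def using hom_of_tensors[OF cB cB cB, of F] by blast+
qed

text \<open>Evaluation of \<open>B\<close> at \<open>k\<close> maps \<open>(B \<otimes> C) \<otimes> D\<close> to \<open>C \<otimes> D\<close>, from where \<open>w \<mapsto> e\<^sub>k \<otimes> w\<close> leads to the other bracketing.
  Re-bracketing is thus reduced to functoriality. The same idea gives the inverse associators below.\<close>

lemma assoc_left:
  assumes C: "cstar_algebra C" and D: "cstar_algebra D"
  shows "assoc_map \<T> B C D \<in> cstar_hom ((B \<boxtimes> C) \<boxtimes> D) (B \<boxtimes> (C \<boxtimes> D))"
    and "\<lbrakk>b \<in> carrier B; c \<in> carrier C; d \<in> carrier D\<rbrakk> \<Longrightarrow>
      assoc_map \<T> B C D (tens \<T> (B \<boxtimes> C) D (tens \<T> B C b c) d) = tens \<T> B (C \<boxtimes> D) b (tens \<T> C D c d)"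
proof -
  interpret BC: min_tensor B C "B \<boxtimes> C" "tens \<T> B C" by (rule mt[OF cB C])
  interpret CD: min_tensor C D "C \<boxtimes> D" "tens \<T> C D" by (rule mt[OF C D])
  interpret BCD: min_tensor "B \<boxtimes> C" D "(B \<boxtimes> C) \<boxtimes> D" "tens \<T> (B \<boxtimes> C) D" by (rule mt[OF BC.T D])
  interpret E: min_tensor B "C \<boxtimes> D" "B \<boxtimes> (C \<boxtimes> D)" "tens \<T> B (C \<boxtimes> D)" by (rule mt[OF cB CD.T])
  note oneB = one_projection[OF cB] and oneC = one_projection[OF C] and oneD = one_projection[OF D]
    and oneCD = one_projection[OF CD.T]
  have "\<exists>S. star_morphism ((B \<boxtimes> C) \<boxtimes> D) (C \<boxtimes> D) S \<and>
    (\<forall>b \<in> carrier B. \<forall>c \<in> carrier C. \<forall>d \<in> carrier D.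
      S (tens \<T> (B \<boxtimes> C) D (tens \<T> B C b c) d) = \<omega> k b \<odot>\<^bsub>C \<boxtimes> D\<^esub> tens \<T> C D c d)" if k: "k \<in> {1..n}" for k
  proof -
    obtain S where S: "star_morphism ((B \<boxtimes> C) \<boxtimes> D) (C \<boxtimes> D) S" "S \<in> extensional (carrier ((B \<boxtimes> C) \<boxtimes> D))"
      "\<And>x x' y y'. \<lbrakk>(x, x') \<in> {(tens \<T> B C b y, \<omega> k b \<odot>\<^bsub>C\<^esub> y) | b y. b \<in> carrier B \<and> y \<in> carrier C};
        (y, y') \<in> {(y, y) | y. y \<in> carrier D}\<rbrakk> \<Longrightarrow> S (tens \<T> (B \<boxtimes> C) D x y) = tens \<T> C D x' y'"
    proof (rule tensor_relation_morphism[OF mt[OF BC.T D] mt[OF C D]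
            slice_left_relation[OF mt[OF cB C] character[OF k]] star_relation_graph[OF D star_morphism_id]])
      fix F assume F: "star_morphism ((B \<boxtimes> C) \<boxtimes> D) (C \<boxtimes> D) F" "F \<in> extensional (carrier ((B \<boxtimes> C) \<boxtimes> D))"
        "\<And>x x' y y'. \<lbrakk>(x, x') \<in> {(tens \<T> B C b y, \<omega> k b \<odot>\<^bsub>C\<^esub> y) | b y. b \<in> carrier B \<and> y \<in> carrier C}; (y, y') \<in> {(y, y) | y. y \<in> carrier D}\<rbrakk> \<Longrightarrow> F (tens \<T> (B \<boxtimes> C) D x y) = tens \<T> C D x' y'"
      show thesis by (rule that[OF F(1,2)]) (rule F(3))
    qed
    have "S (tens \<T> (B \<boxtimes> C) D (tens \<T> B C b c) d) = tens \<T> C D (\<omega> k b \<odot>\<^bsub>C\<^esub> c) d"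
      if "b \<in> carrier B" "c \<in> carrier C" "d \<in> carrier D" for b c d
      by (rule S(3)) (use that in auto)
    then show ?thesis using S(1) by (auto simp: CD.t_smult_left)
  qed
  then obtain S where S: "\<And>k. k \<in> {1..n} \<Longrightarrow> star_morphism ((B \<boxtimes> C) \<boxtimes> D) (C \<boxtimes> D) (S k)"
    "\<And>k b c d. \<lbrakk>k \<in> {1..n}; b \<in> carrier B; c \<in> carrier C; d \<in> carrier D\<rbrakk> \<Longrightarrow>
      S k (tens \<T> (B \<boxtimes> C) D (tens \<T> B C b c) d) = \<omega> k b \<odot>\<^bsub>C \<boxtimes> D\<^esub> tens \<T> C D c d"
    by metis
  define F where "F = (\<lambda>z \<in> carrier ((B \<boxtimes> C) \<boxtimes> D). \<Oplus>\<^bsub>B \<boxtimes> (C \<boxtimes> D)\<^esub>k\<in>{1..n}. tens \<T> B (C \<boxtimes> D) (e k) (S k z))"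
  have F: "F \<in> cstar_hom ((B \<boxtimes> C) \<boxtimes> D) (B \<boxtimes> (C \<boxtimes> D))"
    unfolding F_def
  proof (rule sum_of_slices_hom[OF BCD.T CD.T E.T S(1), where J = "\<lambda>k. tens \<T> B (C \<boxtimes> D) (e k)"])
    show "star_morphism B (B \<boxtimes> (C \<boxtimes> D)) (\<lambda>b. tens \<T> B (C \<boxtimes> D) b \<one>\<^bsub>C \<boxtimes> D\<^esub>)"
      by (rule E.embed_left) (rule oneCD)+
    fix k assume k: "k \<in> {1..n}"
    have "S k (tens \<T> (B \<boxtimes> C) D (tens \<T> B C \<one>\<^bsub>B\<^esub> \<one>\<^bsub>C\<^esub>) \<one>\<^bsub>D\<^esub>) = \<one>\<^bsub>C \<boxtimes> D\<^esub>"
      using S(2)[OF k oneB(1) oneC(1) oneD(1)] k oneCD by (simp only: \<omega>_one CD.t_one)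
    then show "S k \<one>\<^bsub>(B \<boxtimes> C) \<boxtimes> D\<^esub> = \<one>\<^bsub>C \<boxtimes> D\<^esub>"
      by (simp only: BC.t_one BCD.t_one)
    show "star_morphism (C \<boxtimes> D) (B \<boxtimes> (C \<boxtimes> D)) (tens \<T> B (C \<boxtimes> D) (e k))"
      using e_projection[OF k] by (intro E.embed_right) auto
  qed (simp_all only: E.t_one)
  have F_eq: "F (tens \<T> (B \<boxtimes> C) D (tens \<T> B C b c) d) = tens \<T> B (C \<boxtimes> D) b (tens \<T> C D c d)"
    if bcd: "b \<in> carrier B" "c \<in> carrier C" "d \<in> carrier D" for b c d
  proof -
    have "F (tens \<T> (B \<boxtimes> C) D (tens \<T> B C b c) d) =
      (\<Oplus>\<^bsub>B \<boxtimes> (C \<boxtimes> D)\<^esub>k\<in>{1..n}. tens \<T> B (C \<boxtimes> D) (\<omega> k b \<odot>\<^bsub>B\<^esub> e k) (tens \<T> C D c d))"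
      unfolding F_def using bcd
      by (simp, intro E.T.finsum_cong') (auto simp: S(2) e_closed E.t_smult_left E.t_smult_right)
    also have "\<dots> = tens \<T> B (C \<boxtimes> D) b (tens \<T> C D c d)"
      by (rule sum_expand[OF E.T bcd(1)]) (use bcd in \<open>auto simp: E.t_add_left E.t_zero_left\<close>)
    finally show ?thesis .
  qed
  have "assoc_map \<T> B C D = F"
    by (rule assoc_map[OF cB C D F F_eq])
  then show "assoc_map \<T> B C D \<in> cstar_hom ((B \<boxtimes> C) \<boxtimes> D) (B \<boxtimes> (C \<boxtimes> D))"
    "\<lbrakk>b \<in> carrier B; c \<in> carrier C; d \<in> carrier D\<rbrakk> \<Longrightarrow>
      assoc_map \<T> B C D (tens \<T> (B \<boxtimes> C) D (tens \<T> B C b c) d) = tens \<T> B (C \<boxtimes> D) b (tens \<T> C D c d)"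
    using F F_eq by auto
qed

lemma assoc_inv_middle:
  assumes C: "cstar_algebra C" and D: "cstar_algebra D"
  shows "assoc_inv_map \<T> C B D \<in> cstar_hom (C \<boxtimes> (B \<boxtimes> D)) ((C \<boxtimes> B) \<boxtimes> D)"
    and "\<lbrakk>c \<in> carrier C; b \<in> carrier B; d \<in> carrier D\<rbrakk> \<Longrightarrow>
      assoc_inv_map \<T> C B D (tens \<T> C (B \<boxtimes> D) c (tens \<T> B D b d)) = tens \<T> (C \<boxtimes> B) D (tens \<T> C B c b) d"
proof -
  interpret BD: min_tensor B D "B \<boxtimes> D" "tens \<T> B D" by (rule mt[OF cB D])
  interpret CB: min_tensor C B "C \<boxtimes> B" "tens \<T> C B" by (rule mt[OF C cB])
  interpret CD: min_tensor C D "C \<boxtimes> D" "tens \<T> C D" by (rule mt[OF C D])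
  interpret CBD: min_tensor C "B \<boxtimes> D" "C \<boxtimes> (B \<boxtimes> D)" "tens \<T> C (B \<boxtimes> D)" by (rule mt[OF C BD.T])
  interpret E: min_tensor "C \<boxtimes> B" D "(C \<boxtimes> B) \<boxtimes> D" "tens \<T> (C \<boxtimes> B) D" by (rule mt[OF CB.T D])
  note oneB = one_projection[OF cB] and oneC = one_projection[OF C] and oneD = one_projection[OF D]
    and oneCD = one_projection[OF CD.T]
  have "\<exists>S. star_morphism (C \<boxtimes> (B \<boxtimes> D)) (C \<boxtimes> D) S \<and>
    (\<forall>b \<in> carrier B. \<forall>c \<in> carrier C. \<forall>d \<in> carrier D.
      S (tens \<T> C (B \<boxtimes> D) c (tens \<T> B D b d)) = \<omega> k b \<odot>\<^bsub>C \<boxtimes> D\<^esub> tens \<T> C D c d)" if k: "k \<in> {1..n}" for k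
  proof -
    obtain S where S: "star_morphism (C \<boxtimes> (B \<boxtimes> D)) (C \<boxtimes> D) S" "S \<in> extensional (carrier (C \<boxtimes> (B \<boxtimes> D)))"
      "\<And>x x' y y'. \<lbrakk>(x, x') \<in> {(x, x) | x. x \<in> carrier C};
        (y, y') \<in> {(tens \<T> B D b y, \<omega> k b \<odot>\<^bsub>D\<^esub> y) | b y. b \<in> carrier B \<and> y \<in> carrier D}\<rbrakk>
        \<Longrightarrow> S (tens \<T> C (B \<boxtimes> D) x y) = tens \<T> C D x' y'"
    proof (rule tensor_relation_morphism[OF mt[OF C BD.T] mt[OF C D] star_relation_graph[OF C star_morphism_id]
            slice_left_relation[OF mt[OF cB D] character[OF k]]])
      fix F assume F: "star_morphism (C \<boxtimes> (B \<boxtimes> D)) (C \<boxtimes> D) F" "F \<in> extensional (carrier (C \<boxtimes> (B \<boxtimes> D)))"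
        "\<And>x x' y y'. \<lbrakk>(x, x') \<in> {(x, x) | x. x \<in> carrier C}; (y, y') \<in> {(tens \<T> B D b y, \<omega> k b \<odot>\<^bsub>D\<^esub> y) | b y. b \<in> carrier B \<and> y \<in> carrier D}\<rbrakk> \<Longrightarrow> F (tens \<T> C (B \<boxtimes> D) x y) = tens \<T> C D x' y'"
      show thesis by (rule that[OF F(1,2)]) (rule F(3))
    qed
    have "S (tens \<T> C (B \<boxtimes> D) c (tens \<T> B D b d)) = tens \<T> C D c (\<omega> k b \<odot>\<^bsub>D\<^esub> d)"
      if "b \<in> carrier B" "c \<in> carrier C" "d \<in> carrier D" for b c d
      by (rule S(3)) (use that in auto)
    then show ?thesis using S(1) by (auto simp: CD.t_smult_right)
  qed
  then obtain S where S: "\<And>k. k \<in> {1..n} \<Longrightarrow> star_morphism (C \<boxtimes> (B \<boxtimes> D)) (C \<boxtimes> D) (S k)"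
    "\<And>k b c d. \<lbrakk>k \<in> {1..n}; b \<in> carrier B; c \<in> carrier C; d \<in> carrier D\<rbrakk> \<Longrightarrow>
      S k (tens \<T> C (B \<boxtimes> D) c (tens \<T> B D b d)) = \<omega> k b \<odot>\<^bsub>C \<boxtimes> D\<^esub> tens \<T> C D c d"
    by metis
  have "\<exists>J. star_morphism (C \<boxtimes> D) ((C \<boxtimes> B) \<boxtimes> D) J \<and> (\<forall>c \<in> carrier C. \<forall>d \<in> carrier D.
      J (tens \<T> C D c d) = tens \<T> (C \<boxtimes> B) D (tens \<T> C B c (e k)) d)" if k: "k \<in> {1..n}" for k
    using tensor_morphism[OF mt[OF C D] mt[OF CB.T D] CB.embed_left[of "e k"] star_morphism_id] e_projection[OF k]
    by metis
  then obtain J where J: "\<And>k. k \<in> {1..n} \<Longrightarrow> star_morphism (C \<boxtimes> D) ((C \<boxtimes> B) \<boxtimes> D) (J k)"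
    "\<And>k c d. \<lbrakk>k \<in> {1..n}; c \<in> carrier C; d \<in> carrier D\<rbrakk> \<Longrightarrow>
      J k (tens \<T> C D c d) = tens \<T> (C \<boxtimes> B) D (tens \<T> C B c (e k)) d"
    by metis
  define F where "F = (\<lambda>z \<in> carrier (C \<boxtimes> (B \<boxtimes> D)). \<Oplus>\<^bsub>(C \<boxtimes> B) \<boxtimes> D\<^esub>k\<in>{1..n}. J k (S k z))"
  have F: "F \<in> cstar_hom (C \<boxtimes> (B \<boxtimes> D)) ((C \<boxtimes> B) \<boxtimes> D)"
    unfolding F_def
  proof (rule sum_of_slices_hom[OF CBD.T CD.T E.T S(1) _ J(1)])
    show "star_morphism B ((C \<boxtimes> B) \<boxtimes> D) (\<lambda>b. tens \<T> (C \<boxtimes> B) D (tens \<T> C B \<one>\<^bsub>C\<^esub> b) \<one>\<^bsub>D\<^esub>)"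
      by (rule star_morphism_comp[OF CB.embed_right E.embed_left]) (rule oneC oneD)+
    fix k assume k: "k \<in> {1..n}"
    have "S k (tens \<T> C (B \<boxtimes> D) \<one>\<^bsub>C\<^esub> (tens \<T> B D \<one>\<^bsub>B\<^esub> \<one>\<^bsub>D\<^esub>)) = \<one>\<^bsub>C \<boxtimes> D\<^esub>"
      using S(2)[OF k oneB(1) oneC(1) oneD(1)] k oneCD by (simp only: \<omega>_one CD.t_one)
    then show "S k \<one>\<^bsub>C \<boxtimes> (B \<boxtimes> D)\<^esub> = \<one>\<^bsub>C \<boxtimes> D\<^esub>"
      by (simp only: BD.t_one CBD.t_one)
    show "J k \<one>\<^bsub>C \<boxtimes> D\<^esub> = tens \<T> (C \<boxtimes> B) D (tens \<T> C B \<one>\<^bsub>C\<^esub> (e k)) \<one>\<^bsub>D\<^esub>"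
      using J(2)[OF k oneC(1) oneD(1)] by (simp only: CD.t_one)
  qed (simp_all only: E.t_one CB.t_one)
  have F_eq: "F (tens \<T> C (B \<boxtimes> D) c (tens \<T> B D b d)) = tens \<T> (C \<boxtimes> B) D (tens \<T> C B c b) d"
    if bcd: "c \<in> carrier C" "b \<in> carrier B" "d \<in> carrier D" for b c d
  proof -
    have "F (tens \<T> C (B \<boxtimes> D) c (tens \<T> B D b d)) =
      (\<Oplus>\<^bsub>(C \<boxtimes> B) \<boxtimes> D\<^esub>k\<in>{1..n}. tens \<T> (C \<boxtimes> B) D (tens \<T> C B c (\<omega> k b \<odot>\<^bsub>B\<^esub> e k)) d)"
      unfolding F_def using bcd
      by (simp, intro E.T.finsum_cong')
        (auto simp: S(2) J(2) e_closed E.t_smult_left CB.t_smult_right star_morphismD(4)[OF J(1)])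
    also have "\<dots> = tens \<T> (C \<boxtimes> B) D (tens \<T> C B c b) d"
      by (rule sum_expand[OF E.T bcd(2)])
        (use bcd in \<open>auto simp: E.t_add_left E.t_zero_left CB.t_add_right CB.t_zero_right\<close>)
    finally show ?thesis .
  qed
  have "assoc_inv_map \<T> C B D = F"
    by (rule assoc_inv_map[OF C cB D F F_eq])
  then show "assoc_inv_map \<T> C B D \<in> cstar_hom (C \<boxtimes> (B \<boxtimes> D)) ((C \<boxtimes> B) \<boxtimes> D)"
    "\<lbrakk>c \<in> carrier C; b \<in> carrier B; d \<in> carrier D\<rbrakk> \<Longrightarrow>
      assoc_inv_map \<T> C B D (tens \<T> C (B \<boxtimes> D) c (tens \<T> B D b d)) = tens \<T> (C \<boxtimes> B) D (tens \<T> C B c b) d"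
    using F F_eq by auto
qed

lemma assoc_inv_left:
  assumes D: "cstar_algebra D"
  shows "assoc_inv_map \<T> B B D \<in> cstar_hom (B \<boxtimes> (B \<boxtimes> D)) ((B \<boxtimes> B) \<boxtimes> D)"
    and "\<lbrakk>a \<in> carrier B; b \<in> carrier B; d \<in> carrier D\<rbrakk> \<Longrightarrow>
      assoc_inv_map \<T> B B D (tens \<T> B (B \<boxtimes> D) a (tens \<T> B D b d)) = tens \<T> (B \<boxtimes> B) D (tens \<T> B B a b) d"
  using assoc_inv_middle[OF cB D] by auto

end

section \<open>Comparison of the two comultiplications\<close>

lemma id_hom_apply: "x \<in> carrier P \<Longrightarrow> id_hom P x = x"
  by (simp add: id_hom_def)

context coordinate_tensor_system
begin

lemma middle_flip_map:
  assumes C: "cstar_algebra C"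
  shows "star_morphism ((B \<boxtimes> C) \<boxtimes> (B \<boxtimes> C)) ((B \<boxtimes> B) \<boxtimes> (C \<boxtimes> C)) (middle_flip_map \<T> B C)"
    and "\<lbrakk>b \<in> carrier B; c \<in> carrier C; b' \<in> carrier B; c' \<in> carrier C\<rbrakk> \<Longrightarrow>
      middle_flip_map \<T> B C (tens \<T> (B \<boxtimes> C) (B \<boxtimes> C) (tens \<T> B C b c) (tens \<T> B C b' c')) =
      tens \<T> (B \<boxtimes> B) (C \<boxtimes> C) (tens \<T> B B b b') (tens \<T> C C c c')"
proof -
  note BC = cstar_tprod[OF cB C] and CB = cstar_tprod[OF C cB] and CC = cstar_tprod[OF C C]
  note C_BC = cstar_tprod[OF C BC] and CB_C = cstar_tprod[OF CB C] and BC_C = cstar_tprod[OF BC C]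
    and B_CC = cstar_tprod[OF cB CC]
  note idB = id_hom[OF cB] and idC = id_hom[OF C]
  note f1 = assoc_left[OF C BC] and a2 = assoc_inv_middle[OF C C] and fl = flip_map[OF C cB]
    and a4 = assoc_left[OF C C] and f5 = assoc_inv_left[OF CC]
  note f2 = tensor_map[OF cB C_BC cB CB_C idB a2(1)]
  note g3 = tensor_map[OF CB C BC C fl(1) idC]
  note f3 = tensor_map[OF cB CB_C cB BC_C idB g3(1)]
  note f4 = tensor_map[OF cB BC_C cB B_CC idB a4(1)]
  have m: "\<phi> \<in> cstar_hom P Q \<Longrightarrow> star_morphism P Q \<phi>" for \<phi> and P Q :: "'u cstar_alg"
    by (simp add: cstar_hom_iff)
  show "star_morphism ((B \<boxtimes> C) \<boxtimes> (B \<boxtimes> C)) ((B \<boxtimes> B) \<boxtimes> (C \<boxtimes> C)) (middle_flip_map \<T> B C)"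
    unfolding middle_flip_map_def comp_def
    by (rule star_morphism_comp[OF star_morphism_comp[OF star_morphism_comp[OF star_morphism_comp[OF
          m[OF f1(1)] m[OF f2(1)]] m[OF f3(1)]] m[OF f4(1)]] m[OF f5(1)]])
  have t: "\<lbrakk>p \<in> carrier P; q \<in> carrier Q; cstar_algebra P; cstar_algebra Q\<rbrakk> \<Longrightarrow> tens \<T> P Q p q \<in> carrier (P \<boxtimes> Q)" for P Q p q
    using min_tensor.t_closed[OF mt] .
  show "middle_flip_map \<T> B C (tens \<T> (B \<boxtimes> C) (B \<boxtimes> C) (tens \<T> B C b c) (tens \<T> B C b' c')) =
      tens \<T> (B \<boxtimes> B) (C \<boxtimes> C) (tens \<T> B B b b') (tens \<T> C C c c')"
    if "b \<in> carrier B" "c \<in> carrier C" "b' \<in> carrier B" "c' \<in> carrier C"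
    unfolding middle_flip_map_def comp_def using that
    by (simp add: t cB C BC CB CC C_BC CB_C BC_C B_CC f1(2) f2(2) a2(2) f3(2) g3(2) fl(2) f4(2) a4(2) f5(2) id_hom_apply)
qed

text \<open>The canonical map \<open>B \<otimes> E \<rightarrow> E\<^sup>n\<close> is injective: this is where the components of the defining identity of
  \<open>\<Gamma>\<close> are read off.\<close>

lemma components_eq:
  assumes P: "cstar_algebra P" and Q: "cstar_algebra Q"
    and x: "\<And>k. k \<in> {1..n} \<Longrightarrow> x k \<in> carrier (P \<boxtimes> Q)" and y: "\<And>k. k \<in> {1..n} \<Longrightarrow> y k \<in> carrier (P \<boxtimes> Q)"
    and eq: "(\<Oplus>\<^bsub>B \<boxtimes> (P \<boxtimes> Q)\<^esub>k\<in>{1..n}. tens \<T> B (P \<boxtimes> Q) (e k) (x k)) =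
      (\<Oplus>\<^bsub>B \<boxtimes> (P \<boxtimes> Q)\<^esub>k\<in>{1..n}. tens \<T> B (P \<boxtimes> Q) (e k) (y k))"
    and k: "k \<in> {1..n}"
  shows "x k = y k"
proof -
  interpret PQ: min_tensor P Q "P \<boxtimes> Q" "tens \<T> P Q" by (rule mt[OF P Q])
  interpret E: min_tensor B "P \<boxtimes> Q" "B \<boxtimes> (P \<boxtimes> Q)" "tens \<T> B (P \<boxtimes> Q)" by (rule mt[OF cB PQ.T])
  obtain S where S: "star_morphism (B \<boxtimes> (P \<boxtimes> Q)) (P \<boxtimes> Q) S"
    "\<And>b q. \<lbrakk>b \<in> carrier B; q \<in> carrier (P \<boxtimes> Q)\<rbrakk> \<Longrightarrow> S (tens \<T> B (P \<boxtimes> Q) b q) = \<omega> k b \<odot>\<^bsub>P \<boxtimes> Q\<^esub> q"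
    using slice_exists[OF PQ.T PQ.faithful_tensor_product[OF infinite] k] by blast
  have component: "S (\<Oplus>\<^bsub>B \<boxtimes> (P \<boxtimes> Q)\<^esub>l\<in>{1..n}. tens \<T> B (P \<boxtimes> Q) (e l) (z l)) = z k"
    if z: "\<And>l. l \<in> {1..n} \<Longrightarrow> z l \<in> carrier (P \<boxtimes> Q)" for z
  proof -
    have "S (\<Oplus>\<^bsub>B \<boxtimes> (P \<boxtimes> Q)\<^esub>l\<in>{1..n}. tens \<T> B (P \<boxtimes> Q) (e l) (z l)) =
        (\<Oplus>\<^bsub>P \<boxtimes> Q\<^esub>l\<in>{1..n}. S (tens \<T> B (P \<boxtimes> Q) (e l) (z l)))"
      by (rule star_morphism_finsum[OF E.T PQ.T S(1)]) (auto simp: e_closed z)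
    also have "\<dots> = (\<Oplus>\<^bsub>P \<boxtimes> Q\<^esub>l\<in>{1..n}. if k = l then z l else \<zero>\<^bsub>P \<boxtimes> Q\<^esub>)"
      by (rule PQ.T.finsum_cong') (use k in \<open>auto simp: S(2) e_closed z \<omega>_e\<close>)
    also have "\<dots> = z k"
      by (rule PQ.T.finsum_singleton[OF k]) (auto simp: z)
    finally show ?thesis .
  qed
  show ?thesis
    using component[of x, OF x] component[of y, OF y] by (simp only: eq)
qed

lemma all_maps_family_hom:
  assumes A: "cstar_algebra A" and C: "cstar_algebra C" and \<iota>: "\<And>k. k \<in> {1..n} \<Longrightarrow> \<iota> k \<in> cstar_hom A C"
  shows "all_maps_family \<T> A n B e C \<iota> \<in> cstar_hom A (B \<boxtimes> C)"
proof -
  interpret BC: min_tensor B C "B \<boxtimes> C" "tens \<T> B C" by (rule mt[OF cB C])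
  have \<iota>': "star_morphism A C (\<iota> k)" "\<iota> k \<one>\<^bsub>A\<^esub> = \<one>\<^bsub>C\<^esub>" if "k \<in> {1..n}" for k
    using \<iota>[OF that] by (auto simp: cstar_hom_iff)
  show ?thesis
    unfolding all_maps_family_def
  proof (rule sum_of_slices_hom[OF A C BC.T \<iota>', where J = "\<lambda>k. tens \<T> B C (e k)"])
    show "star_morphism B (B \<boxtimes> C) (\<lambda>b. tens \<T> B C b \<one>\<^bsub>C\<^esub>)"
      by (rule BC.embed_left) (rule one_projection[OF C])+
    show "star_morphism C (B \<boxtimes> C) (tens \<T> B C (e k))" if "k \<in> {1..n}" for k
      using e_projection[OF that] by (intro BC.embed_right) auto
  qed (auto simp: BC.t_one)
qed

text \<open>On elementary tensors \<open>a \<otimes> a'\<close> the composition on the right-hand side gives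
  \<open>\<Sum>\<^sub>k\<^sub>l e\<^sub>k e\<^sub>l \<otimes> \<iota>\<^sub>k(a) \<otimes> \<iota>\<^sub>l(a') = \<Sum>\<^sub>k e\<^sub>k \<otimes> (\<iota>\<^sub>k \<otimes> \<iota>\<^sub>k)(a \<otimes> a')\<close>. Both ends of this are values of
  homomorphisms of \<open>A \<otimes> A\<close>, which therefore agree at \<open>\<Delta>\<^sub>A(a)\<close> too.\<close>

lemma component_formula:
  assumes A: "cstar_algebra A" and C: "cstar_algebra C" and \<iota>: "\<And>k. k \<in> {1..n} \<Longrightarrow> \<iota> k \<in> cstar_hom A C"
    and \<Phi>: "\<Phi> = all_maps_family \<T> A n B e C \<iota>"
    and \<Delta>\<^sub>A: "\<Delta>\<^sub>A \<in> cstar_hom A (A \<boxtimes> A)" and \<Gamma>: "\<Gamma> \<in> cstar_hom C (C \<boxtimes> C)"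
    and a: "a \<in> carrier A"
    and eq: "tensor_map \<T> B B C (C \<boxtimes> C) (id_hom B) \<Gamma> (\<Phi> a) =
           (tensor_map \<T> (B \<boxtimes> B) B (C \<boxtimes> C) (C \<boxtimes> C) (mult_map \<T> B) (id_hom (C \<boxtimes> C))
            \<circ> middle_flip_map \<T> B C
            \<circ> tensor_map \<T> A (B \<boxtimes> C) A (B \<boxtimes> C) \<Phi> \<Phi>
            \<circ> \<Delta>\<^sub>A) a"
    and k: "k \<in> {1..n}"
  shows "\<Gamma> (\<iota> k a) = tensor_map \<T> A C A C (\<iota> k) (\<iota> k) (\<Delta>\<^sub>A a)"
proof -
  interpret AA: min_tensor A A "A \<boxtimes> A" "tens \<T> A A" by (rule mt[OF A A])
  interpret BB: min_tensor B B "B \<boxtimes> B" "tens \<T> B B" by (rule mt[OF cB cB])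
  interpret BC: min_tensor B C "B \<boxtimes> C" "tens \<T> B C" by (rule mt[OF cB C])
  interpret CC: min_tensor C C "C \<boxtimes> C" "tens \<T> C C" by (rule mt[OF C C])
  interpret BCBC: min_tensor "B \<boxtimes> C" "B \<boxtimes> C" "(B \<boxtimes> C) \<boxtimes> (B \<boxtimes> C)" "tens \<T> (B \<boxtimes> C) (B \<boxtimes> C)" by (rule mt[OF BC.T BC.T])
  interpret BE: min_tensor B "C \<boxtimes> C" "B \<boxtimes> (C \<boxtimes> C)" "tens \<T> B (C \<boxtimes> C)" by (rule mt[OF cB CC.T])
  let ?E = "B \<boxtimes> (C \<boxtimes> C)"
  have \<iota>': "star_morphism A C (\<iota> k)" "\<iota> k \<one>\<^bsub>A\<^esub> = \<one>\<^bsub>C\<^esub>" if "k \<in> {1..n}" for k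
    using \<iota>[OF that] by (auto simp: cstar_hom_iff)
  note \<iota>c = star_morphismD(1)[OF \<iota>'(1)]
  have \<Delta>a: "\<Delta>\<^sub>A a \<in> carrier (A \<boxtimes> A)" and \<Gamma>m: "star_morphism C (C \<boxtimes> C) \<Gamma>"
    using \<Delta>\<^sub>A \<Gamma> a by (auto simp: cstar_hom_iff star_morphism_def)
  have \<Phi>_hom: "\<Phi> \<in> cstar_hom A (B \<boxtimes> C)"
    unfolding \<Phi> by (rule all_maps_family_hom[OF A C \<iota>])
  have \<Phi>_eq: "\<Phi> x = (\<Oplus>\<^bsub>B \<boxtimes> C\<^esub>l\<in>{1..n}. tens \<T> B C (e l) (\<iota> l x))" if "x \<in> carrier A" for x
    using that by (simp add: \<Phi> all_maps_family_def)
  define M where "M = tensor_map \<T> (B \<boxtimes> B) B (C \<boxtimes> C) (C \<boxtimes> C) (mult_map \<T> B) (id_hom (C \<boxtimes> C))"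
  define m where "m = (\<lambda>z. M (middle_flip_map \<T> B C z))"
  define PP where "PP = tensor_map \<T> A (B \<boxtimes> C) A (B \<boxtimes> C) \<Phi> \<Phi>"
  define II where "II k = tensor_map \<T> A C A C (\<iota> k) (\<iota> k)" for k
  note M' = tensor_map[OF BB.T CC.T cB CC.T mult_map(1) id_hom[OF CC.T], folded M_def]
  note PP = tensor_map[OF A A BC.T BC.T \<Phi>_hom \<Phi>_hom, folded PP_def]
  have II: "II l \<in> cstar_hom (A \<boxtimes> A) (C \<boxtimes> C)"
    "\<lbrakk>x \<in> carrier A; y \<in> carrier A\<rbrakk> \<Longrightarrow> II l (tens \<T> A A x y) = tens \<T> C C (\<iota> l x) (\<iota> l y)" if "l \<in> {1..n}" for l x y
    unfolding II_def by (rule tensor_map[OF A A C C \<iota>[OF that] \<iota>[OF that]]; assumption)+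
  have mm: "star_morphism ((B \<boxtimes> C) \<boxtimes> (B \<boxtimes> C)) ?E m"
    unfolding m_def by (rule star_morphism_comp[OF middle_flip_map(1)[OF C]]) (use M'(1) in \<open>simp add: cstar_hom_iff\<close>)
  have m_tens: "m (tens \<T> (B \<boxtimes> C) (B \<boxtimes> C) (tens \<T> B C b c) (tens \<T> B C b' c')) =
      tens \<T> B (C \<boxtimes> C) (b \<otimes>\<^bsub>B\<^esub> b') (tens \<T> C C c c')"
    if "b \<in> carrier B" "c \<in> carrier C" "b' \<in> carrier B" "c' \<in> carrier C" for b c b' c'
    using that by (simp add: m_def middle_flip_map(2)[OF C] M'(2) mult_map(2) id_hom_apply)
  let ?H = "\<lambda>z. \<Oplus>\<^bsub>?E\<^esub>l\<in>{1..n}. tens \<T> B (C \<boxtimes> C) (e l) (II l z)"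
  have H: "(\<lambda>z \<in> carrier (A \<boxtimes> A). ?H z) \<in> cstar_hom (A \<boxtimes> A) ?E"
  proof (rule sum_of_slices_hom[OF AA.T CC.T BE.T, where S = II and J = "\<lambda>k. tens \<T> B (C \<boxtimes> C) (e k)"])
    show "star_morphism B ?E (\<lambda>b. tens \<T> B (C \<boxtimes> C) b \<one>\<^bsub>C \<boxtimes> C\<^esub>)"
      by (rule BE.embed_left) (rule one_projection[OF CC.T])+
    fix l assume l: "l \<in> {1..n}"
    show "star_morphism (C \<boxtimes> C) ?E (tens \<T> B (C \<boxtimes> C) (e l))"
      using e_projection[OF l] by (intro BE.embed_right) auto
    show "star_morphism (A \<boxtimes> A) (C \<boxtimes> C) (II l)" "II l \<one>\<^bsub>A \<boxtimes> A\<^esub> = \<one>\<^bsub>C \<boxtimes> C\<^esub>"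
      using II(1)[OF l] by (auto simp: cstar_hom_iff)
  qed (auto simp: BE.t_one)

  \<comment> \<open>The cross terms \<open>e\<^sub>k e\<^sub>l\<close> with \<open>k \<noteq> l\<close> vanish; so the multiplication of \<open>B\<close> turns the square of the family \<open>\<Phi>\<close> into a
    family over the diagonal.\<close>
  have diagonal: "m (PP (tens \<T> A A x y)) = ?H (tens \<T> A A x y)" if x: "x \<in> carrier A" and y: "y \<in> carrier A" for x y
  proof -
    have c: "tens \<T> B C (e l) (\<iota> l x) \<in> carrier (B \<boxtimes> C)" if "l \<in> {1..n}" "x \<in> carrier A" for l x
      using that e_closed \<iota>c by auto
    have \<Phi>c: "\<Phi> x \<in> carrier (B \<boxtimes> C)" if "x \<in> carrier A" for x
      using \<Phi>_hom that by (auto simp: cstar_hom_iff star_morphism_def)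
    note mD = star_morphismD[OF mm] and m0 = star_morphism_zero[OF BCBC.T BE.T mm]
    have "m (PP (tens \<T> A A x y)) = m (tens \<T> (B \<boxtimes> C) (B \<boxtimes> C) (\<Phi> x) (\<Phi> y))"
      using x y by (simp add: PP(2))
    also have "\<dots> = (\<Oplus>\<^bsub>?E\<^esub>l\<in>{1..n}. m (tens \<T> (B \<boxtimes> C) (B \<boxtimes> C) (tens \<T> B C (e l) (\<iota> l x)) (\<Phi> y)))"
      unfolding \<Phi>_eq[OF x]
      by (rule additive_finsum[OF BC.T BE.T])
        (use c x \<Phi>c[OF y] in \<open>auto simp: BCBC.t_add_left BCBC.t_zero_left mD m0\<close>)
    also have "\<dots> = ?H (tens \<T> A A x y)"
    proof (rule BE.T.finsum_cong')
      fix l assume l: "l \<in> {1..n}"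
      let ?r = "tens \<T> B (C \<boxtimes> C) (e l) (tens \<T> C C (\<iota> l x) (\<iota> l y))"
      have rc: "?r \<in> carrier ?E" using l x y e_closed \<iota>c by auto
      have "m (tens \<T> (B \<boxtimes> C) (B \<boxtimes> C) (tens \<T> B C (e l) (\<iota> l x)) (\<Phi> y)) =
          (\<Oplus>\<^bsub>?E\<^esub>r\<in>{1..n}. m (tens \<T> (B \<boxtimes> C) (B \<boxtimes> C) (tens \<T> B C (e l) (\<iota> l x)) (tens \<T> B C (e r) (\<iota> r y))))"
        unfolding \<Phi>_eq[OF y]
        by (rule additive_finsum[OF BC.T BE.T])
          (use c[OF l x] c[OF _ y] in \<open>auto simp: BCBC.t_add_right BCBC.t_zero_right mD m0\<close>)
      also have "\<dots> = (\<Oplus>\<^bsub>?E\<^esub>r\<in>{1..n}. if l = r then ?r else \<zero>\<^bsub>?E\<^esub>)"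
        by (rule BE.T.finsum_cong') (use l x y e_closed \<iota>c rc in \<open>auto simp: m_tens e_mult BE.t_zero_left\<close>)
      also have "\<dots> = ?r"
        by (rule BE.T.finsum_singleton[OF l, where f = "\<lambda>_. ?r"]) (use rc in auto)
      finally show "m (tens \<T> (B \<boxtimes> C) (B \<boxtimes> C) (tens \<T> B C (e l) (\<iota> l x)) (\<Phi> y)) =
          tens \<T> B (C \<boxtimes> C) (e l) (II l (tens \<T> A A x y))"
        using II(2)[OF l x y] by simp
    qed (use x y e_closed \<iota>c in \<open>auto simp: II(2)\<close>)
    finally show ?thesis .
  qed
  have PPm: "star_morphism (A \<boxtimes> A) ((B \<boxtimes> C) \<boxtimes> (B \<boxtimes> C)) PP"
    using PP(1) by (simp add: cstar_hom_iff)
  have rhs: "m (PP (\<Delta>\<^sub>A a)) = ?H (\<Delta>\<^sub>A a)"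
  proof -
    have "m (PP (\<Delta>\<^sub>A a)) = (\<lambda>z \<in> carrier (A \<boxtimes> A). ?H z) (\<Delta>\<^sub>A a)"
    proof (rule AA.morphism_eqI_tensors[OF BE.T star_morphism_comp[OF PPm mm] _ _ \<Delta>a])
      show "star_morphism (A \<boxtimes> A) ?E (\<lambda>z \<in> carrier (A \<boxtimes> A). ?H z)"
        using H by (simp only: cstar_hom_iff)
      show "m (PP (tens \<T> A A x y)) = (\<lambda>z \<in> carrier (A \<boxtimes> A). ?H z) (tens \<T> A A x y)"
        if "x \<in> carrier A" "y \<in> carrier A" for x y
        using diagonal[OF that] that by (simp only: restrict_apply' AA.t_closed)
    qed
    then show ?thesis using \<Delta>a by simp
  qed
  have lhs: "tensor_map \<T> B B C (C \<boxtimes> C) (id_hom B) \<Gamma> (\<Phi> a) =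
      (\<Oplus>\<^bsub>?E\<^esub>l\<in>{1..n}. tens \<T> B (C \<boxtimes> C) (e l) (\<Gamma> (\<iota> l a)))"
  proof -
    note tm = tensor_map[OF cB C cB CC.T id_hom[OF cB] \<Gamma>]
    have tmm: "star_morphism (B \<boxtimes> C) ?E (tensor_map \<T> B B C (C \<boxtimes> C) (id_hom B) \<Gamma>)"
      using tm(1) by (simp only: cstar_hom_iff)
    have "tensor_map \<T> B B C (C \<boxtimes> C) (id_hom B) \<Gamma> (\<Phi> a) =
        (\<Oplus>\<^bsub>?E\<^esub>l\<in>{1..n}. tensor_map \<T> B B C (C \<boxtimes> C) (id_hom B) \<Gamma> (tens \<T> B C (e l) (\<iota> l a)))"
      unfolding \<Phi>_eq[OF a]
      by (rule star_morphism_finsum[OF BC.T BE.T tmm]) (use a in \<open>auto simp: e_closed \<iota>c\<close>)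
    also have "\<dots> = (\<Oplus>\<^bsub>?E\<^esub>l\<in>{1..n}. tens \<T> B (C \<boxtimes> C) (e l) (\<Gamma> (\<iota> l a)))"
      by (rule BE.T.finsum_cong')
        (use a e_closed \<iota>c star_morphismD(1)[OF \<Gamma>m] in \<open>auto simp: tm(2) id_hom_apply\<close>)
    finally show ?thesis .
  qed
  have "\<Gamma> (\<iota> k a) = II k (\<Delta>\<^sub>A a)"
  proof (rule components_eq[OF C C _ _ _ k])
    show "\<Gamma> (\<iota> l a) \<in> carrier (C \<boxtimes> C)" if "l \<in> {1..n}" for l
      using star_morphismD(1)[OF \<Gamma>m \<iota>c[OF that a]] .
    show "II l (\<Delta>\<^sub>A a) \<in> carrier (C \<boxtimes> C)" if "l \<in> {1..n}" for l
      using II(1)[OF that] \<Delta>a by (auto simp: cstar_hom_iff star_morphism_def)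
    show "(\<Oplus>\<^bsub>?E\<^esub>l\<in>{1..n}. tens \<T> B (C \<boxtimes> C) (e l) (\<Gamma> (\<iota> l a))) = ?H (\<Delta>\<^sub>A a)"
      using eq lhs rhs by (simp add: m_def M_def PP_def)
  qed
  then show ?thesis by (simp add: II_def)
qed

end

theorem proposition3p2:
  fixes \<T> :: "'u tensor_system" (structure)
    and A B C :: "'u cstar_alg"
    and \<Delta>\<^sub>A \<Gamma> \<Delta> \<Phi> :: "'u \<Rightarrow> 'u"
    and n :: nat
    and j :: "(nat \<Rightarrow> complex) \<Rightarrow> 'u"
    and e :: "nat \<Rightarrow> 'u"
    and \<iota> :: "nat \<Rightarrow> 'u \<Rightarrow> 'u"
  assumes "minimal_tensor_system \<T>"
    and "compact_quantum_semigroup \<T> A \<Delta>\<^sub>A"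
    and "finitely_generated A"
    and "cstar_algebra B"
    and "j \<in> cstar_iso (complex_power n) B"
    and "\<And>i. i \<in> {1..n} \<Longrightarrow> e i = j (unit_vec n i)"
    and "is_free_power A n C \<iota>"
    and "\<Phi> = all_maps_family \<T> A n B e C \<iota>"
    and "\<Gamma> \<in> cstar_hom C (C \<boxtimes> C)"
    and "\<And>a. a \<in> carrier A \<Longrightarrow>
           tensor_map \<T> B B C (C \<boxtimes> C) (id_hom B) \<Gamma> (\<Phi> a) =
           (tensor_map \<T> (B \<boxtimes> B) B (C \<boxtimes> C) (C \<boxtimes> C) (mult_map \<T> B) (id_hom (C \<boxtimes> C))
            \<circ> middle_flip_map \<T> B C
            \<circ> tensor_map \<T> A (B \<boxtimes> C) A (B \<boxtimes> C) \<Phi> \<Phi>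
            \<circ> \<Delta>\<^sub>A) a"
    and "\<Delta> \<in> cstar_hom C (C \<boxtimes> C)"
    and "coassociative \<T> C \<Delta>"
    and "\<And>k a. k \<in> {1..n} \<Longrightarrow> a \<in> carrier A \<Longrightarrow>
           \<Delta> (\<iota> k a) = tensor_map \<T> A C A C (\<iota> k) (\<iota> k) (\<Delta>\<^sub>A a)"
  shows "\<Gamma> = \<Delta>"
proof -
  interpret S: minimal_tensor_system \<T> by fact
  have A: "cstar_algebra A" and \<Delta>\<^sub>A: "\<Delta>\<^sub>A \<in> cstar_hom A (A \<boxtimes> A)"
    using assms(2) by (auto simp: compact_quantum_semigroup_def)
  have C: "cstar_algebra C" and \<iota>: "\<And>k. k \<in> {1..n} \<Longrightarrow> \<iota> k \<in> cstar_hom A C"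
    using assms(7) by (auto simp: is_free_power_def)
  note CC = S.cstar_tprod[OF C C]
  show ?thesis
  proof (cases "finite (UNIV :: 'u set)")
    case True
    \<comment> \<open>The carrier of a nonzero algebra is infinite; so here \<open>C \<otimes> C\<close> is the zero algebra.\<close>
    have zero: "\<phi> z = \<zero>\<^bsub>C \<boxtimes> C\<^esub>" if "\<phi> \<in> cstar_hom C (C \<boxtimes> C)" "z \<in> carrier C" for \<phi> z
      by (rule finite_universe_trivial[OF CC True]) (use that in \<open>auto simp: cstar_hom_iff star_morphism_def\<close>)
    show ?thesis
    proof (rule extensionalityI)
      show "\<Gamma> \<in> extensional (carrier C)" "\<Delta> \<in> extensional (carrier C)"
        using assms(9,11) by (simp_all add: cstar_hom_iff)
      show "\<Gamma> z = \<Delta> z" if "z \<in> carrier C" for z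
        using zero[OF assms(9) that] zero[OF assms(11) that] by simp
    qed
  next
    case False
    let ?\<omega> = "\<lambda>k b. inv_into (carrier (complex_power n)) j b k"
    interpret coordinate_algebra B n e ?\<omega>
      by (rule coordinate_algebra_iso[OF assms(4-6)])
    interpret coordinate_tensor_system \<T> B n e ?\<omega>
      by unfold_locales (rule False)
    have \<Gamma>_\<iota>: "\<Gamma> (\<iota> k a) = \<Delta> (\<iota> k a)" if "k \<in> {1..n}" "a \<in> carrier A" for k a
      using component_formula[OF A C \<iota> assms(8) \<Delta>\<^sub>A assms(9) that(2) assms(10)[OF that(2)] that(1)]
        assms(13)[OF that] by simp
    define \<psi> where "\<psi> k = (\<lambda>a \<in> carrier A. \<Gamma> (\<iota> k a))" for k
    have \<psi>: "\<psi> k \<in> cstar_hom A (C \<boxtimes> C)" if k: "k \<in> {1..n}" for k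
    proof -
      interpret A: cstar_algebra A by (rule A)
      have "star_morphism A (C \<boxtimes> C) (\<lambda>a. \<Gamma> (\<iota> k a))" "\<Gamma> (\<iota> k \<one>\<^bsub>A\<^esub>) = \<one>\<^bsub>C \<boxtimes> C\<^esub>"
        using \<iota>[OF k] assms(9) by (auto simp: cstar_hom_iff star_morphism_comp)
      then show ?thesis
        using ring.ring_simprules(6)[OF A.is_ring]
        by (simp add: \<psi>_def cstar_hom_iff star_morphism_def A.m_closed)
    qed
    have universal: "\<forall>(D :: 'u cstar_alg) \<psi>. cstar_algebra D \<and> (\<forall>k \<in> {1..n}. \<psi> k \<in> cstar_hom A D) \<longrightarrow>
        (\<exists>!\<Lambda>. \<Lambda> \<in> cstar_hom C D \<and> (\<forall>k \<in> {1..n}. \<forall>a \<in> carrier A. \<Lambda> (\<iota> k a) = \<psi> k a))"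
      by (rule conjunct2[OF conjunct2[OF assms(7)[unfolded is_free_power_def]]])
    have "\<exists>!\<Lambda>. \<Lambda> \<in> cstar_hom C (C \<boxtimes> C) \<and> (\<forall>k \<in> {1..n}. \<forall>a \<in> carrier A. \<Lambda> (\<iota> k a) = \<psi> k a)"
      by (rule mp[OF spec[OF spec[OF universal]]]) (intro conjI ballI CC \<psi>)
    moreover have "\<forall>k \<in> {1..n}. \<forall>a \<in> carrier A. \<Gamma> (\<iota> k a) = \<psi> k a" "\<forall>k \<in> {1..n}. \<forall>a \<in> carrier A. \<Delta> (\<iota> k a) = \<psi> k a"
      by (simp_all add: \<psi>_def \<Gamma>_\<iota>)
    ultimately show ?thesis using assms(9,11) by blast
  qed
qed

end
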